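(* Let $q$ be a prime power, let $n \geq 3$ be an integer, and let $m_1, m_2$ be positive integers. If $$q^{\frac{n}{2}} \geq (m_1 + m_2+1)\, W(q^n-1)^2\, W_q(x^n-1),$$ then for each $f \in \Upsilon_{q^n}(m_1,m_2)$ there exists $\alpha \in \mathbb{F}_{q^n}$, primitive and normal over $\mathbb{F}_q$, such that $f(\alpha) \in \mathbb{F}_{q^n}$ is also a primitive element.
   Context: An element of a finite field $\mathbb{F}_{q^n}$ is primitive if it generates the multiplicative group $\mathbb{F}_{q^n}^*$. An element $\beta \in \mathbb{F}_{q^n}$ is normal over $\mathbb{F}_q$ if $\{\beta, \beta^q, \ldots, \beta^{q^{n-1}}\}$ is an $\mathbb{F}_q$-basis of $\mathbb{F}_{q^n}$. For a prime power $Q$ and positive integers $m_1,m_2$, $\Upsilon_Q(m_1,m_2)$ is the set of rational functions $f_1/f_2 \in \mathbb{F}_Q(x)$, with $f_1,f_2\in\mathbb{F}_Q[x]$, such that: (i) $\deg(f_1)\leq m_1$ and $\deg(f_2)\leq m_2$; (ii) $\gcd(f_1,f_2)=1$; (iii) there exist a positive integer $a$ and a monic irreducible polynomial $g\in\mathbb{F}_Q[x]\setminus\{x\}$ such that $\gcd(a,Q-1)=1$, $g^a\mid f_1f_2$ and $g^{a+1}\nmid f_1f_2$. Saying that $f(\alpha)=f_1(\alpha)/f_2(\alpha)$ is primitive includes the requirement $f_2(\alpha)\neq 0$. For a positive integer $\ell$, $W(\ell)$ is the number of square-free (positive) divisors of $\ell$. For a polynomial $g\in\mathbb{F}_q[x]$,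 $W_q(g)$ is the number of monic square-free factors of $g$ in $\mathbb{F}_q[x]$. *)

theory Defs
  imports
    Complex_Main
    "HOL-Library.Cardinality"
    "HOL-Computational_Algebra.Computational_Algebra"
    "HOL-Number_Theory.Prime_Powers"
begin

text \<open>
  A finite extension of finite fields is given by two finite field types and a ring homomorphism
  between them, which is automatically injective. With \<^prop>\<open>CARD('k) = q\<close> and
  \<^prop>\<open>CARD('a) = q ^ n\<close>, the type \<open>'k\<close> is the field with \<open>q\<close> elements and \<open>'a\<close> its
  extension of degree \<open>n\<close>.
\<close>

definition field_embedding :: "('k :: field \<Rightarrow> 'a :: field) \<Rightarrow> bool" where
  "field_embedding \<iota> \<longleftrightarrow>
     \<iota> 0 = 0 \<and> \<iota> 1 = 1 \<and>
     (\<forall>x y. \<iota> (x + y) = \<iota> x + \<iota> y) \<and>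
     (\<forall>x y. \<iota> (x * y) = \<iota> x * \<iota> y)"

definition primitive_elem :: "'a :: {field, finite} \<Rightarrow> bool" where
  "primitive_elem \<beta> \<longleftrightarrow> \<beta> \<noteq> 0 \<and> range (\<lambda>k :: int. \<beta> powi k) = {x. x \<noteq> 0}"

abbreviation (input) ext_scale :: "('k :: field \<Rightarrow> 'a :: field) \<Rightarrow> 'k \<Rightarrow> 'a \<Rightarrow> 'a" where
  "ext_scale \<iota> c x \<equiv> \<iota> c * x"

lemma vector_space_ext_scale: "field_embedding \<iota> \<Longrightarrow> vector_space (ext_scale \<iota>)"
  by unfold_locales (simp_all add: field_embedding_def algebra_simps)

definition normal_elem ::
    "('k :: {field, finite} \<Rightarrow> 'a :: {field, finite}) \<Rightarrow> nat \<Rightarrow> 'a \<Rightarrow> bool" where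
  "normal_elem \<iota> n \<beta> \<longleftrightarrow>
     (let B = {\<beta> ^ (CARD('k) ^ i) | i. i < n}
      in \<not> module.dependent (ext_scale \<iota>) B \<and> module.span (ext_scale \<iota>) B = UNIV)"

definition Upsilon :: "nat \<Rightarrow> nat \<Rightarrow> 'a :: {field, finite} poly fract set" where
  "Upsilon m1 m2 =
     {Fract f1 f2 | f1 f2.
        f2 \<noteq> 0 \<and> degree f1 \<le> m1 \<and> degree f2 \<le> m2 \<and> coprime f1 f2 \<and>
        (\<exists>a g. a > 0 \<and> lead_coeff g = 1 \<and> irreducible g \<and> g \<noteq> [:0, 1:] \<and>
               coprime a (CARD('a) - 1) \<and>
               g ^ a dvd f1 * f2 \<and> \<not> g ^ (a + 1) dvd f1 * f2)}"

text \<open>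
  \<open>ratfun_value f x v\<close> says that the rational function \<open>f\<close>, written in lowest terms, has no
  pole at \<open>x\<close> and takes the value \<open>v\<close> there.
\<close>

definition ratfun_value :: "'a :: field poly fract \<Rightarrow> 'a \<Rightarrow> 'a \<Rightarrow> bool" where
  "ratfun_value f x v \<longleftrightarrow>
     (\<exists>f1 f2. f = Fract f1 f2 \<and> f2 \<noteq> 0 \<and> coprime f1 f2 \<and>
              poly f2 x \<noteq> 0 \<and> v = poly f1 x / poly f2 x)"

lemma ratfun_value_unique:
  assumes "ratfun_value f x v" "ratfun_value f x w"
  shows "v = w"
proof -
  obtain f1 f2 where f: "f = Fract f1 f2" "f2 \<noteq> 0" "poly f2 x \<noteq> 0" "v = poly f1 x / poly f2 x"
    using assms(1) by (auto simp: ratfun_value_def)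
  obtain g1 g2 where g: "f = Fract g1 g2" "g2 \<noteq> 0" "poly g2 x \<noteq> 0" "w = poly g1 x / poly g2 x"
    using assms(2) by (auto simp: ratfun_value_def)
  have "f1 * g2 = g1 * f2"
    using f g by (simp add: eq_fract)
  hence "poly f1 x * poly g2 x = poly g1 x * poly f2 x"
    by (metis poly_mult)
  with f g show ?thesis
    by (simp add: frac_eq_eq)
qed

definition W :: "nat \<Rightarrow> nat" where
  "W l = card {d. d dvd l \<and> squarefree d}"

definition W_poly :: "'k :: {field, finite} poly \<Rightarrow> nat" where
  "W_poly g = card {d. lead_coeff d = 1 \<and> squarefree d \<and> d dvd g}"

end

(*
The indicator functions of primitivity and of normality are products of factors 1 - 1_H, one for
each prime divisor of q^n - 1 and each irreducible factor of x^n - 1, where H is a subgroup.  In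
the algebra of character expansions, normed by the sum of the absolute values of the
coefficients, 1 - 1_H has norm twice its mean, and the norm is submultiplicative.  Hence the
count of the wanted elements equals its main term up to mixed character sums
sum chi1(x) chi2(f(x)) psi(x), weighted by at most W(q^n-1)^2 W_q(x^n-1) times the main term, and
everything rests on the bound (m1 + m2 + 1) q^(n/2) for such a sum.

Write Q = q^n.  The L-function of the sum is a polynomial of degree at most m1 + m2 + 1: monic
polynomials h of large degree are equidistributed modulo x f1 f2 and in their second coefficient.
By Newton's identity, minus the sum over the extension of degree k is the k-th power sum of the
reciprocal roots.  Summing over all additive characters and the nontrivial powers of a
multiplicative character of order d counts the z in F_(Q^k) for which F(z^Q - z) is a d-th
power, and Stepanov's method (in Bombieri's form, where the auxiliary polynomial is an s-th power
with s^2 = Q^k) estimates this count up to O(Q^(k/2)).  As all reciprocal roots enter with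
positive multiplicity, each of them has absolute value at most sqrt Q.
*)

theory Submission
  imports Defs "HOL-Number_Theory.Number_Theory" "HOL-Algebra.Algebraic_Closure_Type"
begin

hide_const (open) UnivPoly.up_ring.coeff UnivPoly.up_ring.monom UnivPoly.eval UnivPoly.deg
  Polynomials.degree Polynomials.lead_coeff
  Coset.order Divisibility.irreducible Divisibility.prime up Module.module.smult

section \<open>Polynomials over algebraically closed fields\<close>

text \<open>Stepanov's method bounds the number of points in a power class from above only. Lower
  bounds come from the partition of the field into d classes and the zeros, so every class is
  treated, not just the d-th powers. They also show that each class has points, which supplies the
  argument at which a multiplicative character is nontrivial: for a trivial additive character even
  the vanishing of the L-coefficients rests on Stepanov.

  The count is available only in extensions of even degree and only jointly for all characters, so
  it bounds the squares of all reciprocal roots at once.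

  A mixed sum is rewritten with a single character of exact order d and a polynomial F = x^u' f1^v'
  f2^(2d-v'). The obstacle is to see that F is not an l-th power up to constants for any prime l
  dividing d. A root other than 0 whose multiplicity is prime to Q - 1 shows this unless l divides
  v', and then the factor x does.

  Since the trivial character is left out of the error, its weight is one less than the total
  weight; this margin pays for the points where x, f1 or f2 vanishes.\<close>

locale field_hom =
  fixes f :: "'a :: idom \<Rightarrow> 'b :: idom"
  assumes hom_add: "f (x + y) = f x + f y"
    and hom_mult: "f (x * y) = f x * f y"
    and hom_one: "f 1 = 1"
    and hom_inj: "f x = 0 \<Longrightarrow> x = 0"
begin

lemma hom_zero: "f 0 = 0"
  by (metis add.right_neutral add_cancel_left_right hom_add)

lemma hom_eq_0_iff: "f x = 0 \<longleftrightarrow> x = 0"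
  using hom_zero hom_inj by auto

lemma hom_minus: "f (- x) = - f x"
  using hom_add[of x "- x"] by (simp add: hom_zero eq_neg_iff_add_eq_0 add.commute)

lemma hom_diff: "f (x - y) = f x - f y"
  using hom_add[of x "- y"] by (simp add: hom_minus)

lemma hom_eq_iff: "f x = f y \<longleftrightarrow> x = y"
  using hom_inj[of "x - y"] by (auto simp: hom_diff)

lemma hom_power: "f (x ^ k) = f x ^ k"
  by (induction k) (auto simp: hom_one hom_mult)

lemma hom_sum: "f (sum g A) = (\<Sum>x\<in>A. f (g x))"
  by (induction A rule: infinite_finite_induct) (auto simp: hom_zero hom_add)

lemma hom_prod: "f (prod g A) = (\<Prod>x\<in>A. f (g x))"
  by (induction A rule: infinite_finite_induct) (auto simp: hom_one hom_mult)

lemma hom_prod_mset: "f (prod_mset A) = (\<Prod>x\<in>#A. f x)"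
  by (induction A) (auto simp: hom_one hom_mult)

lemma coeff_map_poly_hom: "coeff (map_poly f p) k = f (coeff p k)"
  by (simp add: coeff_map_poly hom_zero)

lemma degree_map_poly_hom: "degree (map_poly f p) = degree p"
  by (intro degree_map_poly) (auto simp: hom_eq_0_iff)

lemma lead_coeff_map_poly_hom: "lead_coeff (map_poly f p) = f (lead_coeff p)"
  by (simp add: degree_map_poly_hom coeff_map_poly_hom)

lemma map_poly_pCons_hom: "map_poly f (pCons c p) = pCons (f c) (map_poly f p)"
  by (simp add: map_poly_pCons hom_zero)

lemma map_poly_add_hom: "map_poly f (p + q) = map_poly f p + map_poly f q"
  by (intro poly_eqI) (simp add: coeff_map_poly_hom hom_add)

lemma map_poly_smult_hom: "map_poly f (smult c p) = smult (f c) (map_poly f p)"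
  by (intro poly_eqI) (simp add: coeff_map_poly_hom hom_mult)

lemma map_poly_mult_hom: "map_poly f (p * q) = map_poly f p * map_poly f q"
  by (intro poly_eqI) (simp add: coeff_map_poly_hom coeff_mult hom_sum hom_mult)

lemma poly_map_poly_hom: "poly (map_poly f p) (f x) = f (poly p x)"
  by (induction p) (auto simp: map_poly_pCons_hom hom_zero hom_add hom_mult)

text \<open>Closure under passing to polynomials lets the same facts serve field embeddings, the
  Frobenius and their coefficientwise extensions.\<close>

lemma map_poly_hom: "field_hom (map_poly f)"
proof
  show "map_poly f p = 0 \<Longrightarrow> p = 0" for p
    by (metis coeff_map_poly_hom hom_inj coeff_0 poly_eqI)
qed (auto simp: map_poly_add_hom map_poly_mult_hom hom_one)

lemma order_map_poly_hom:
  assumes "p \<noteq> 0" shows "order (f a) (map_poly f p) \<ge> order a p"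
proof -
  interpret P: field_hom "map_poly f" by (rule map_poly_hom)
  obtain r where "p = [:- a, 1:] ^ order a p * r"
    using order_1[of a p] by (auto elim: dvdE)
  hence "map_poly f p = [:- f a, 1:] ^ order a p * map_poly f r"
    using P.hom_mult[of "[:- a, 1:] ^ order a p" r]
    by (simp only: P.hom_power map_poly_pCons_hom hom_minus hom_one map_poly_0)
  hence "[:- f a, 1:] ^ order a p dvd map_poly f p" by simp
  thus ?thesis using assms P.hom_inj by (auto simp: order_divides)
qed

end

lemma proots_prod_linear: "proots (\<Prod>x\<in>#A. [:-x, 1:]) = (A :: 'a :: idom multiset)"
proof (induction A)
  case (add x A)
  have "(\<Prod>x\<in>#A. [:-x, 1:]) \<noteq> 0"
    by (auto simp: prod_mset_zero_iff)
  hence "proots ([:-x, 1:] * (\<Prod>x\<in>#A. [:-x, 1:])) = proots [:-x, 1:] + A"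
    by (subst proots_mult) (auto simp: add.IH)
  thus ?case by (simp del: mult_pCons_left)
qed auto

lemma alg_closed_size_proots: "size (proots (p :: 'a :: alg_closed_field poly)) = degree p"
proof (cases "p = 0")
  case False
  then obtain A where A: "size A = degree p" "p = smult (lead_coeff p) (\<Prod>x\<in>#A. [:-x, 1:])"
    using alg_closed_imp_factorization by blast
  have "proots p = A"
    using False by (subst A(2)) (simp add: proots_prod_linear)
  thus ?thesis using A by simp
qed auto

lemma alg_closed_prod_proots:
  "smult (lead_coeff p) (\<Prod>x\<in>#proots p. [:-x, 1:]) = (p :: 'a :: alg_closed_field poly)"
proof (cases "p = 0")
  case False
  then obtain A where A: "size A = degree p" "p = smult (lead_coeff p) (\<Prod>x\<in>#A. [:-x, 1:])"
    using alg_closed_imp_factorization by blast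
  have "proots p = A"
    using False by (subst A(2)) (simp add: proots_prod_linear)
  thus ?thesis using A by simp
qed auto

lemma order_le_1_if_pderiv_nz:
  fixes p :: "'a :: idom poly"
  assumes "p \<noteq> 0" "poly (pderiv p) a \<noteq> 0" shows "order a p \<le> 1"
proof (rule ccontr)
  assume "\<not> ?thesis"
  hence "[:-a, 1:] ^ 2 dvd p" using assms by (subst order_divides) auto
  then obtain r where "p = [:-a, 1:] ^ 2 * r" by (auto elim: dvdE)
  hence "p = [:-a, 1:] * ([:-a, 1:] * r)" by (simp only: power2_eq_square mult.assoc)
  hence "poly (pderiv p) a = 0" by (simp only: pderiv_mult) (simp add: pderiv_pCons)
  thus False using assms by simp
qed

lemma card_roots_separable:
  fixes p :: "'a :: alg_closed_field poly"
  assumes "p \<noteq> 0" "\<And>a. poly p a = 0 \<Longrightarrow> poly (pderiv p) a \<noteq> 0"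
  shows "card {x. poly p x = 0} = degree p"
proof -
  have "order a p = 1" if "poly p a = 0" for a
    using order_le_1_if_pderiv_nz[OF assms(1) assms(2)[OF that]] that assms(1) order_root[of p a]
    by auto
  hence "degree p = (\<Sum>x | poly p x = 0. 1)"
    using assms(1) by (subst alg_closed_size_proots [symmetric]) (simp add: size_multiset_overloaded_eq)
  thus ?thesis by simp
qed

section \<open>Power sums\<close>

text \<open>Multiply the power sums by the polynomial vanishing at all \<open>w\<^sub>j\<close> other than the one under
  consideration: a fixed linear combination of shifted power sums is a multiple of \<open>w\<^sub>i\<^sup>k\<close>.\<close>

lemma power_sums_bound:
  fixes w :: "'i \<Rightarrow> complex"
  assumes "finite I" and B: "B > 0"
    and bound: "\<And>k. k \<ge> k0 \<Longrightarrow> norm (\<Sum>i\<in>I. w i ^ k) \<le> C * B ^ k"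
    and i: "i \<in> I"
  shows "norm (w i) \<le> B"
proof (rule ccontr)
  assume neg: "\<not> ?thesis"
  define V where "V = w ` I - {w i}"
  define P where "P x = (\<Prod>v\<in>V. (x - v))" for x
  have finV: "finite V" using assms by (simp add: V_def)
  obtain a N where a: "\<And>x. P x = (\<Sum>l\<le>N. a l * x ^ l)"
  proof -
    have "\<exists>a N. \<forall>x. (\<Prod>v\<in>V. (x - v)) = (\<Sum>l\<le>N. a l * x ^ l)"
      using finV
    proof (induction V rule: finite_induct)
      case empty
      show ?case by (rule exI[of _ "\<lambda>_. 1"], rule exI[of _ 0]) simp
    next
      case (insert v V)
      then obtain a N where aN: "\<And>x. (\<Prod>v\<in>V. (x - v)) = (\<Sum>l\<le>N. a l * x ^ l)" by auto
      define a' where "a' l = (if l = 0 then 0 else a (l - 1)) - (if l \<le> N then v * a l else 0)" for l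
      have "(\<Prod>v\<in>insert v V. (x - v)) = (\<Sum>l\<le>Suc N. a' l * x ^ l)" for x
      proof -
        have "(\<Sum>l\<le>Suc N. a' l * x ^ l) = (\<Sum>l\<le>Suc N. (if l = 0 then 0 else a (l - 1)) * x ^ l)
            - (\<Sum>l\<le>Suc N. (if l \<le> N then v * a l else 0) * x ^ l)"
          by (simp only: a'_def left_diff_distrib sum_subtractf)
        also have "(\<Sum>l\<le>Suc N. (if l = 0 then 0 else a (l - 1)) * x ^ l) = x * (\<Sum>l\<le>N. a l * x ^ l)"
          by (subst sum.atMost_Suc_shift) (simp add: sum_distrib_left mult_ac)
        also have "(\<Sum>l\<le>Suc N. (if l \<le> N then v * a l else 0) * x ^ l) = v * (\<Sum>l\<le>N. a l * x ^ l)"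
          by (simp add: sum_distrib_left mult_ac)
        finally show ?thesis using insert by (simp add: aN algebra_simps)
      qed
      thus ?case by blast
    qed
    thus ?thesis using that by (auto simp: P_def)
  qed
  have Pw: "P (w i) \<noteq> 0" using finV by (simp add: P_def V_def)
  \<comment> \<open>Indices with equal values are collected; they enter with the positive weight
    \<open>m\<close>, so nothing cancels.\<close>
  define m where "m = card {j \<in> I. w j = w i}"
  have "m > 0" using i assms(1) by (auto simp: m_def card_gt_0_iff)
  have key: "(\<Sum>l\<le>N. a l * (\<Sum>j\<in>I. w j ^ (k + l))) = of_nat m * P (w i) * w i ^ k" for k
  proof -
    have "(\<Sum>l\<le>N. a l * (\<Sum>j\<in>I. w j ^ (k + l))) = (\<Sum>j\<in>I. w j ^ k * P (w j))"
      by (simp only: a sum_distrib_left power_add) (subst sum.swap, simp add: mult_ac)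
    also have "\<dots> = (\<Sum>j\<in>{j \<in> I. w j = w i}. w j ^ k * P (w j))"
      using assms(1) finV by (intro sum.mono_neutral_right) (auto simp: P_def V_def)
    also have "\<dots> = of_nat m * P (w i) * w i ^ k" by (simp add: m_def)
    finally show ?thesis .
  qed
  define D where "D = (\<Sum>l\<le>N. norm (a l) * (C * B ^ l))"
  have le: "real m * norm (P (w i)) * norm (w i) ^ k \<le> D * B ^ k" if "k \<ge> k0" for k
  proof -
    have "real m * norm (P (w i)) * norm (w i) ^ k = norm (\<Sum>l\<le>N. a l * (\<Sum>j\<in>I. w j ^ (k + l)))"
      by (simp add: key norm_mult norm_power)
    also have "\<dots> \<le> (\<Sum>l\<le>N. norm (a l) * (C * B ^ (k + l)))"
      by (rule order.trans[OF norm_sum]) (use that in \<open>auto simp: norm_mult intro!: sum_mono mult_left_mono bound\<close>)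
    also have "\<dots> = D * B ^ k" by (simp add: D_def sum_distrib_left sum_distrib_right power_add mult_ac)
    finally show ?thesis .
  qed
  define c where "c = real m * norm (P (w i))"
  have "c > 0" using \<open>m > 0\<close> Pw by (simp add: c_def)
  define r where "r = norm (w i) / B"
  have r: "r > 1" using neg B by (simp add: r_def)
  have le': "c * r ^ k \<le> D" if "k \<ge> k0" for k
    using le[OF that] B by (simp add: c_def r_def power_divide field_simps)
  obtain k where "D / c < r ^ k" using real_arch_pow[OF r] by blast
  also have "r ^ k \<le> r ^ max k k0" using r by (intro power_increasing) auto
  finally have "D < c * r ^ max k k0" using \<open>c > 0\<close> by (simp add: field_simps)
  thus False using le'[of "max k k0"] by simp
qed

section \<open>Stepanov's method\<close>

text \<open>Cancel \<open>gcd d m\<close>: the remaining cofactor of \<open>d\<close> divides every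
  element of \<open>B\<close>, and a prime factor of it would be a prime factor of \<open>d\<close>
  that divides all of \<open>B\<close>.\<close>

lemma prime_free_dvd_mult_imp_dvd:
  fixes d m :: nat
  assumes "d > 0" and "\<And>l. prime l \<Longrightarrow> l dvd d \<Longrightarrow> \<exists>b\<in>B. \<not> l dvd b" and "\<And>b. b \<in> B \<Longrightarrow> d dvd m * b"
  shows "d dvd m"
proof -
  define g where "g = gcd d m"
  have "g > 0" using assms(1) by (simp add: g_def)
  obtain d' m' where dm: "d = g * d'" "m = g * m'"
    by (metis dvd_def gcd_dvd1 gcd_dvd2 g_def)
  have cop: "coprime d' m'"
    using dm \<open>g > 0\<close> by (metis g_def gcd_coprime gcd_mult_distrib_nat mult.right_neutral coprime_iff_gcd_eq_1 mult_left_cancel neq0_conv)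
  have "d' dvd b" if "b \<in> B" for b
  proof -
    have "g * d' dvd g * (m' * b)" using assms(3)[OF that] dm by (simp add: mult.assoc)
    hence "d' dvd m' * b" using \<open>g > 0\<close> by simp
    thus ?thesis using cop by (simp add: coprime_dvd_mult_right_iff)
  qed
  have "d' = 1"
  proof (rule ccontr)
    assume "d' \<noteq> 1"
    then obtain l where l: "prime l" "l dvd d'" using prime_factor_nat by blast
    then obtain b where "b \<in> B" "\<not> l dvd b" using assms(2)[of l] dm by auto
    thus False using l \<open>\<And>b. b \<in> B \<Longrightarrow> d' dvd b\<close> dvd_trans by blast
  qed
  thus ?thesis using dm by simp
qed

text \<open>Kummer theory over the rational functions: the minimal polynomial \<open>U\<close> of
  \<open>y\<close> divides \<open>Y ^ d - h\<close>, so all its roots are d-th roots of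
  \<open>h\<close>, and the d-th power of its normalized constant term is \<open>h ^ m\<close> up to
  sign. Comparing orders at each \<open>b\<close> gives \<open>d dvd m * order b h\<close>, and the
  condition on primes leaves \<open>d dvd m\<close>.\<close>

lemma kummer_degree:
  fixes h :: "'K :: field poly" and y :: "'K poly fract alg_closure" and T :: "'K poly fract poly"
  assumes h: "h \<noteq> 0" and d: "d > 0"
    and ord: "\<And>l. prime l \<Longrightarrow> l dvd d \<Longrightarrow> \<exists>b. \<not> l dvd order b h"
    and y: "y ^ d = to_ac (to_fract h)"
    and T: "T \<noteq> 0" "poly (map_poly to_ac T) y = 0"
  shows "degree T \<ge> d"
proof (rule ccontr)
  interpret ac: field_hom "to_ac :: 'K poly fract \<Rightarrow> 'K poly fract alg_closure"
    by unfold_locales auto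
  interpret mac: field_hom "map_poly (to_ac :: 'K poly fract \<Rightarrow> 'K poly fract alg_closure)"
    by (rule ac.map_poly_hom)
  interpret fr: field_hom "to_fract :: 'K poly \<Rightarrow> 'K poly fract"
    by unfold_locales auto
  assume "\<not> degree T \<ge> d"
  define P where "P m \<longleftrightarrow> (\<exists>T. T \<noteq> 0 \<and> poly (map_poly to_ac T) y = 0 \<and> degree T = m)" for m
  have "P (degree T)" using T by (auto simp: P_def)
  define m where "m = (LEAST m. P m)"
  have "P m" unfolding m_def by (rule LeastI) fact
  have "m < d" using Least_le[of P, OF \<open>P (degree T)\<close>] \<open>\<not> degree T \<ge> d\<close> by (simp add: m_def)
  obtain U where U: "U \<noteq> 0" "poly (map_poly to_ac U) y = 0" "degree U = m"
    using \<open>P m\<close> by (auto simp: P_def)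
  have "m > 0"
  proof (rule ccontr)
    assume "\<not> m > 0"
    then obtain c where "U = [:c:]" using U(3) degree_eq_zeroE by blast
    thus False using U by (auto simp: ac.map_poly_pCons_hom)
  qed
  define V where "V = monom 1 d - [:to_fract h:]"
  have mV: "map_poly to_ac V = monom 1 d - [:to_ac (to_fract h):]"
    by (simp add: V_def mac.hom_diff map_poly_monom ac.map_poly_pCons_hom)
  have "V mod U = 0"
  proof (rule ccontr)
    assume *: "V mod U \<noteq> 0"
    have "poly (map_poly to_ac (V div U * U + V mod U)) y = 0"
      using y by (simp add: mV poly_monom)
    hence "poly (map_poly to_ac (V mod U)) y = 0"
      using U(2) by (simp only: mac.hom_add mac.hom_mult) simp
    hence "P (degree (V mod U))" using * by (auto simp: P_def)
    hence "m \<le> degree (V mod U)" unfolding m_def by (rule Least_le)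
    thus False using degree_mod_less[of U V] * U by auto
  qed
  hence "U dvd V" by auto
  define U' where "U' = map_poly to_ac U"
  have degU': "degree U' = m" using U by (simp add: U'_def ac.degree_map_poly_hom)
  have root: "x ^ d = to_ac (to_fract h)" if "x \<in># proots U'" for x
  proof -
    have "poly U' x = 0" using that U mac.hom_inj
      by (subst (asm) set_count_proots) (auto simp: U'_def)
    moreover obtain R where "V = U * R" using \<open>U dvd V\<close> by auto
    hence "map_poly to_ac V = U' * map_poly to_ac R" by (simp add: U'_def mac.hom_mult)
    ultimately have "poly (map_poly to_ac V) x = 0" by simp
    thus ?thesis by (simp add: mV poly_monom)
  qed
  \<comment> \<open>Up to sign the product of the roots of \<open>U\<close>. It is a rational
    function, so its d-th power can be compared with \<open>h\<close> by orders of polynomials once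
    the denominator \<open>v\<close> is cleared.\<close>
  define c where "c = coeff U 0 / lead_coeff U"
  have "to_ac (coeff U 0) = poly U' 0" by (simp add: poly_0_coeff_0 U'_def ac.coeff_map_poly_hom)
  also have "U' = smult (lead_coeff U') (\<Prod>x\<in>#proots U'. [:-x, 1:])"
    by (rule alg_closed_prod_proots [symmetric])
  also have "poly \<dots> 0 = lead_coeff U' * (\<Prod>x\<in>#proots U'. -x)"
    by (simp add: poly_prod_mset image_mset.compositionality o_def)
  finally have "to_ac (coeff U 0) = to_ac (lead_coeff U) * (\<Prod>x\<in>#proots U'. -x)"
    by (simp add: U'_def ac.degree_map_poly_hom ac.coeff_map_poly_hom)
  hence "to_ac c = (\<Prod>x\<in>#proots U'. -x)" using U(1) by (simp add: c_def)
  hence "to_ac (c ^ d) = (\<Prod>x\<in>#proots U'. -x) ^ d" by simp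
  also have "\<dots> = (\<Prod>x\<in>#proots U'. (-x) ^ d)"
  proof -
    have "(\<Prod>x\<in>#M. -x) ^ d = (\<Prod>x\<in>#M. (-x) ^ d)" for M :: "'K poly fract alg_closure multiset"
      by (induction M) (auto simp: power_mult_distrib simp del: mult_minus_left)
    thus ?thesis .
  qed
  also have "\<dots> = (\<Prod>x\<in>#proots U'. (-1) ^ d * to_ac (to_fract h))"
    by (intro arg_cong[of _ _ prod_mset] image_mset_cong) (metis root power_minus)
  also have "\<dots> = ((-1) ^ d * to_ac (to_fract h)) ^ m"
    using degU' by (simp add: alg_closed_size_proots)
  also have "\<dots> = to_ac (to_fract (((-1) ^ d * h) ^ m))"
    by (simp add: fr.hom_power)
  finally have ceq: "c ^ d = to_fract (((-1) ^ d * h) ^ m)" by (simp only: to_ac_eq_iff)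
  obtain u v where uv: "c = Fract u v" "v \<noteq> 0" by (cases c) auto
  have "to_fract v * c = to_fract u" using uv by (simp add: to_fract_def eq_fract)
  hence "to_fract v ^ d * c ^ d = to_fract u ^ d" by (metis power_mult_distrib)
  hence "to_fract (v ^ d * ((-1) ^ d * h) ^ m) = to_fract (u ^ d)"
    by (simp only: ceq fr.hom_mult fr.hom_power)
  hence eq: "v ^ d * ((-1) ^ d * h) ^ m = u ^ d" by (simp only: to_fract_eq_iff)
  have "d dvd m"
  proof (rule prime_free_dvd_mult_imp_dvd[OF d, where B = "range (\<lambda>b. order b h)"])
    fix k assume "k \<in> range (\<lambda>b. order b h)"
    then obtain b where b: "k = order b h" by auto
    have nz: "u \<noteq> 0" using eq h uv d by (auto simp: power_0_left)
    have *: "order b (p ^ n) = n * order b p" if "p \<noteq> 0" for p :: "'K poly" and n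
      using that by (induction n) (auto simp: order_mult)
    have "order b ((-1) ^ d * h) = order b h"
      by (cases "even d") auto
    hence "d * order b v + m * k = d * order b u"
      using arg_cong[OF eq, of "order b"] uv nz h
      by (subst (asm) order_mult) (auto simp: * b)
    thus "d dvd m * k" by (metis dvd_add_right_iff dvd_triv_left)
  qed (use ord in auto)
  thus False using \<open>m < d\<close> \<open>m > 0\<close> by (auto dest: dvd_imp_le)
qed

text \<open>Gaussian elimination on the coefficient of index \<open>n\<close>, with a pivot
  \<open>j\<close>. This provides the auxiliary polynomial of Stepanov's method.\<close>

lemma underdetermined_polys:
  fixes P :: "'i \<Rightarrow> 'K :: field poly"
  assumes "finite I" "card I > n" "\<And>i k. i \<in> I \<Longrightarrow> k \<ge> n \<Longrightarrow> coeff (P i) k = 0"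
  shows "\<exists>A. (\<exists>i\<in>I. A i \<noteq> 0) \<and> (\<Sum>i\<in>I. smult (A i) (P i)) = 0"
  using assms
proof (induction n arbitrary: I P)
  case 0
  then obtain i where "i \<in> I" by fastforce
  have "P i = 0" if "i \<in> I" for i
    using 0(3)[OF that] by (intro poly_eqI) auto
  thus ?case using \<open>i \<in> I\<close> by (intro exI[of _ "\<lambda>_. 1"]) auto
next
  case (Suc n)
  show ?case
  proof (cases "\<forall>i\<in>I. coeff (P i) n = 0")
    case True
    have "coeff (P i) k = 0" if "i \<in> I" "n \<le> k" for i k
      using True Suc.prems(3)[of i k] that by (cases "k = n") auto
    with Suc.prems(1,2) show ?thesis by (intro Suc.IH) auto
  next
    case False
    then obtain j where j: "j \<in> I" "coeff (P j) n \<noteq> 0" by auto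
    define c where "c i = coeff (P i) n / coeff (P j) n" for i
    define P' where "P' i = P i - smult (c i) (P j)" for i
    have "\<exists>A. (\<exists>i\<in>I - {j}. A i \<noteq> 0) \<and> (\<Sum>i\<in>I - {j}. smult (A i) (P' i)) = 0"
    proof (rule Suc.IH)
      show "card (I - {j}) > n" using Suc.prems j by simp
      show "coeff (P' i) k = 0" if "i \<in> I - {j}" "n \<le> k" for i k
        using that Suc.prems(3)[of i k] Suc.prems(3)[of j k] j
        by (cases "k = n") (auto simp: P'_def c_def)
    qed (use Suc.prems in auto)
    then obtain A where A: "\<exists>i\<in>I - {j}. A i \<noteq> 0" "(\<Sum>i\<in>I - {j}. smult (A i) (P' i)) = 0"
      by blast
    define A' where "A' i = (if i = j then - (\<Sum>i\<in>I - {j}. A i * c i) else A i)" for i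
    have "(\<Sum>i\<in>I. smult (A' i) (P i)) = smult (A' j) (P j) + (\<Sum>i\<in>I-{j}. smult (A i) (P i))"
      using Suc.prems(1) j by (subst sum.remove[of _ j]) (auto simp: A'_def intro!: sum.cong)
    also have "\<dots> = (\<Sum>i\<in>I-{j}. smult (A i) (P' i))"
      by (simp add: P'_def A'_def smult_diff_right sum_subtractf smult_sum flip: sum_negf)
    finally show ?thesis using A by (intro exI[of _ A']) (auto simp: A'_def)
  qed
qed

section \<open>Polynomial congruences, Frobenius fixed points and roots of unity\<close>

lemma diff_dvd_poly_diff: "(x - y) dvd poly p x - poly p (y :: 'a :: comm_ring_1)"
proof (induction p)
  case (pCons a p)
  have "poly (pCons a p) x - poly (pCons a p) y = (x - y) * poly p x + y * (poly p x - poly p y)"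
    by (simp add: algebra_simps)
  thus ?case using pCons.IH by (simp only: dvd_add dvd_mult dvd_mult2 dvd_triv_left)
qed auto

lemma diff_dvd_power_diff: "(x - y) dvd x ^ n - y ^ n" for x y :: "'a :: comm_ring_1"
  using diff_dvd_poly_diff[of x y "monom 1 n"] by (simp add: poly_monom)

lemma pcompose_power: "pcompose (p ^ n) q = pcompose p q ^ n"
  by (induction n) (auto simp: pcompose_mult pcompose_1)

lemma card_frobenius_fixed:
  assumes "prime CHAR('K :: alg_closed_field)" "r = CHAR('K) ^ k" "k > 0"
  shows "card {x :: 'K. x ^ r = x} = r" "finite {x :: 'K. x ^ r = x}"
proof -
  define P :: "'K poly" where "P = monom 1 r - [:0, 1:]"
  have "r > 1" using assms prime_gt_1_nat[OF assms(1)] by (metis one_less_power)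
  have "of_nat r = (0 :: 'K)" using assms by (simp add: of_nat_eq_0_iff_char_dvd)
  hence pd: "pderiv P = -1"
    by (simp add: P_def pderiv_diff pderiv_monom pderiv_pCons one_pCons)
  have deg: "degree P = r" unfolding P_def
    by (subst diff_conv_add_uminus, subst degree_add_eq_left) (use \<open>r > 1\<close> in \<open>auto simp: degree_monom_eq\<close>)
  hence "P \<noteq> 0" using \<open>r > 1\<close> by auto
  have "{x :: 'K. x ^ r = x} = {x. poly P x = 0}" by (auto simp: P_def poly_monom)
  moreover have "card {x. poly P x = 0} = degree P"
    by (rule card_roots_separable) (use \<open>P \<noteq> 0\<close> pd in auto)
  ultimately show "card {x :: 'K. x ^ r = x} = r" "finite {x :: 'K. x ^ r = x}"
    using deg poly_roots_finite[OF \<open>P \<noteq> 0\<close>] by simp_all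
qed

lemma card_roots_of_unity:
  assumes "of_nat d \<noteq> (0 :: 'K :: alg_closed_field)"
  shows "card {x :: 'K. x ^ d = 1} = d" "finite {x :: 'K. x ^ d = 1}"
proof -
  define P :: "'K poly" where "P = monom 1 d - 1"
  have "d > 0" using assms by (cases d) auto
  have deg: "degree P = d" unfolding P_def
    by (subst diff_conv_add_uminus, subst degree_add_eq_left) (use \<open>d > 0\<close> in \<open>auto simp: degree_monom_eq\<close>)
  hence "P \<noteq> 0" using \<open>d > 0\<close> by auto
  have eq: "{x :: 'K. x ^ d = 1} = {x. poly P x = 0}" by (auto simp: P_def poly_monom)
  have "poly (pderiv P) x \<noteq> 0" if "poly P x = 0" for x
  proof -
    have "x ^ d = 1" using that by (simp add: P_def poly_monom)
    hence "x \<noteq> 0" using \<open>d > 0\<close> by (auto simp: power_0_left)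
    thus ?thesis using assms by (simp add: P_def pderiv_diff pderiv_monom poly_monom)
  qed
  thus "card {x :: 'K. x ^ d = 1} = d" "finite {x :: 'K. x ^ d = 1}"
    using deg poly_roots_finite[OF \<open>P \<noteq> 0\<close>] card_roots_separable[OF \<open>P \<noteq> 0\<close>] by (simp_all add: eq)
qed

lemma card_power_eq_1_le:
  assumes "n > 0" shows "card {x :: 'K :: field. x ^ n = 1} \<le> n"
proof -
  define P :: "'K poly" where "P = monom 1 n - 1"
  have deg: "degree P = n" unfolding P_def
    by (subst diff_conv_add_uminus, subst degree_add_eq_left) (use \<open>n > 0\<close> in \<open>auto simp: degree_monom_eq\<close>)
  hence "P \<noteq> 0" using \<open>n > 0\<close> by auto
  have "{x. x ^ n = 1} = {x. poly P x = 0}" by (auto simp: P_def poly_monom)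
  thus ?thesis using card_poly_roots_bound[OF \<open>P \<noteq> 0\<close>] deg by simp
qed

text \<open>On d-th roots of unity \<open>x ^ k\<close> depends only on \<open>k mod d\<close>, and
  fewer than \<open>d\<close> elements satisfy \<open>x ^ (k mod d) = 1\<close>.\<close>

lemma root_of_unity_power_ne_1:
  assumes d: "of_nat d \<noteq> (0 :: 'K)" and k: "\<not> d dvd k"
  obtains x :: "'K :: alg_closed_field" where "x ^ d = 1" "x ^ k \<noteq> 1"
proof -
  have "d > 0" using d by (cases d) auto
  hence km: "k mod d > 0" "k mod d < d" using k by (auto simp: dvd_eq_mod_eq_0)
  have "\<not> {x :: 'K. x ^ d = 1} \<subseteq> {x. x ^ (k mod d) = 1}"
  proof
    assume *: "{x :: 'K. x ^ d = 1} \<subseteq> {x. x ^ (k mod d) = 1}"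
    have "finite {x :: 'K. x ^ (k mod d) = 1}"
      using poly_roots_finite[of "monom 1 (k mod d) - 1 :: 'K poly"] km
      by (simp add: poly_monom monom_eq_1_iff)
    from card_mono[OF this *] card_power_eq_1_le[OF km(1), where 'K = 'K] card_roots_of_unity(1)[OF d] km
    show False by simp
  qed
  then obtain x :: 'K where x: "x ^ d = 1" "x ^ (k mod d) \<noteq> 1" by auto
  have "x ^ k = (x ^ d) ^ (k div d) * x ^ (k mod d)" by (metis mult_div_mod_eq power_add power_mult)
  hence "x ^ k \<noteq> 1" using x by simp
  with x(1) show ?thesis by (rule that)
qed

section \<open>Relations for an approximate d-th root\<close>

lemma degree_coeff_mult_le:
  fixes P Q :: "'K :: comm_ring_1 poly poly"
  assumes "\<And>k. degree (coeff P k) \<le> a" "\<And>k. degree (coeff Q k) \<le> b"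
  shows "degree (coeff (P * Q) k) \<le> a + b"
  unfolding coeff_mult
  by (intro degree_sum_le order.trans[OF degree_mult_le] add_mono assms) auto

lemma degree_coeff_prod_le:
  fixes P :: "'i \<Rightarrow> 'K :: comm_ring_1 poly poly"
  assumes "\<And>x k. x \<in> A \<Longrightarrow> degree (coeff (P x) k) \<le> a"
  shows "degree (coeff (\<Prod>x\<in>A. P x) k) \<le> card A * a"
  using assms
proof (induction A arbitrary: k rule: infinite_finite_induct)
  case (insert x A)
  have "degree (coeff (P x * (\<Prod>x\<in>A. P x)) k) \<le> a + card A * a"
    by (intro degree_coeff_mult_le insert) (use insert in auto)
  thus ?case using insert by simp
qed auto

text \<open>The norm of \<open>P(Y)\<close>, formed from the conjugates \<open>\<xi> Y\<close>, is a polynomial in \<open>Y\<^sup>d\<close>, so it can be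
  evaluated at \<open>H\<close>; its degree is too small for the divisibility unless it vanishes.\<close>

lemma no_small_relation_mod:
  fixes P :: "'K :: alg_closed_field poly poly" and H Y M :: "'K poly"
  assumes d: "of_nat d \<noteq> (0 :: 'K)" and H: "H \<noteq> 0"
    and ord: "\<And>l. prime l \<Longrightarrow> l dvd d \<Longrightarrow> \<exists>b. \<not> l dvd order b H"
    and P: "degree P < d" "P \<noteq> 0" "\<And>k. degree (coeff P k) \<le> m"
    and M: "M dvd poly P Y" "M dvd Y ^ d - H" "degree M > d * m + d * degree H"
  shows False
proof -
  have "d > 0" using P by simp
  define Z where "Z = {x :: 'K. x ^ d = 1}"
  have Z: "card Z = d" "finite Z" using card_roots_of_unity[OF d] by (simp_all add: Z_def)
  define N where "N = (\<Prod>x\<in>Z. pcompose P [:0, [:x:]:])"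
  have degN: "degree N < d * d"
  proof -
    have "degree N \<le> (\<Sum>x\<in>Z. degree (pcompose P [:0, [:x:]:]))"
      unfolding N_def by (rule degree_prod_sum_le[OF Z(2), unfolded o_def])
    also have "\<dots> \<le> (\<Sum>x\<in>Z. d - 1)"
    proof (intro sum_mono)
      fix x
      have "degree (pcompose P [:0, [:x:]:]) \<le> degree P * 1"
        by (rule order.trans[OF degree_pcompose_le]) (auto intro!: mult_mono)
      thus "degree (pcompose P [:0, [:x:]:]) \<le> d - 1" using P(1) by simp
    qed
    also have "\<dots> < d * d" using Z \<open>d > 0\<close> by simp
    finally show ?thesis .
  qed
  have cN: "degree (coeff N k) \<le> d * m" for k
    unfolding N_def using Z degree_coeff_prod_le[of Z "\<lambda>x. pcompose P [:0, [:x:]:]" m k] P(3)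
    by (auto simp: coeff_pcompose_linear poly_const_pow order.trans[OF degree_smult_le])
  have inv: "pcompose N [:0, [:x:]:] = N" if "x \<in> Z" for x
  proof -
    have x: "x \<noteq> 0" using that \<open>d > 0\<close> by (auto simp: Z_def power_0_left)
    have "pcompose N [:0, [:x:]:] = (\<Prod>z\<in>Z. pcompose P [:0, [:z * x:]:])"
      by (simp add: N_def pcompose_prod pcompose_assoc [symmetric] pcompose_pCons mult.commute)
    also have "\<dots> = N" unfolding N_def
      by (rule prod.reindex_bij_witness[of _ "\<lambda>z. z / x" "\<lambda>z. z * x"])
         (use x that in \<open>auto simp: Z_def power_mult_distrib power_divide\<close>)
    finally show ?thesis .
  qed
  have van: "coeff N k = 0" if nd: "\<not> d dvd k" for k
  proof -
    obtain x where x: "x \<in> Z" "x ^ k \<noteq> 1"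
      using root_of_unity_power_ne_1[OF d nd] by (auto simp: Z_def)
    have "smult (x ^ k) (coeff N k) = coeff N k"
      using arg_cong[OF inv[OF x(1)], of "\<lambda>p. coeff p k"]
      by (simp add: coeff_pcompose_linear poly_const_pow)
    hence "smult (x ^ k - 1) (coeff N k) = 0" by (simp add: smult_diff_left)
    thus ?thesis using x(2) by simp
  qed
  \<comment> \<open>Only exponents divisible by \<open>d\<close> occur in \<open>N\<close>; since
    \<open>degree N < d * d\<close>, the indices \<open>l < d\<close> capture all of them.\<close>
  define N2 where "N2 = (\<Sum>l<d. monom (coeff N (l * d)) l)"
  have N_eq: "N = pcompose N2 (monom 1 d)"
  proof -
    have "pcompose N2 (monom 1 d) = (\<Sum>l<d. monom (coeff N (l * d)) (l * d))"
    proof -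
      have *: "pcompose (monom c l) (monom 1 d) = monom c (l * d)" for c :: "'K poly" and l
      proof -
        have "monom c l = smult c ([:0, 1:] ^ l)" by (simp add: monom_altdef)
        hence "pcompose (monom c l) (monom 1 d) = smult c (monom 1 d ^ l)"
          by (simp add: pcompose_smult pcompose_power pcompose_pCons)
        thus ?thesis by (simp add: monom_power smult_monom mult.commute)
      qed
      show ?thesis by (simp add: N2_def pcompose_sum *)
    qed
    also have "\<dots> = N"
    proof (rule poly_eqI)
      fix k
      show "coeff (\<Sum>l<d. monom (coeff N (l * d)) (l * d)) k = coeff N k"
      proof (cases "d dvd k \<and> k < d * d")
        case True
        then obtain i where i: "k = i * d" "i < d" by (auto elim!: dvdE simp: mult.commute)
        have "(\<Sum>l<d. coeff (monom (coeff N (l * d)) (l * d)) k) = (\<Sum>l<d. if l = i then coeff N k else 0)"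
          using \<open>d > 0\<close> by (intro sum.cong) (auto simp: i)
        thus ?thesis using i by (simp add: coeff_sum)
      next
        case False
        have "coeff N k = 0" using False van degN by (cases "d dvd k") (auto intro: coeff_eq_0)
        moreover have "coeff (monom (coeff N (l * d)) (l * d)) k = 0" if "l < d" for l
          using False that by auto
        ultimately show ?thesis by (simp add: coeff_sum)
      qed
    qed
    finally show ?thesis ..
  qed
  have degN2H: "degree (poly N2 H) \<le> d * m + d * degree H"
  proof -
    have "poly N2 H = (\<Sum>l<d. coeff N (l * d) * H ^ l)"
      by (simp add: N2_def poly_sum poly_monom)
    also have "degree \<dots> \<le> d * m + d * degree H"
    proof (intro degree_sum_le)
      fix l assume "l \<in> {..<d}"
      have "degree (coeff N (l * d) * H ^ l) \<le> d * m + degree H * l"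
        by (intro order.trans[OF degree_mult_le] add_mono cN degree_power_le)
      also have "degree H * l \<le> d * degree H" using \<open>l \<in> {..<d}\<close> by simp
      finally show "degree (coeff N (l * d) * H ^ l) \<le> d * m + d * degree H" by simp
    qed auto
    finally show ?thesis .
  qed
  have "M dvd poly N Y"
  proof -
    have "1 \<in> Z" by (simp add: Z_def)
    hence "poly (pcompose P [:0, [:1:]:]) Y dvd poly N Y"
      unfolding N_def poly_prod using Z by (intro dvd_prodI) auto
    thus ?thesis using M(1) dvd_trans by (auto simp: poly_pcompose)
  qed
  hence "M dvd poly N2 (Y ^ d)" by (simp add: N_eq poly_pcompose poly_monom)
  moreover have "M dvd poly N2 (Y ^ d) - poly N2 H"
    using M(2) diff_dvd_poly_diff by (rule dvd_trans)
  ultimately have "M dvd poly N2 (Y ^ d) - (poly N2 (Y ^ d) - poly N2 H)"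
    by (rule dvd_diff)
  \<comment> \<open>Modulo \<open>M\<close> the power \<open>Y ^ d\<close> may be replaced by
    \<open>H\<close>; what results has smaller degree than \<open>M\<close> and must vanish.\<close>
  hence "M dvd poly N2 H" by (simp only: diff_diff_eq2 add_diff_cancel_left')
  hence N2H: "poly N2 H = 0"
    using dvd_imp_degree_le[of M "poly N2 H"] degN2H M(3) by (cases "poly N2 H = 0") linarith+
  define e :: "'K poly \<Rightarrow> 'K poly fract alg_closure" where "e = to_ac \<circ> to_fract"
  interpret e: field_hom e by unfold_locales (auto simp: e_def)
  interpret me: field_hom "map_poly e" by (rule e.map_poly_hom)
  \<comment> \<open>The approximate root \<open>Y\<close> is exchanged for a true d-th root of
    \<open>H\<close>. There a factor of the norm vanishes, so a conjugate \<open>y'\<close> is a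
    root of \<open>P\<close>, against the degree bound of Kummer theory.\<close>
  obtain y where y: "y ^ d = e H" using nth_root_exists[OF \<open>d > 0\<close>] by blast
  have mpc: "map_poly e (pcompose p q) = pcompose (map_poly e p) (map_poly e q)" for p q
    by (induction p) (auto simp: pcompose_pCons me.hom_add me.hom_mult e.map_poly_pCons_hom)
  have "poly (map_poly e N) y = poly (map_poly e N2) (e H)"
    by (simp add: N_eq mpc poly_pcompose map_poly_monom e.hom_zero e.hom_one poly_monom y)
  also have "\<dots> = 0" by (simp add: e.poly_map_poly_hom N2H e.hom_zero)
  finally have "(\<Prod>x\<in>Z. poly (map_poly e (pcompose P [:0, [:x:]:])) y) = 0"
    by (simp add: N_def me.hom_prod poly_prod)
  then obtain x where x: "x \<in> Z" "poly (map_poly e (pcompose P [:0, [:x:]:])) y = 0"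
    using Z by auto
  define y' where "y' = e [:x:] * y"
  have "poly (map_poly e P) y' = 0"
    using x(2) by (simp add: mpc poly_pcompose e.map_poly_pCons_hom e.hom_zero y'_def mult.commute)
  hence "poly (map_poly to_ac (map_poly to_fract P)) y' = 0"
    by (simp add: map_poly_map_poly e_def)
  moreover have "y' ^ d = to_ac (to_fract H)"
  proof -
    have "e [:x:] ^ d = e [:x ^ d:]" by (simp add: e.hom_power [symmetric] poly_const_pow)
    also have "\<dots> = 1" using x(1) e.hom_one by (simp add: Z_def one_pCons)
    finally show ?thesis using y by (simp add: y'_def power_mult_distrib e_def)
  qed
  moreover have "map_poly to_fract P \<noteq> 0" "degree (map_poly to_fract P) = degree P"
    using P by (auto simp: map_poly_eq_0_iff degree_map_poly)
  ultimately have "d \<le> degree P"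
    using kummer_degree[OF H \<open>d > 0\<close> ord, of y' "map_poly to_fract P"] by auto
  thus False using P by simp
qed

lemma frobenius_diff:
  fixes x y :: "'a :: comm_ring_1"
  assumes "prime CHAR('a)" "s = CHAR('a) ^ t"
  shows "(x - y) ^ s = x ^ s - y ^ s"
  using freshmans_dream'[OF assms, of "x - y" y] by simp

section \<open>Exponents for the auxiliary polynomial\<close>

locale stepanov_exponents =
  fixes d s :: nat
  assumes d: "d \<ge> 2" and dvd: "d dvd s * s - 1" and s: "s > 0"
begin

text \<open>Formally \<open>G ^ \<tau> j\<close> is \<open>y ^ (st j + j * s)\<close>, where \<open>y ^ d = G\<close>: here \<open>st j\<close> is
  congruent to \<open>- s * j\<close> modulo \<open>d\<close> to make the exponent divisible by \<open>d\<close>, and because of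
  \<open>s * s\<close> being \<open>1\<close> modulo \<open>d\<close> also \<open>st j * s + j\<close> is divisible by \<open>d\<close>.\<close>

definition st :: "nat \<Rightarrow> nat" where "st j = ((d - 1) * s * j) mod d"
definition \<tau> :: "nat \<Rightarrow> nat" where "\<tau> j = (st j + j * s) div d"
definition \<theta> :: "nat \<Rightarrow> nat" where "\<theta> j = (st j * s + j) div d"

lemma ss: obtains u where "s * s = 1 + d * u"
proof -
  obtain u where "s * s - 1 = d * u" using dvd by blast
  moreover have "s * s \<ge> 1" using s by simp
  ultimately show ?thesis using that[of u] by linarith
qed

lemma coprime_d_s: "coprime d s"
proof (rule coprimeI)
  fix c assume c: "c dvd d" "c dvd s"
  obtain u where "s * s = 1 + d * u" by (rule ss)
  thus "is_unit c" using c by (metis dvd_add_left_iff dvd_mult2 dvd_trans)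
qed

lemma st_less: "st j < d"
  using d by (simp add: st_def)

lemma dvd_tau: "d dvd st j + j * s"
proof -
  have "d dvd (d - 1) * s * j + j * s"
  proof -
    have "(d - 1) * s * j + j * s = d * (s * j)" using d by (cases d) (auto simp: algebra_simps)
    thus ?thesis by simp
  qed
  thus ?thesis unfolding st_def by (metis dvd_eq_mod_eq_0 mod_add_left_eq)
qed

lemma tau: "d * \<tau> j = st j + j * s"
  using dvd_tau by (simp add: \<tau>_def)

lemma theta: "d * \<theta> j = st j * s + j"
proof -
  obtain u where u: "s * s = 1 + d * u" by (rule ss)
  have "d dvd (st j + j * s) * s" using dvd_tau by simp
  also have "(st j + j * s) * s = (st j * s + j) + d * (u * j)"
    using u by (simp add: algebra_simps)
  finally have "d dvd st j * s + j" by (simp add: dvd_add_left_iff)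
  thus ?thesis by (simp add: \<theta>_def)
qed

text \<open>At a point where \<open>G\<close> has the power residue value \<open>z\<close>, raising
  \<open>G ^ \<tau> j\<close> to the power \<open>s\<close> gives
  \<open>z ^ j * G ^ \<theta> j\<close>. The exponent drops from about \<open>j * s * s / d\<close>
  to at most \<open>s\<close>.\<close>

lemma tau_s: "\<tau> j * s = \<theta> j + j * ((s * s - 1) div d)"
proof -
  obtain u where u: "s * s = 1 + d * u" by (rule ss)
  have "d * (\<tau> j * s) = (d * \<tau> j) * s" by simp
  also have "\<dots> = st j * s + j * (s * s)" by (simp only: tau distrib_right mult.assoc)
  also have "\<dots> = d * \<theta> j + d * (j * u)" by (simp add: theta u algebra_simps)
  also have "u = (s * s - 1) div d" using u d by simp
  finally have "d * (\<tau> j * s) = d * (\<theta> j + j * ((s * s - 1) div d))" by (simp add: algebra_simps)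
  thus ?thesis using d by simp
qed

text \<open>Multiplication by \<open>- s\<close> permutes the residues modulo \<open>d\<close>. In
  \<open>independence\<close>, different \<open>j\<close> therefore belong to different powers of
  \<open>Y\<close> and their coefficients do not mix.\<close>

lemma st_inj: "inj_on st {..<d}"
proof (rule inj_onI)
  fix i j assume ij: "i \<in> {..<d}" "j \<in> {..<d}" "st i = st j"
  have "coprime (d - 1) d" by (rule coprime_diff_one_left_nat) (use d in simp)
  hence "coprime ((d - 1) * s) d" using coprime_d_s by (simp add: coprime_commute)
  moreover have "[(d - 1) * s * i = (d - 1) * s * j] (mod d)"
    using ij by (simp add: st_def cong_def)
  ultimately have "[i = j] (mod d)" by (simp only: cong_mult_lcancel_nat)
  thus "i = j" using ij by (simp add: cong_less_modulus_unique_nat)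
qed

lemma st_0: "st 0 = 0" by (simp add: st_def)

text \<open>Keeps the natural subtraction in \<open>\<kappa>\<close> exact.\<close>

lemma le_a_st: "j < d \<Longrightarrow> j \<le> (d - 1) * s * st j"
proof (cases "j = 0")
  case False
  assume "j < d"
  hence "st j \<noteq> 0" using False st_inj st_0 d by (metis inj_onD lessThan_iff less_le_trans zero_less_numeral)
  hence "(d - 1) * 1 * 1 \<le> (d - 1) * s * st j" using s by (intro mult_mono) auto
  moreover have "j \<le> (d - 1) * 1 * 1" using \<open>j < d\<close> by simp
  ultimately show ?thesis by linarith
qed auto

lemma tau_le:
  assumes "d \<le> s" "j < d" shows "\<tau> j \<le> s" "\<theta> j \<le> s"
proof -
  have "st j + j * s \<le> (d - 1) + (d - 1) * s" using st_less[of j] assms by (intro add_mono mult_mono) auto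
  also have "\<dots> \<le> d * s" using assms d by (cases d) auto
  finally show "\<tau> j \<le> s" using d tau[of j] by (metis mult_le_cancel1 not_gr_zero not_numeral_le_zero)
  have "st j * s + j \<le> (d - 1) * s + (d - 1)" using st_less[of j] assms by (intro add_mono mult_mono) auto
  also have "\<dots> \<le> d * s" using assms d by (cases d) auto
  finally show "\<theta> j \<le> s" using d theta[of j] by (metis mult_le_cancel1 not_gr_zero not_numeral_le_zero)
qed

text \<open>Chosen so that \<open>(G ^ \<nu>) ^ d = G * (G ^ s) ^ ((d - 1) * s)\<close>. Modulo
  \<open>[:-c, 1:] ^ s\<close> the power \<open>G ^ s\<close> is constant, so
  \<open>G ^ \<nu>\<close> is a polynomial d-th root of a constant multiple of
  \<open>G\<close>.\<close>

definition \<nu> :: nat where "\<nu> = (1 + s * ((d - 1) * s)) div d"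

lemma nu: "d * \<nu> = 1 + s * ((d - 1) * s)"
proof -
  obtain u where u: "s * s = 1 + d * u" by (rule ss)
  have "1 + s * ((d - 1) * s) = 1 + (d - 1) * (s * s)" by (simp add: mult_ac)
  also have "\<dots> = d * (1 + (d - 1) * u)" using d by (cases d) (auto simp: u algebra_simps)
  finally show ?thesis by (simp add: \<nu>_def)
qed

definition \<kappa> :: "nat \<Rightarrow> nat" where "\<kappa> j = ((d - 1) * s * st j - j) div d"

text \<open>The multiple of \<open>s\<close> in the exponent contributes only a constant modulo
  \<open>[:-c, 1:] ^ s\<close>, where \<open>G ^ \<tau> j\<close> thus agrees with
  \<open>(G ^ \<nu>) ^ st j\<close> up to a constant factor.\<close>

lemma kappa: "j < d \<Longrightarrow> \<nu> * st j = \<tau> j + s * \<kappa> j"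
proof -
  assume j: "j < d"
  have "d * (\<nu> * st j) = (1 + s * ((d - 1) * s)) * st j" by (simp only: nu [symmetric] mult.assoc)
  also have "\<dots> = st j + s * ((d - 1) * s * st j)" by (simp add: algebra_simps)
  also have "\<dots> = d * \<tau> j + s * ((d - 1) * s * st j - j)"
  proof -
    have "s * ((d - 1) * s * st j) = s * j + s * ((d - 1) * s * st j - j)"
      using le_a_st[OF j] by (simp only: distrib_left [symmetric] le_add_diff_inverse)
    thus ?thesis by (simp only: tau mult.commute[of j s] add.assoc)
  qed
  finally have *: "d * (\<nu> * st j) = d * \<tau> j + s * ((d - 1) * s * st j - j)" .
  hence "d dvd s * ((d - 1) * s * st j - j)" by (metis dvd_add_right_iff dvd_triv_left)
  hence "d dvd (d - 1) * s * st j - j" using coprime_d_s by (simp add: coprime_dvd_mult_right_iff)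
  hence eq: "(d - 1) * s * st j - j = d * \<kappa> j" by (simp add: \<kappa>_def)
  have "d * (\<nu> * st j) = d * (\<tau> j + s * \<kappa> j)" using * unfolding eq by (simp add: algebra_simps)
  thus ?thesis using d by simp
qed

end

section \<open>The auxiliary polynomial and the bound for one power class\<close>

locale stepanov = stepanov_exponents d s for d s +
  fixes G :: "'K :: alg_closed_field poly" and t :: nat
  assumes char: "prime CHAR('K)" and s_eq: "s = CHAR('K) ^ t" and G: "G \<noteq> 0"
    and ord: "\<And>l. prime l \<Longrightarrow> l dvd d \<Longrightarrow> \<exists>b. \<not> l dvd order b G"
    and s_large: "s \<ge> 4 * d * (degree G + 1)"
begin

lemma t_pos: "t > 0"
proof (rule ccontr)
  assume "\<not> t > 0"
  hence "s = 1" by (simp add: s_eq)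
  thus False using s_large d by auto
qed

lemma d_nz: "of_nat d \<noteq> (0 :: 'K)"
proof
  assume "of_nat d = (0 :: 'K)"
  hence "CHAR('K) dvd d" by (simp add: of_nat_eq_0_iff_char_dvd)
  moreover have "CHAR('K) dvd s" using t_pos by (simp add: s_eq)
  ultimately have "is_unit CHAR('K)" using coprime_d_s by (metis coprime_def)
  thus False using char by auto
qed

text \<open>Modulo \<open>[:-c, 1:] ^ s\<close> the sum becomes \<open>P(Y)\<close>, where
  \<open>P\<close> has degree below \<open>d\<close>, small coefficients carrying the
  \<open>k j\<close>, and \<open>Y\<close> is a d-th root of a multiple of \<open>G\<close>. By
  \<open>no_small_relation_mod\<close> such a \<open>P\<close> is zero. This is what makes the
  auxiliary polynomial nonzero.\<close>

lemma independence:
  fixes k :: "nat \<Rightarrow> 'K poly"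
  assumes c: "poly G c \<noteq> 0" and deg: "\<And>j. degree (k j) \<le> m" and m: "d * m + d * degree G < s"
    and dv: "[:-c, 1:] ^ s dvd (\<Sum>j<d. k j * G ^ \<tau> j)" and j: "j < d"
  shows "k j = 0"
proof (rule ccontr)
  assume nz: "k j \<noteq> 0"
  define \<gamma> where "\<gamma> = poly G c ^ s"
  define M where "M = [:-c, 1:] ^ s"
  define Y where "Y = G ^ \<nu>"
  define a where "a = (d - 1) * s"
  have "\<gamma> \<noteq> 0" using c by (simp add: \<gamma>_def)
  have charp: "prime CHAR('K poly)" "s = CHAR('K poly) ^ t" using char s_eq by simp_all
  \<comment> \<open>The Frobenius turns the zero of \<open>G - [:poly G c:]\<close> at
    \<open>c\<close> into one of order at least \<open>s\<close>.\<close>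
  have Gs: "M dvd G ^ s - [:\<gamma>:]"
  proof -
    have "[:-c, 1:] dvd G - [:poly G c:]" by (subst poly_eq_0_iff_dvd [symmetric]) simp
    hence "M dvd (G - [:poly G c:]) ^ s" unfolding M_def by (rule dvd_power_same)
    also have "\<dots> = G ^ s - [:\<gamma>:]" by (simp add: frobenius_diff[OF charp] \<gamma>_def poly_const_pow)
    finally show ?thesis .
  qed
  have Gsn: "M dvd (G ^ s) ^ n - [:\<gamma> ^ n:]" for n
    using dvd_trans[OF Gs diff_dvd_power_diff[of "G ^ s" "[:\<gamma>:]" n]] by (simp add: poly_const_pow)
  define P where "P = (\<Sum>j<d. monom (smult (inverse (\<gamma> ^ \<kappa> j)) (k j)) (st j))"
  have coeffP: "coeff P (st j) = smult (inverse (\<gamma> ^ \<kappa> j)) (k j)" if "j < d" for j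
  proof -
    have "coeff P (st j) = (\<Sum>i<d. if i = j then smult (inverse (\<gamma> ^ \<kappa> j)) (k j) else 0)"
      unfolding P_def coeff_sum using that inj_onD[OF st_inj, of _ j] by (intro sum.cong) auto
    thus ?thesis using that by simp
  qed
  have "M dvd k j * G ^ \<tau> j - smult (inverse (\<gamma> ^ \<kappa> j)) (k j) * Y ^ st j" if "j < d" for j
  proof -
    have "Y ^ st j = G ^ \<tau> j * (G ^ s) ^ \<kappa> j"
      using kappa[OF that] by (simp add: Y_def flip: power_mult power_add)
    hence "k j * G ^ \<tau> j - smult (inverse (\<gamma> ^ \<kappa> j)) (k j) * Y ^ st j
       = - smult (inverse (\<gamma> ^ \<kappa> j)) (k j * G ^ \<tau> j) * ((G ^ s) ^ \<kappa> j - [:\<gamma> ^ \<kappa> j:])"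
      using \<open>\<gamma> \<noteq> 0\<close> by (simp add: algebra_simps smult_diff_right)
    thus ?thesis using Gsn by (simp only: dvd_mult)
  qed
  hence "M dvd (\<Sum>j<d. k j * G ^ \<tau> j - smult (inverse (\<gamma> ^ \<kappa> j)) (k j) * Y ^ st j)"
    by (intro dvd_sum) auto
  also have "\<dots> = (\<Sum>j<d. k j * G ^ \<tau> j) - poly P Y"
    by (simp add: sum_subtractf P_def poly_sum poly_monom)
  finally have *: "M dvd (\<Sum>j<d. k j * G ^ \<tau> j) - poly P Y" .
  have "M dvd (\<Sum>j<d. k j * G ^ \<tau> j) - ((\<Sum>j<d. k j * G ^ \<tau> j) - poly P Y)"
    by (rule dvd_diff[OF dv[folded M_def] *])
  hence MP: "M dvd poly P Y" by (simp only: diff_diff_eq2 add_diff_cancel_left')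
  have "Y ^ d = G * (G ^ s) ^ a"
    by (simp add: Y_def a_def nu mult.commute[of _ d] flip: power_mult power_Suc)
  hence "Y ^ d - smult (\<gamma> ^ a) G = G * ((G ^ s) ^ a - [:\<gamma> ^ a:])" by (simp add: algebra_simps)
  hence MY: "M dvd Y ^ d - smult (\<gamma> ^ a) G" using Gsn by (simp only: dvd_mult)
  show False
  proof (rule no_small_relation_mod[OF d_nz, of "smult (\<gamma> ^ a) G" P m M Y])
    show "smult (\<gamma> ^ a) G \<noteq> 0" using G \<open>\<gamma> \<noteq> 0\<close> by simp
    show "\<exists>b. \<not> l dvd order b (smult (\<gamma> ^ a) G)" if "prime l" "l dvd d" for l
      using ord[OF that] \<open>\<gamma> \<noteq> 0\<close> by (simp add: order_smult)
    have "st j \<le> d - 1" for j using st_less[of j] by simp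
    hence "degree P \<le> d - 1" unfolding P_def
      by (intro degree_sum_le order.trans[OF degree_monom_le]) auto
    thus "degree P < d" using d by simp
    show "P \<noteq> 0" using coeffP[OF j] nz \<open>\<gamma> \<noteq> 0\<close> by auto
    show "degree (coeff P n) \<le> m" for n
    proof -
      have "degree (coeff (monom (smult (inverse (\<gamma> ^ \<kappa> j)) (k j)) (st j)) n) \<le> m" for j
        using deg[of j] by (cases "n = st j") (auto intro: order.trans[OF degree_smult_le])
      thus ?thesis unfolding P_def coeff_sum by (intro degree_sum_le) auto
    qed
    show "d * m + d * degree (smult (\<gamma> ^ a) G) < degree M"
      using m \<open>\<gamma> \<noteq> 0\<close> by (simp add: M_def degree_power_eq)
  qed (use MP MY in auto)
qed

theorem bound:
  "d * card {x. x ^ (s * s) = x \<and> poly G x ^ ((s * s - 1) div d) = z} \<le> s * s + d * (3 * degree G + 3) * s"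
proof -
  define g where "g = degree G"
  \<comment> \<open>With this choice \<open>d * m\<close> takes at most half of the room
    \<open>s\<close> that \<open>independence\<close> leaves; \<open>d * g\<close> takes at most a
    quarter.\<close>
  define m where "m = s div (2 * d)"
  \<comment> \<open>The excess in the number of unknowns: \<open>(m + 1) * c\<close> has to pay for
    the degree \<open>g * s\<close> and one further \<open>s\<close>, and \<open>m + 1\<close>
    exceeds \<open>s / (2 * d)\<close>.\<close>
  define c where "c = 2 * d * (g + 1)"
  \<comment> \<open>The part \<open>s / d\<close> produces the main term \<open>s * s\<close> of the
    bound, as \<open>\<Psi>\<close> has degree about \<open>n * s\<close>; the part
    \<open>c / d\<close> only enters the error.\<close>
  define n where "n = (s + c) div d"
  have "d * 2 \<le> s * 1" "d \<ge> 2" using s_large d by (auto simp: algebra_simps)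
  have ds: "d \<le> s" using s_large by simp
  have dm: "2 * (d * m) \<le> s"
    using div_times_less_eq_dividend[of s "2 * d"] by (simp add: m_def mult_ac)
  have dg: "4 * (d * g) + 4 * d \<le> s" using s_large by (simp add: g_def algebra_simps)
  have dm1: "s < 2 * d * (m + 1)" using d dividend_less_times_div[of "2 * d" s] by (simp add: m_def)
  have dn: "d * n \<le> s + c" by (simp add: n_def)
  have dn1: "s + c < d * (n + 1)" using d dividend_less_times_div[of d "s + c"] by (simp add: n_def)
  have count: "m * s + n + g * s + 1 < (m + 1) * ((n + 1) * d)"
  proof -
    have "2 * n \<le> d * n" using d by simp
    hence n2: "2 * n \<le> s + c" using dn by linarith
    have "2 * c \<le> 2 * s" using dg by (simp add: c_def algebra_simps)
    have "s * (g + 1) \<le> (2 * d * (m + 1)) * (g + 1)" using dm1 by (intro mult_right_mono) auto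
    hence "s * (g + 1) \<le> c * (m + 1)" by (simp only: c_def mult_ac)
    moreover have "(m + 1) * (s + c) + (m + 1) \<le> (m + 1) * (d * (n + 1))"
      using mult_le_mono2[OF Suc_leI[OF dn1], of "m + 1"] by (simp add: algebra_simps)
    moreover have "n + 1 \<le> s + s" using n2 \<open>2 * c \<le> 2 * s\<close> dg d by linarith
    ultimately show ?thesis by (simp add: algebra_simps)
  qed
  define I where "I = {..m} \<times> {..n} \<times> {..<d}"
  have finI: "finite I" by (simp add: I_def)
  have cardI: "card I = (m + 1) * ((n + 1) * d)" by (simp add: I_def card_cartesian_product)
  obtain c0 where c0: "poly G c0 \<noteq> 0"
  proof -
    have "\<not> {x :: 'K. x ^ s = x} \<subseteq> {x. poly G x = 0}"
    proof
      assume "{x :: 'K. x ^ s = x} \<subseteq> {x. poly G x = 0}"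
      from card_mono[OF poly_roots_finite[OF G] this] card_poly_roots_bound[OF G]
      have "s \<le> g" using card_frobenius_fixed(1)[OF char s_eq t_pos] by (simp add: g_def)
      moreover have "1 * g \<le> d * g" using d by (intro mult_right_mono) auto
      ultimately show False using dg d by linarith
    qed
    thus ?thesis using that by auto
  qed
  \<comment> \<open>Reduced form of the s-th power of \<open>F\<close> below:
    \<open>[:-c0, 1:] ^ (i * s * s)\<close> collapses to degree \<open>i\<close>, so the linear
    system has only \<open>m * s + n + g * s + 1\<close> equations.\<close>
  define E where "E = (\<lambda>(e, i, j). monom 1 (e * s) * [:-(c0 ^ (s * s)), 1:] ^ i * smult (z ^ j) (G ^ \<theta> j))"
  obtain A where A: "\<exists>i\<in>I. A i \<noteq> 0" "(\<Sum>i\<in>I. smult (A i) (E i)) = 0"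
  proof -
    have "coeff (E x) k = 0" if "x \<in> I" "m * s + n + g * s + 1 \<le> k" for x k
    proof -
      obtain e i j where x: "x = (e, i, j)" by (cases x)
      have b: "e \<le> m" "i \<le> n" "j < d" using that by (auto simp: I_def x)
      have "degree (E x) \<le> (degree (monom (1 :: 'K) (e * s)) + degree ([:-(c0 ^ (s * s)), 1:] ^ i)) + degree (smult (z ^ j) (G ^ \<theta> j))"
        unfolding E_def x prod.case by (intro order.trans[OF degree_mult_le] add_mono order.refl)
      also have "\<dots> \<le> (m * s + n) + g * s"
      proof (intro add_mono)
        show "degree (monom (1 :: 'K) (e * s)) \<le> m * s"
          using b by (intro order.trans[OF degree_monom_le]) auto
        show "degree ([:-(c0 ^ (s * s)), 1:] ^ i) \<le> n" using b by (simp add: degree_power_eq)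
        have "degree (smult (z ^ j) (G ^ \<theta> j)) \<le> g * \<theta> j"
          unfolding g_def by (intro order.trans[OF degree_smult_le] degree_power_le)
        also have "\<dots> \<le> g * s" using tau_le(2)[OF ds b(3)] by simp
        finally show "degree (smult (z ^ j) (G ^ \<theta> j)) \<le> g * s" .
      qed
      finally show ?thesis using that by (intro coeff_eq_0) simp
    qed
    moreover have "m * s + n + g * s + 1 < card I" using count by (simp only: cardI)
    ultimately show ?thesis using underdetermined_polys[OF finI, of "m * s + n + g * s + 1" E] that by blast
  qed
  have "s > 0" by (rule s)
  \<comment> \<open>At the points counted, the relation among the \<open>E i\<close> is to be the
    s-th power of a combination of the \<open>F i\<close>, so its coefficients need s-th
    roots.\<close>
  have "\<forall>x. \<exists>y. y ^ s = A x" using nth_root_exists[OF \<open>s > 0\<close>] by blast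
  then obtain \<alpha> where \<alpha>: "\<And>x. \<alpha> x ^ s = A x" by metis
  \<comment> \<open>\<open>F\<close> is chosen so that \<open>F ^ s\<close> and \<open>E\<close> agree wherever \<open>x ^ (s * s) = x\<close> and \<open>G\<close> is in the class of \<open>z\<close>.\<close>
  define F where "F = (\<lambda>(e, i, j). monom 1 e * [:-c0, 1:] ^ (i * s) * G ^ \<tau> j)"
  define \<Psi> where "\<Psi> = (\<Sum>x\<in>I. smult (\<alpha> x) (F x))"
  have ss_eq: "s * s = CHAR('K) ^ (t + t)" by (simp add: s_eq power_add)
  have root: "poly \<Psi> x = 0" if x: "x ^ (s * s) = x" "poly G x ^ ((s * s - 1) div d) = z" for x
  proof -
    have "poly \<Psi> x ^ s = (\<Sum>y\<in>I. (\<alpha> y * poly (F y) x) ^ s)"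
      by (simp add: \<Psi>_def poly_sum freshmans_dream_sum'[OF char s_eq])
    also have "\<dots> = (\<Sum>y\<in>I. A y * poly (E y) x)"
    proof (intro sum.cong refl)
      fix y assume "y \<in> I"
      obtain e i j where y: "y = (e, i, j)" by (cases y)
      have "poly (F y) x ^ s = x ^ (e * s) * ((x - c0) ^ (s * s)) ^ i * poly G x ^ (\<tau> j * s)"
        by (simp add: F_def y poly_monom power_mult_distrib mult_ac flip: power_mult)
      also have "(x - c0) ^ (s * s) = x - c0 ^ (s * s)"
        using x by (simp add: frobenius_diff[OF char ss_eq])
      also have "poly G x ^ (\<tau> j * s) = poly G x ^ \<theta> j * z ^ j"
        unfolding tau_s power_add x(2) [symmetric] by (simp add: mult.commute flip: power_mult)
      also have "x ^ (e * s) * (x - c0 ^ (s * s)) ^ i * (poly G x ^ \<theta> j * z ^ j) = poly (E y) x"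
        by (simp add: E_def y poly_monom mult_ac)
      finally show "(\<alpha> y * poly (F y) x) ^ s = A y * poly (E y) x"
        by (simp add: power_mult_distrib \<alpha>)
    qed
    also have "\<dots> = poly (\<Sum>y\<in>I. smult (A y) (E y)) x" by (simp add: poly_sum)
    also have "\<dots> = 0" by (simp add: A(2))
    finally show ?thesis using \<open>s > 0\<close> by simp
  qed
  have "\<Psi> \<noteq> 0"
  proof
    assume "\<Psi> = 0"
    define k where "k i j = (\<Sum>e\<le>m. monom (\<alpha> (e, i, j)) e)" for i j
    define Xs where "Xs = [:-c0, 1:] ^ s"
    have "Xs \<noteq> 0" by (simp add: Xs_def)
    define Sm where "Sm i = (\<Sum>j<d. k i j * G ^ \<tau> j)" for i
    have kdeg: "degree (k i j) \<le> m" for i j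
      unfolding k_def by (intro degree_sum_le order.trans[OF degree_monom_le]) auto
    have kz: "k i j = 0" if "Sm i = Xs * r" "j < d" for i j r
    proof (rule independence[OF c0 kdeg _ _ that(2)])
      show "d * m + d * degree G < s" using dm dg d unfolding g_def by linarith
      show "[:- c0, 1:] ^ s dvd (\<Sum>j<d. k i j * G ^ \<tau> j)"
        using that(1) by (simp add: Sm_def Xs_def)
    qed
    have \<Psi>: "\<Psi> = (\<Sum>i\<le>n. Xs ^ i * Sm i)"
    proof -
      have "(\<Sum>i\<le>n. Xs ^ i * Sm i) = (\<Sum>i\<le>n. \<Sum>j<d. \<Sum>e\<le>m. smult (\<alpha> (e, i, j)) (F (e, i, j)))"
        by (intro sum.cong refl) (simp add: Sm_def k_def Xs_def F_def sum_distrib_left sum_distrib_right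
            monom_altdef mult_ac flip: power_mult)
      also have "\<dots> = (\<Sum>e\<le>m. \<Sum>i\<le>n. \<Sum>j<d. smult (\<alpha> (e, i, j)) (F (e, i, j)))"
        by (subst (2) sum.swap, subst sum.swap) simp
      also have "\<dots> = \<Psi>"
        by (simp add: \<Psi>_def I_def sum.cartesian_product split_def)
      finally show ?thesis ..
    qed
    \<comment> \<open>Induction from the lowest power of \<open>Xs\<close>: once the earlier terms
      vanish, \<open>Xs ^ i\<close> cancels and \<open>Xs\<close> divides \<open>Sm i\<close>, so
      \<open>independence\<close> annihilates its coefficients.\<close>
    have "Sm i = 0" if "i \<le> n" for i
      using that
    proof (induction i rule: less_induct)
      case (less i)
      have "0 = (\<Sum>i'\<in>{..<i}. Xs ^ i' * Sm i') + (\<Sum>i'\<in>{i..n}. Xs ^ i' * Sm i')"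
      proof -
        have "{..n} = {..<i} \<union> {i..n}" using less.prems by auto
        hence "(\<Sum>i\<le>n. Xs ^ i * Sm i) = (\<Sum>i'\<in>{..<i}. Xs ^ i' * Sm i') + (\<Sum>i'\<in>{i..n}. Xs ^ i' * Sm i')"
          by (simp only:) (subst sum.union_disjoint, auto)
        thus ?thesis using \<open>\<Psi> = 0\<close> \<Psi> by simp
      qed
      also have "(\<Sum>i'\<in>{..<i}. Xs ^ i' * Sm i') = 0" using less by (intro sum.neutral) auto
      also have "(\<Sum>i'\<in>{i..n}. Xs ^ i' * Sm i') = Xs ^ i * Sm i + (\<Sum>i'\<in>{Suc i..n}. Xs ^ i' * Sm i')"
        using less.prems by (subst sum.atLeast_Suc_atMost) auto
      also have "(\<Sum>i'\<in>{Suc i..n}. Xs ^ i' * Sm i') = Xs ^ i * (Xs * (\<Sum>i'\<in>{Suc i..n}. Xs ^ (i' - Suc i) * Sm i'))"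
        by (auto simp: sum_distrib_left mult.assoc [symmetric] simp flip: power_Suc power_add power_Suc2 intro!: sum.cong)
      finally have "Xs ^ i * (Sm i + Xs * (\<Sum>i'\<in>{Suc i..n}. Xs ^ (i' - Suc i) * Sm i')) = 0"
        by (simp add: algebra_simps)
      hence "Sm i = Xs * - (\<Sum>i'\<in>{Suc i..n}. Xs ^ (i' - Suc i) * Sm i')"
        using \<open>Xs \<noteq> 0\<close> by (simp add: eq_neg_iff_add_eq_0)
      from kz[OF this] show ?case by (simp add: Sm_def)
    qed
    hence kz': "k i j = 0" if "i \<le> n" "j < d" for i j
      using kz[of i 0 j] that by simp
    obtain e i j where e: "e \<le> m" "i \<le> n" "j < d" "A (e, i, j) \<noteq> 0"
      using A(1) by (auto simp: I_def)
    have "coeff (k i j) e = \<alpha> (e, i, j)"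
      using e(1) by (simp add: k_def coeff_sum)
    hence "\<alpha> (e, i, j) = 0" using kz' e by simp
    thus False using \<alpha>[of "(e, i, j)"] e(4) \<open>s > 0\<close> by (simp add: power_0_left)
  qed
  have "degree \<Psi> \<le> (m + n * s) + g * s"
    unfolding \<Psi>_def
  proof (intro degree_sum_le finI order.trans[OF degree_smult_le])
    fix x assume "x \<in> I"
    obtain e i j where x: "x = (e, i, j)" by (cases x)
    have b: "e \<le> m" "i \<le> n" "j < d" using \<open>x \<in> I\<close> by (auto simp: I_def x)
    have "degree (F x) \<le> (degree (monom (1 :: 'K) e) + degree ([:-c0, 1:] ^ (i * s))) + degree (G ^ \<tau> j)"
      unfolding F_def x prod.case by (intro order.trans[OF degree_mult_le] add_mono order.refl)
    also have "\<dots> \<le> (m + n * s) + g * s"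
    proof (intro add_mono)
      show "degree (monom (1 :: 'K) e) \<le> m" using b by (intro order.trans[OF degree_monom_le]) auto
      show "degree ([:-c0, 1:] ^ (i * s)) \<le> n * s" using b by (simp add: degree_power_eq)
      have "degree (G ^ \<tau> j) \<le> g * \<tau> j" unfolding g_def by (rule degree_power_le)
      also have "\<dots> \<le> g * s" using tau_le(1)[OF ds b(3)] by simp
      finally show "degree (G ^ \<tau> j) \<le> g * s" .
    qed
    finally show "degree (F x) \<le> (m + n * s) + g * s" .
  qed
  moreover have "card {x. x ^ (s * s) = x \<and> poly G x ^ ((s * s - 1) div d) = z} \<le> degree \<Psi>"
    by (rule order.trans[OF card_mono card_poly_roots_bound[OF \<open>\<Psi> \<noteq> 0\<close>]])
       (use root poly_roots_finite[OF \<open>\<Psi> \<noteq> 0\<close>] in auto)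
  ultimately have "d * card {x. x ^ (s * s) = x \<and> poly G x ^ ((s * s - 1) div d) = z} \<le> d * (m + n * s + g * s)"
    by (intro mult_le_mono2) simp
  also have "\<dots> = d * m + (d * n) * s + d * g * s" by (simp add: algebra_simps)
  also have "\<dots> \<le> d * s + (s + c) * s + d * g * s"
  proof -
    have "1 * m \<le> d * m" using \<open>d \<ge> 2\<close> by (intro mult_right_mono) auto
    hence "d * m \<le> d * s" using dm by (intro mult_le_mono2) linarith
    thus ?thesis using dn by (intro add_mono mult_right_mono) auto
  qed
  also have "\<dots> = s * s + d * (3 * g + 3) * s" by (simp add: c_def algebra_simps)
  finally show ?thesis unfolding g_def .
qed

end

section \<open>Polynomials over a finite field and Newton's identity\<close>

lemma alg_closed_dvdI:
  fixes p q :: "'K :: alg_closed_field poly"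
  assumes "p \<noteq> 0" "\<And>x. order x p \<le> order x q"
  shows "p dvd q"
proof (cases "q = 0")
  case False
  have "proots p \<subseteq># proots q"
    using assms False by (auto simp: subseteq_mset_def)
  hence "(\<Prod>x\<in>#proots p. [:-x, 1:]) dvd (\<Prod>x\<in>#proots q. [:-x, 1:])"
    by (intro prod_mset_subset_imp_dvd image_mset_subseteq_mono)
  hence "smult (lead_coeff p) (\<Prod>x\<in>#proots p. [:-x, 1:]) dvd smult (lead_coeff q) (\<Prod>x\<in>#proots q. [:-x, 1:])"
    using assms(1) by (simp add: smult_dvd_iff dvd_smult)
  thus ?thesis by (simp only: alg_closed_prod_proots)
qed auto

lemma order_linear_factor_other: "y \<noteq> x \<Longrightarrow> order y [:-x, 1:] = 0" for x y :: "'a :: idom"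
  by (rule order_0I) auto

lemma order_linear_factor_same: "order x [:-x, 1:] = 1" for x :: "'a :: idom"
  using order_power_n_n[of x 1] by simp

lemma order_power: "p \<noteq> 0 \<Longrightarrow> order x (p ^ n) = n * order x p" for p :: "'a :: idom poly"
  by (induction n) (auto simp: order_mult)

lemma order_prod:
  fixes f :: "'i \<Rightarrow> 'a :: idom poly"
  assumes "\<And>i. i \<in> A \<Longrightarrow> f i \<noteq> 0"
  shows "order x (prod f A) = (\<Sum>i\<in>A. order x (f i))"
  using assms by (induction A rule: infinite_finite_induct) (auto simp: order_mult)

section \<open>Fixed fields of the Frobenius and polynomials over F_Q\<close>

locale finite_frobenius =
  fixes Q t :: nat and dummy :: "'K :: alg_closed_field itself"
  assumes char: "prime CHAR('K)" and Q: "Q = CHAR('K) ^ t" and t: "t > 0"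
begin

lemma Q_gt_1: "Q > 1"
  using prime_gt_1_nat[OF char] t by (simp only: Q one_less_power)

lemma Q_power: "Q ^ k = CHAR('K) ^ (t * k)"
  by (simp add: Q power_mult)

lemma frob_add: "(x + y :: 'K) ^ Q ^ k = x ^ Q ^ k + y ^ Q ^ k"
  by (rule freshmans_dream'[OF char Q_power])

lemma frob_diff: "(x - y :: 'K) ^ Q ^ k = x ^ Q ^ k - y ^ Q ^ k"
  by (rule frobenius_diff[OF char Q_power])

lemma frob_sum: "sum f A ^ Q ^ k = (\<Sum>x\<in>A. (f x :: 'K) ^ Q ^ k)"
  by (rule freshmans_dream_sum'[OF char Q_power])

lemma frob_inj: "x ^ Q ^ k = y ^ Q ^ k \<Longrightarrow> x = (y :: 'K)"
proof -
  assume "x ^ Q ^ k = y ^ Q ^ k"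
  hence "(x - y) ^ Q ^ k = 0" by (simp add: frob_diff)
  thus ?thesis by simp
qed

sublocale fr: field_hom "\<lambda>x :: 'K. x ^ Q"
proof
  show "x ^ Q = 0 \<Longrightarrow> x = 0" for x :: 'K by simp
qed (use frob_add[of _ _ 1] in \<open>auto simp: power_mult_distrib\<close>)

abbreviation frp :: "'K poly \<Rightarrow> 'K poly" where "frp \<equiv> map_poly (\<lambda>x. x ^ Q)"

sublocale frp: field_hom frp
  by (rule fr.map_poly_hom)

text \<open>The field F_(Q^k). All these fields live inside one algebraically closed type, so that
  no tower of types is needed.\<close>

definition fixed_field :: "nat \<Rightarrow> 'K set" where "fixed_field k = {x. x ^ Q ^ k = x}"

definition base_field :: "'K set" where "base_field = {x. x ^ Q = x}"

lemma fixed_field_1: "fixed_field 1 = base_field" by (simp add: fixed_field_def base_field_def)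

lemma finite_fixed_field: "k > 0 \<Longrightarrow> finite (fixed_field k)" and card_fixed_field: "k > 0 \<Longrightarrow> card (fixed_field k) = Q ^ k"
  using card_frobenius_fixed[OF char Q_power, of k] t by (simp_all add: fixed_field_def)

lemma finite_base_field: "finite base_field" and card_base_field: "card base_field = Q"
  using finite_fixed_field[of 1] card_fixed_field[of 1] by (simp_all add: fixed_field_1[symmetric])

lemma base_field_1: "1 \<in> base_field"
  by (simp add: base_field_def)

lemma base_field_minus: "x \<in> base_field \<Longrightarrow> - x \<in> base_field"
  and base_field_mult: "x \<in> base_field \<Longrightarrow> y \<in> base_field \<Longrightarrow> x * y \<in> base_field"
  by (simp_all add: base_field_def fr.hom_minus power_mult_distrib)

text \<open>Membership in F_Q[x], phrased as invariance under the Frobenius: closure under products,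
  cancellation and remainders then follows by transport.\<close>

definition base_poly :: "'K poly \<Rightarrow> bool" where "base_poly h \<longleftrightarrow> frp h = h"

lemma base_poly_iff: "base_poly h \<longleftrightarrow> (\<forall>i. coeff h i \<in> base_field)"
  by (simp add: base_poly_def poly_eq_iff fr.coeff_map_poly_hom base_field_def)

lemma base_poly_mult: "base_poly f \<Longrightarrow> base_poly g \<Longrightarrow> base_poly (f * g)"
  and base_poly_add: "base_poly f \<Longrightarrow> base_poly g \<Longrightarrow> base_poly (f + g)"
  and base_poly_diff: "base_poly f \<Longrightarrow> base_poly g \<Longrightarrow> base_poly (f - g)"
  and base_poly_1: "base_poly 1"
  and base_poly_monom: "c \<in> base_field \<Longrightarrow> base_poly (monom c n)"
  and base_poly_smult: "c \<in> base_field \<Longrightarrow> base_poly f \<Longrightarrow> base_poly (smult c f)"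
  using Q_gt_1
  by (simp_all add: base_poly_def frp.hom_mult frp.hom_add frp.hom_diff map_poly_monom fr.map_poly_smult_hom base_field_def)

lemma base_poly_cancel:
  assumes "base_poly f" "base_poly (f * g)" "f \<noteq> 0" shows "base_poly g"
proof -
  have "f * frp g = f * g" using assms(1,2) by (simp add: base_poly_def frp.hom_mult)
  thus ?thesis using assms(3) by (simp add: base_poly_def)
qed

lemma base_poly_poly_power: "base_poly h \<Longrightarrow> poly h (x ^ Q ^ k) = poly h x ^ Q ^ k"
proof (induction k)
  case (Suc k)
  have "poly h (x ^ Q ^ Suc k) = poly (frp h) ((x ^ Q ^ k) ^ Q)"
    using Suc.prems by (simp add: base_poly_def mult.commute flip: power_mult)
  also have "\<dots> = poly h (x ^ Q ^ k) ^ Q" by (rule fr.poly_map_poly_hom)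
  finally show ?case using Suc by (simp add: mult.commute flip: power_mult)
qed auto

lemma base_poly_order_le: "base_poly h \<Longrightarrow> h \<noteq> 0 \<Longrightarrow> order x h \<le> order (x ^ Q ^ k) h"
proof (induction k)
  case (Suc k)
  have "order (x ^ Q ^ k) h \<le> order ((x ^ Q ^ k) ^ Q) (frp h)"
    using Suc.prems by (intro fr.order_map_poly_hom)
  also have "frp h = h" using Suc.prems by (simp add: base_poly_def)
  finally show ?case using Suc by (simp add: mult.commute flip: power_mult)
qed auto

definition monics :: "nat \<Rightarrow> 'K poly set" where
  "monics D = {h. base_poly h \<and> lead_coeff h = 1 \<and> degree h = D}"

text \<open>For \<open>x\<close> in F_(Q^k) this is the characteristic polynomial of
  \<open>x\<close> over F_Q, a power of its minimal polynomial. Unlike the latter it has degree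
  \<open>k\<close> for every \<open>x\<close>.\<close>

definition orbit_poly :: "nat \<Rightarrow> 'K \<Rightarrow> 'K poly" where
  "orbit_poly k x = (\<Prod>i<k. [:- (x ^ Q ^ i), 1:])"

lemma finite_over: "finite {h. base_poly h \<and> degree h \<le> D}"
proof (rule finite_subset)
  show "{h. base_poly h \<and> degree h \<le> D} \<subseteq> Poly ` {xs. set xs \<subseteq> base_field \<and> length xs \<le> Suc D}"
  proof
    fix h assume h: "h \<in> {h. base_poly h \<and> degree h \<le> D}"
    have "set (coeffs h) \<subseteq> base_field" using h by (auto simp: base_poly_iff coeffs_def)
    moreover have "length (coeffs h) \<le> Suc D" using h by (auto simp: coeffs_def)
    ultimately show "h \<in> Poly ` {xs. set xs \<subseteq> base_field \<and> length xs \<le> Suc D}"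
      by (intro image_eqI[of _ _ "coeffs h"]) auto
  qed
  show "finite (Poly ` {xs. set xs \<subseteq> base_field \<and> length xs \<le> Suc D})"
    using finite_lists_length_le[OF finite_base_field] by simp
qed

lemma finite_monics: "finite (monics D)"
  by (rule finite_subset[OF _ finite_over[of D]]) (auto simp: monics_def)

lemma monics_0: "monics 0 = {1}"
  using base_poly_1 by (auto simp: monics_def elim!: degree_eq_zeroE simp: one_pCons)

lemma lead_coeff_orbit_poly: "lead_coeff (orbit_poly k x) = 1"
  by (simp add: orbit_poly_def lead_coeff_prod)

lemma orbit_poly_nz: "orbit_poly k x \<noteq> 0" using lead_coeff_orbit_poly[of k x] by auto

lemma degree_orbit_poly: "degree (orbit_poly k x) = k"
  by (simp add: orbit_poly_def degree_prod_eq_sum_degree)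

text \<open>The Frobenius shifts the factors, and \<open>x \<in> fixed_field k\<close> closes the
  cycle.\<close>

lemma base_poly_orbit_poly:
  assumes "x \<in> fixed_field k" shows "base_poly (orbit_poly k x)"
proof -
  define g where "g i = [:- (x ^ Q ^ i), 1 :: 'K:]" for i
  have gk: "g k = g 0" using assms by (simp add: g_def fixed_field_def)
  have "frp (orbit_poly k x) = (\<Prod>i<k. frp (g i))" by (simp add: orbit_poly_def g_def frp.hom_prod)
  also have "\<dots> = (\<Prod>i<k. g (Suc i))"
    by (intro prod.cong refl) (simp add: g_def fr.map_poly_pCons_hom fr.hom_minus mult.commute flip: power_mult)
  also have "\<dots> = (\<Prod>i<k. g i)"
  proof -
    have "g 0 * (\<Prod>i<k. g (Suc i)) = (\<Prod>i<k. g i) * g k"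
      by (simp flip: prod.lessThan_Suc_shift prod.lessThan_Suc)
    moreover have "g 0 \<noteq> 0" by (simp add: g_def)
    ultimately show ?thesis using gk by (simp add: mult.commute)
  qed
  finally show ?thesis by (simp add: base_poly_def orbit_poly_def g_def)
qed

lemma orbit_poly_monics: "x \<in> fixed_field k \<Longrightarrow> orbit_poly k x \<in> monics k"
  using lead_coeff_orbit_poly[of k x] by (simp add: monics_def base_poly_orbit_poly degree_orbit_poly)

lemma mult_monics: "f \<in> monics a \<Longrightarrow> g \<in> monics b \<Longrightarrow> f * g \<in> monics (a + b)"
proof -
  assume *: "f \<in> monics a" "g \<in> monics b"
  hence "f \<noteq> 0" "g \<noteq> 0" by (auto simp: monics_def)
  thus ?thesis using * lead_coeff_mult[of f g] by (auto simp: monics_def base_poly_mult degree_mult_eq)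
qed

lemma fixed_field_iterate: "x \<in> fixed_field e \<Longrightarrow> x ^ Q ^ (e * q) = x"
proof (induction q)
  case (Suc q)
  have "x ^ Q ^ (e * Suc q) = (x ^ Q ^ (e * q)) ^ Q ^ e"
    by (simp add: power_add mult.commute flip: power_mult)
  thus ?case using Suc by (simp add: fixed_field_def)
qed auto

text \<open>Here \<open>e\<close> is the degree of \<open>x\<close> over F_Q. The sequence of
  conjugates repeats because all of them are roots of \<open>h\<close>.\<close>

lemma orbit_exponent:
  assumes "h \<in> monics D" "poly h x = 0"
  obtains e where "e > 0" "x \<in> fixed_field e" "\<And>k. x \<in> fixed_field k \<longleftrightarrow> e dvd k"
    "inj_on (\<lambda>i. x ^ Q ^ i) {..<e}"
proof -
  have h: "base_poly h" "h \<noteq> 0" using assms by (auto simp: monics_def)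
  have "\<not> inj (\<lambda>i. x ^ Q ^ i)"
  proof
    assume inj: "inj (\<lambda>i. x ^ Q ^ i)"
    have "range (\<lambda>i. x ^ Q ^ i) \<subseteq> {y. poly h y = 0}"
      using assms h Q_gt_1 by (auto simp: base_poly_poly_power power_0_left)
    hence "finite (range (\<lambda>i. x ^ Q ^ i))" using poly_roots_finite[OF h(2)] finite_subset by blast
    thus False using inj finite_imageD by blast
  qed
  then obtain i j where "i < j" "x ^ Q ^ i = x ^ Q ^ j"
    by (metis injI nat_neq_iff)
  hence "(x ^ Q ^ (j - i)) ^ Q ^ i = x ^ Q ^ i" by (simp flip: power_mult power_add)
  hence ex: "j - i > 0 \<and> x \<in> fixed_field (j - i)" using \<open>i < j\<close> frob_inj by (auto simp: fixed_field_def)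
  define e where "e = (LEAST e. e > 0 \<and> x \<in> fixed_field e)"
  have e: "e > 0" "x \<in> fixed_field e" using LeastI[of "\<lambda>e. e > 0 \<and> x \<in> fixed_field e", OF ex] by (auto simp: e_def)
  have min: "e \<le> k" if "k > 0" "x \<in> fixed_field k" for k
    unfolding e_def using that by (intro Least_le) auto
  note mult = fixed_field_iterate[OF e(2)]
  have iff: "x \<in> fixed_field k \<longleftrightarrow> e dvd k" for k
  proof
    assume "x \<in> fixed_field k"
    have "x ^ Q ^ k = (x ^ Q ^ (e * (k div e))) ^ Q ^ (k mod e)"
      by (simp flip: power_mult power_add)
    hence "x \<in> fixed_field (k mod e)" using \<open>x \<in> fixed_field k\<close> by (simp add: mult fixed_field_def)
    hence "k mod e = 0" using min[of "k mod e"] e(1) by (metis leD mod_less_divisor neq0_conv)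
    thus "e dvd k" by auto
  qed (auto simp: fixed_field_def mult)
  have "inj_on (\<lambda>i. x ^ Q ^ i) {..<e}"
  proof (rule linorder_inj_onI)
    fix i j assume ij: "i < j" "i \<in> {..<e}" "j \<in> {..<e}"
    show "x ^ Q ^ i \<noteq> x ^ Q ^ j"
    proof
      assume "x ^ Q ^ i = x ^ Q ^ j"
      hence "(x ^ Q ^ (j - i)) ^ Q ^ i = x ^ Q ^ i" using ij by (simp flip: power_mult power_add)
      hence "x \<in> fixed_field (j - i)" using frob_inj by (auto simp: fixed_field_def)
      thus False using min[of "j - i"] ij by auto
    qed
  qed auto
  with e iff that show ?thesis by blast
qed

lemma order_cp_power:
  assumes "inj_on (\<lambda>i. x ^ Q ^ i) {..<e}"
  shows "order y (orbit_poly e x ^ q) = (if y \<in> (\<lambda>i. x ^ Q ^ i) ` {..<e} then q else 0)"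
proof -
  have "order y (orbit_poly e x) = (\<Sum>i<e. order y [:- (x ^ Q ^ i), 1:])"
    unfolding orbit_poly_def by (rule order_prod) auto
  also have "\<dots> = (\<Sum>i<e. if y = x ^ Q ^ i then 1 else 0)"
    by (intro sum.cong) (auto simp: order_linear_factor_other order_linear_factor_same simp del: One_nat_def)
  also have "\<dots> = (\<Sum>z\<in>(\<lambda>i. x ^ Q ^ i) ` {..<e}. if y = z then 1 else 0)"
    by (subst sum.reindex[OF assms]) (simp add: o_def)
  also have "\<dots> = (if y \<in> (\<lambda>i. x ^ Q ^ i) ` {..<e} then 1 else 0)"
    by (simp add: sum.delta')
  finally show ?thesis by (simp add: order_power orbit_poly_nz)
qed

lemma prod_lessThan_add: "(\<Prod>i<a + b. f i) = (\<Prod>i<a. f i) * (\<Prod>i<b. f (a + i))"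
  for f :: "nat \<Rightarrow> 'b :: comm_monoid_mult"
  by (induction b) (auto simp: mult.assoc)

lemma orbit_poly_mult:
  assumes "x \<in> fixed_field e" shows "orbit_poly (e * q) x = orbit_poly e x ^ q"
proof (induction q)
  case (Suc q)
  have shift: "x ^ Q ^ (e * q + i) = x ^ Q ^ i" for i
    using fixed_field_iterate[OF assms, of q] by (simp add: power_add power_mult)
  have "orbit_poly (e * Suc q) x = orbit_poly (e * q) x * (\<Prod>i<e. [:- (x ^ Q ^ (e * q + i)), 1:])"
    by (simp only: orbit_poly_def mult_Suc_right add.commute[of e] prod_lessThan_add)
  thus ?case using Suc by (simp only: shift) (simp add: orbit_poly_def mult.commute)
qed (simp add: orbit_poly_def)

text \<open>Only multiples \<open>k = e * q\<close> of the degree \<open>e\<close> of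
  \<open>x\<close> matter, and for them \<open>orbit_poly k x\<close> is the q-th power of the
  minimal polynomial, which divides \<open>h\<close> exactly if
  \<open>q \<le> order x h\<close>.\<close>

lemma card_cp_dvd:
  assumes h: "h \<in> monics D" and x: "poly h x = 0"
  shows "card {k \<in> {1..D}. x \<in> fixed_field k \<and> orbit_poly k x dvd h} = order x h"
proof -
  obtain e where e: "e > 0" "x \<in> fixed_field e" "\<And>k. x \<in> fixed_field k \<longleftrightarrow> e dvd k"
    and inj: "inj_on (\<lambda>i. x ^ Q ^ i) {..<e}"
    using orbit_exponent[OF h x] by metis
  have h': "base_poly h" "h \<noteq> 0" "degree h = D" using h by (auto simp: monics_def)
  have dvd: "orbit_poly (e * q) x dvd h \<longleftrightarrow> q \<le> order x h" for q
  proof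
    assume "orbit_poly (e * q) x dvd h"
    hence "order x (orbit_poly e x ^ q) \<le> order x h"
      using e h' by (intro dvd_imp_order_le) (auto simp: orbit_poly_mult)
    moreover have "x \<in> (\<lambda>i. x ^ Q ^ i) ` {..<e}" using e(1) by (intro image_eqI[of _ _ 0]) auto
    ultimately show "q \<le> order x h" by (simp add: order_cp_power[OF inj])
  next
    assume q: "q \<le> order x h"
    have "order y (orbit_poly e x ^ q) \<le> order y h" for y
      using base_poly_order_le[OF h'(1,2), of x] q by (auto simp: order_cp_power[OF inj] intro: order.trans)
    thus "orbit_poly (e * q) x dvd h" unfolding orbit_poly_mult[OF e(2)] by (intro alg_closed_dvdI) (auto simp: orbit_poly_nz)
  qed
  have "bij_betw (\<lambda>q. e * q) {1..order x h} {k \<in> {1..D}. x \<in> fixed_field k \<and> orbit_poly k x dvd h}"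
  proof (rule bij_betwI[where g = "\<lambda>k. k div e"])
    show "(\<lambda>q. e * q) \<in> {1..order x h} \<rightarrow> {k \<in> {1..D}. x \<in> fixed_field k \<and> orbit_poly k x dvd h}"
    proof
      fix q assume q: "q \<in> {1..order x h}"
      hence "orbit_poly (e * q) x dvd h" by (simp add: dvd)
      moreover from this have "e * q \<le> D" using dvd_imp_degree_le[of "orbit_poly (e * q) x" h] h' by (simp add: degree_orbit_poly)
      ultimately show "e * q \<in> {k \<in> {1..D}. x \<in> fixed_field k \<and> orbit_poly k x dvd h}" using q e by auto
    qed
  next
    show "(\<lambda>k. k div e) \<in> {k \<in> {1..D}. x \<in> fixed_field k \<and> orbit_poly k x dvd h} \<rightarrow> {1..order x h}"
    proof
      fix k assume k: "k \<in> {k \<in> {1..D}. x \<in> fixed_field k \<and> orbit_poly k x dvd h}"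
      then obtain q where q: "k = e * q" using e(3)[of k] by auto
      thus "k div e \<in> {1..order x h}" using k dvd[of q] e(1) by (cases q) auto
    qed
  qed (use e in auto)
  hence "card {1..order x h} = card {k \<in> {1..D}. x \<in> fixed_field k \<and> orbit_poly k x dvd h}" by (rule bij_betw_same_card)
  thus ?thesis by simp
qed

text \<open>Each root is counted with its multiplicity by \<open>card_cp_dvd\<close>. This is the
  polynomial analogue of writing log n as the sum of the von Mangoldt function over the divisors of
  n.\<close>

lemma degree_eq_count:
  assumes h: "h \<in> monics D"
  shows "D = (\<Sum>k=1..D. card {x \<in> fixed_field k. orbit_poly k x dvd h})"
proof -
  have h': "base_poly h" "h \<noteq> 0" "degree h = D" using h by (auto simp: monics_def)
  define R where "R = {x. poly h x = 0}"
  have finR: "finite R" using h' poly_roots_finite by (auto simp: R_def)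
  have sub: "x \<in> R" if "orbit_poly k x dvd h" "k \<ge> 1" for x k
  proof -
    have "orbit_poly k x = [:-x, 1:] * (\<Prod>i\<in>{..<k}-{0}. [:- (x ^ Q ^ i), 1:])"
      unfolding orbit_poly_def using that by (subst prod.remove[of _ 0]) auto
    hence "[:-x, 1:] dvd h" using that by (metis dvd_mult_left)
    thus ?thesis by (simp add: R_def poly_eq_0_iff_dvd)
  qed
  have "D = size (proots h)" using h' by (simp add: alg_closed_size_proots)
  also have "\<dots> = (\<Sum>x\<in>R. order x h)" using h' by (simp add: size_multiset_overloaded_eq R_def)
  also have "\<dots> = (\<Sum>x\<in>R. \<Sum>k=1..D. if x \<in> fixed_field k \<and> orbit_poly k x dvd h then 1 else 0)"
    using card_cp_dvd[OF h] by (intro sum.cong) (auto simp: R_def sum.If_cases Int_def)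
  also have "\<dots> = (\<Sum>k=1..D. \<Sum>x\<in>R. if x \<in> fixed_field k \<and> orbit_poly k x dvd h then 1 else 0)" by (rule sum.swap)
  also have "\<dots> = (\<Sum>k=1..D. card {x \<in> fixed_field k. orbit_poly k x dvd h})"
  proof (intro sum.cong refl)
    fix k assume k: "k \<in> {1..D}"
    have "{x \<in> R. x \<in> fixed_field k \<and> orbit_poly k x dvd h} = {x \<in> fixed_field k. orbit_poly k x dvd h}" using sub k by auto
    thus "(\<Sum>x\<in>R. if x \<in> fixed_field k \<and> orbit_poly k x dvd h then 1 else 0) = card {x \<in> fixed_field k. orbit_poly k x dvd h}"
      using finR by (simp add: sum.If_cases Int_def)
  qed
  finally show ?thesis .
qed

text \<open>The logarithmic derivative of an Euler product: weight every monic \<open>h\<close> by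
  its degree, expand the degree by \<open>degree_eq_count\<close>, and split off the factor
  \<open>orbit_poly k x\<close>.\<close>

lemma newton_identity:
  fixes \<Lambda> :: "'K poly \<Rightarrow> complex"
  assumes mult: "\<And>a b f g. f \<in> monics a \<Longrightarrow> g \<in> monics b \<Longrightarrow> \<Lambda> (f * g) = \<Lambda> f * \<Lambda> g"
  shows "of_nat D * (\<Sum>h\<in>monics D. \<Lambda> h) =
    (\<Sum>k=1..D. (\<Sum>x\<in>fixed_field k. \<Lambda> (orbit_poly k x)) * (\<Sum>h\<in>monics (D - k). \<Lambda> h))"
proof -
  have "of_nat D * (\<Sum>h\<in>monics D. \<Lambda> h) = (\<Sum>h\<in>monics D. \<Sum>k=1..D. \<Sum>x\<in>fixed_field k. if orbit_poly k x dvd h then \<Lambda> h else 0)"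
    unfolding sum_distrib_left
  proof (intro sum.cong refl)
    fix h assume h: "h \<in> monics D"
    have "of_nat D * \<Lambda> h = of_nat (\<Sum>k=1..D. card {x \<in> fixed_field k. orbit_poly k x dvd h}) * \<Lambda> h"
      using degree_eq_count[OF h] by simp
    also have "\<dots> = (\<Sum>k=1..D. of_nat (card {x \<in> fixed_field k. orbit_poly k x dvd h}) * \<Lambda> h)"
      by (simp add: sum_distrib_right)
    also have "\<dots> = (\<Sum>k=1..D. \<Sum>x\<in>fixed_field k. if orbit_poly k x dvd h then \<Lambda> h else 0)"
      by (intro sum.cong refl) (auto simp: sum.If_cases finite_fixed_field Int_def)
    finally show "of_nat D * \<Lambda> h = (\<Sum>k=1..D. \<Sum>x\<in>fixed_field k. if orbit_poly k x dvd h then \<Lambda> h else 0)" .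
  qed
  also have "\<dots> = (\<Sum>k=1..D. \<Sum>x\<in>fixed_field k. \<Sum>h\<in>monics D. if orbit_poly k x dvd h then \<Lambda> h else 0)"
    by (subst sum.swap) (intro sum.cong refl sum.swap)
  also have "\<dots> = (\<Sum>k=1..D. \<Sum>x\<in>fixed_field k. \<Lambda> (orbit_poly k x) * (\<Sum>h\<in>monics (D - k). \<Lambda> h))"
  proof (intro sum.cong refl)
    fix k x assume k: "k \<in> {1..D}" and x: "x \<in> fixed_field k"
    have "(\<Sum>h\<in>monics D. if orbit_poly k x dvd h then \<Lambda> h else 0) = (\<Sum>h\<in>{h \<in> monics D. orbit_poly k x dvd h}. \<Lambda> h)"
      using finite_monics by (simp add: sum.inter_filter)
    also have "\<dots> = (\<Sum>h\<in>monics (D - k). \<Lambda> (orbit_poly k x * h))"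
    proof (rule sum.reindex_bij_witness[of _ "\<lambda>h. orbit_poly k x * h" "\<lambda>h. h div orbit_poly k x"])
      fix h assume h: "h \<in> {h \<in> monics D. orbit_poly k x dvd h}"
      then obtain r where r: "h = orbit_poly k x * r" by auto
      have "base_poly r" using base_poly_cancel[of "orbit_poly k x" r] h r x by (auto simp: monics_def base_poly_orbit_poly orbit_poly_nz)
      moreover have "r \<noteq> 0" using h r by (auto simp: monics_def)
      moreover have "lead_coeff r = 1"
        using h lead_coeff_mult[of "orbit_poly k x" r] unfolding r by (simp only: lead_coeff_orbit_poly monics_def mem_Collect_eq mult_1)
      moreover have "degree h = k + degree r"
        using \<open>r \<noteq> 0\<close> by (simp add: r degree_mult_eq degree_orbit_poly orbit_poly_nz)
      ultimately have "r \<in> monics (D - k)" using h by (auto simp: monics_def)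
      thus "h div orbit_poly k x \<in> monics (D - k)" "orbit_poly k x * (h div orbit_poly k x) = h"
        "\<Lambda> (orbit_poly k x * (h div orbit_poly k x)) = \<Lambda> h" using r orbit_poly_nz by simp_all
    next
      fix h assume h: "h \<in> monics (D - k)"
      thus "orbit_poly k x * h div orbit_poly k x = h" "orbit_poly k x * h \<in> {h \<in> monics D. orbit_poly k x dvd h}"
        using mult_monics[OF orbit_poly_monics[OF x] h] k orbit_poly_nz by auto
    qed
    also have "\<dots> = \<Lambda> (orbit_poly k x) * (\<Sum>h\<in>monics (D - k). \<Lambda> h)"
      unfolding sum_distrib_left using mult[OF orbit_poly_monics[OF x]] by (intro sum.cong) auto
    finally show "(\<Sum>h\<in>monics D. if orbit_poly k x dvd h then \<Lambda> h else 0) = \<Lambda> (orbit_poly k x) * (\<Sum>h\<in>monics (D - k). \<Lambda> h)" .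
  qed
  also have "\<dots> = (\<Sum>k=1..D. (\<Sum>x\<in>fixed_field k. \<Lambda> (orbit_poly k x)) * (\<Sum>h\<in>monics (D - k). \<Lambda> h))"
    by (simp add: sum_distrib_right)
  finally show ?thesis .
qed

end

section \<open>L-functions of mixed characters\<close>

text \<open>The logarithmic derivative of the product, cleared of its denominator; each factor
  contributes a geometric series.\<close>

lemma fps_log_deriv_prod:
  fixes M :: "complex multiset"
  defines "F \<equiv> (\<Prod>w\<in>#M. 1 - fps_const w * fps_X)"
  shows "fps_X * fps_deriv F = - F * (\<Sum>w\<in>#M. Abs_fps (\<lambda>k. if k = 0 then 0 else w ^ k))"
  unfolding F_def
proof (induction M)
  case (add w M)
  define F0 where "F0 = (\<Prod>w\<in>#M. 1 - fps_const w * fps_X)"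
  define G0 where "G0 = (\<Sum>w\<in>#M. Abs_fps (\<lambda>k. if k = 0 then 0 else w ^ k))"
  define Gw where "Gw = Abs_fps (\<lambda>k. if k = 0 then 0 else w ^ k)"
  have IH: "fps_X * fps_deriv F0 = - F0 * G0" using add.IH by (simp add: F0_def G0_def)
  have Gw: "(1 - fps_const w * fps_X) * Gw = fps_const w * fps_X"
  proof (rule fps_ext)
    fix k
    show "fps_nth ((1 - fps_const w * fps_X) * Gw) k = fps_nth (fps_const w * fps_X) k"
      by (cases k) (auto simp: Gw_def left_diff_distrib mult.assoc)
  qed
  have "fps_X * fps_deriv ((1 - fps_const w * fps_X) * F0)
      = (1 - fps_const w * fps_X) * (fps_X * fps_deriv F0) - fps_const w * fps_X * F0"
    by (simp add: algebra_simps)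
  also have "\<dots> = - ((1 - fps_const w * fps_X) * F0) * (Gw + G0)"
    unfolding IH by (subst Gw [symmetric]) (simp add: algebra_simps)
  finally show ?case by (simp add: F0_def G0_def Gw_def)
qed auto

text \<open>The numbers \<open>A D\<close> are the coefficients of a polynomial with constant term
  1, hence of a product of factors \<open>1 - w X\<close>. Its logarithmic derivative shows that the
  negated power sums of the \<open>w\<close> satisfy the same recurrence as
  \<open>P\<close>.\<close>

lemma power_sums_of_recurrence:
  fixes A P :: "nat \<Rightarrow> complex"
  assumes A0: "A 0 = 1" and Am: "\<And>D. D > m \<Longrightarrow> A D = 0"
    and rec: "\<And>D. of_nat D * A D = (\<Sum>k=1..D. P k * A (D - k))"
  obtains w :: "nat \<Rightarrow> complex" and m' where "m' \<le> m" "\<And>k. k \<ge> 1 \<Longrightarrow> P k = - (\<Sum>i<m'. w i ^ k)"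
proof -
  define p where "p = Poly (map A [0..<Suc m])"
  have coeff_p: "coeff p D = A D" for D
    using Am by (auto simp: p_def nth_default_def simp del: upt_Suc)
  have "p \<noteq> 0" using A0 coeff_p[of 0] by auto
  have degp: "degree p \<le> m" by (rule degree_le) (auto simp: coeff_p Am)
  have nz: "r \<noteq> 0" if "r \<in># proots p" for r
    using that \<open>p \<noteq> 0\<close> A0 coeff_p[of 0] by (auto simp: poly_0_coeff_0)
  define W where "W = image_mset inverse (proots p)"
  have fac: "p = (\<Prod>w\<in>#W. [:1, -w:])"
  proof -
    have *: "[:-r, 1:] = smult (-r) [:1, -inverse r:]" if "r \<noteq> 0" for r :: complex using that by simp
    have "(\<Prod>r\<in>#B. [:-r, 1:]) = smult (\<Prod>r\<in>#B. -r) (\<Prod>r\<in>#B. [:1, -inverse r:])" if "0 \<notin># B" for B :: "complex multiset"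
      using that
    proof (induction B)
      case (add r B)
      hence "(\<Prod>r\<in>#add_mset r B. [:-r, 1:]) = smult (-r) [:1, -inverse r:] * smult (\<Prod>r\<in>#B. -r) (\<Prod>r\<in>#B. [:1, -inverse r:])"
        using *[of r] by (simp del: mult_pCons_left smult_pCons)
      also have "\<dots> = smult (-r * (\<Prod>r\<in>#B. -r)) ([:1, -inverse r:] * (\<Prod>r\<in>#B. [:1, -inverse r:]))"
        by (simp only: mult_smult_left mult_smult_right smult_smult mult.commute)
      finally show ?case by simp
    qed auto
    from this[of "proots p"] have eq: "(\<Prod>r\<in>#proots p. [:-r, 1:]) = smult (\<Prod>r\<in>#proots p. -r) (\<Prod>w\<in>#W. [:1, -w:])"
      using nz by (auto simp: W_def image_mset.compositionality o_def)
    have "p = smult (lead_coeff p) (\<Prod>r\<in>#proots p. [:-r, 1:])" by (rule alg_closed_prod_proots [symmetric])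
    hence "p = smult (lead_coeff p * (\<Prod>r\<in>#proots p. -r)) (\<Prod>w\<in>#W. [:1, -w:])"
      by (simp only: eq smult_smult)
    moreover from this have "coeff p 0 = lead_coeff p * (\<Prod>r\<in>#proots p. -r)"
    proof -
      have "poly (\<Prod>w\<in>#W. [:1, -w:]) 0 = 1" by (simp add: poly_prod_mset image_mset.compositionality o_def)
      thus ?thesis
        using arg_cong[OF \<open>p = smult (lead_coeff p * (\<Prod>r\<in>#proots p. -r)) (\<Prod>w\<in>#W. [:1, -w:])\<close>, of "\<lambda>q. poly q 0"]
        by (simp add: poly_0_coeff_0)
    qed
    ultimately show ?thesis using A0 coeff_p[of 0] by (metis smult_1_left)
  qed
  define F where "F = (\<Prod>w\<in>#W. 1 - fps_const w * fps_X)"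
  have "F = fps_of_poly p"
  proof -
    have "fps_of_poly [:1, -w:] = 1 - fps_const w * fps_X" for w :: complex
      by (rule fps_ext) (auto simp: coeff_pCons fps_X_def split: nat.splits)
    hence "fps_of_poly (\<Prod>w\<in>#B. [:1, -w:]) = (\<Prod>w\<in>#B. 1 - fps_const w * fps_X)" for B :: "complex multiset"
      by (induction B) (auto simp: fps_of_poly_mult simp del: mult_pCons_left)
    thus ?thesis by (simp only: F_def fac)
  qed
  hence FA: "fps_nth F D = A D" for D by (simp add: coeff_p)
  define P' where "P' k = - (\<Sum>w\<in>#W. w ^ k)" for k
  have G: "fps_nth (\<Sum>w\<in>#W. Abs_fps (\<lambda>k. if k = 0 then 0 else w ^ k)) k = (if k = 0 then 0 else - P' k)" for k
    unfolding P'_def by (induction W) auto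
  have rec': "of_nat D * A D = (\<Sum>k=1..D. P' k * A (D - k))" for D
  proof -
    have "of_nat D * A D = fps_nth (fps_X * fps_deriv F) D"
      by (cases D) (auto simp: FA)
    also have "\<dots> = - fps_nth ((\<Sum>w\<in>#W. Abs_fps (\<lambda>k. if k = 0 then 0 else w ^ k)) * F) D"
      unfolding F_def fps_log_deriv_prod by (simp add: mult.commute)
    also have "\<dots> = - (\<Sum>k=0..D. (if k = 0 then 0 else - P' k) * A (D - k))"
      by (simp only: fps_mult_nth G FA)
    also have "\<dots> = (\<Sum>k=1..D. P' k * A (D - k))"
      by (simp add: sum.atLeast_Suc_atMost sum_negf)
    finally show ?thesis .
  qed
  \<comment> \<open>The recurrence determines \<open>P\<close>, since \<open>P D\<close> occurs in
    it with the coefficient \<open>A 0 = 1\<close>.\<close>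
  have eq: "P k = P' k" if "k \<ge> 1" for k
    using that
  proof (induction k rule: less_induct)
    case (less D)
    then obtain D' where D: "D = Suc D'" by (cases D) auto
    have "(\<Sum>k=1..D. P k * A (D - k)) = (\<Sum>k=1..D. P' k * A (D - k))"
      using rec[of D] rec'[of D] by simp
    moreover have "(\<Sum>k=1..D'. P k * A (D - k)) = (\<Sum>k=1..D'. P' k * A (D - k))"
      using less.IH D by (intro sum.cong) auto
    ultimately show ?case using A0 by (simp add: D)
  qed
  obtain ws where ws: "mset ws = W" using ex_mset by blast
  show ?thesis
  proof (rule that[of "length ws" "\<lambda>i. ws ! i"])
    have "length ws = size W" by (simp flip: ws)
    also have "\<dots> \<le> degree p" by (simp add: W_def size_proots_le)
    finally show "length ws \<le> m" using degp by simp
    show "P k = - (\<Sum>i<length ws. ws ! i ^ k)" if "k \<ge> 1" for k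
    proof -
      have "(\<Sum>w\<in>#W. w ^ k) = sum_list (map (\<lambda>w. w ^ k) ws)"
        by (simp flip: ws sum_mset_sum_list)
      also have "\<dots> = (\<Sum>i<length ws. ws ! i ^ k)"
        by (simp add: sum_list_sum_nth atLeast0LessThan)
      finally show ?thesis using eq[OF that] by (simp add: P'_def)
    qed
  qed
qed

lemma sum_proots_monic:
  fixes h :: "'K :: alg_closed_field poly"
  assumes "lead_coeff h = 1" "degree h > 0"
  shows "sum_mset (proots h) = - coeff h (degree h - 1)"
proof -
  have "coeff (\<Prod>x\<in>#B. [:-x, 1:]) (size B) = 1 \<and>
      (size B > 0 \<longrightarrow> coeff (\<Prod>x\<in>#B. [:-x, 1:]) (size B - 1) = - sum_mset B)" for B :: "'K multiset"
  proof (induction B)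
    case (add x B)
    have "degree (\<Prod>x\<in>#B. [:-x, 1:]) = size B"
      by (subst alg_closed_size_proots [symmetric]) (simp add: proots_prod_linear)
    hence "coeff (\<Prod>x\<in>#B. [:-x, 1:]) (Suc (size B)) = 0" by (intro coeff_eq_0) simp
    with add show ?case by (cases "size B") (auto simp: coeff_pCons)
  qed auto
  from this[of "proots h"] show ?thesis
    using assms alg_closed_prod_proots[of h] by (simp add: alg_closed_size_proots)
qed

text \<open>Symmetry of the resultant. It replaces a product over the unknown roots of
  \<open>h\<close> by values of \<open>h\<close> at the fixed roots of \<open>F\<close>, which
  depend on a residue class of \<open>h\<close> only.\<close>

lemma prod_proots_swap:
  fixes F h :: "'K :: alg_closed_field poly"
  assumes h: "lead_coeff h = 1"
  shows "(\<Prod>\<alpha>\<in>#proots h. poly F \<alpha>) =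
    lead_coeff F ^ degree h * ((-1) ^ degree h) ^ degree F * (\<Prod>\<beta>\<in>#proots F. poly h \<beta>)"
proof -
  have F: "poly F x = lead_coeff F * (\<Prod>\<beta>\<in>#proots F. x - \<beta>)" for x
    by (subst alg_closed_prod_proots [symmetric, of F])
       (simp only: poly_smult poly_prod_mset image_mset.compositionality o_def, simp)
  have H: "poly h x = (\<Prod>\<alpha>\<in>#proots h. x - \<alpha>)" for x
    by (subst alg_closed_prod_proots [symmetric, of h])
       (simp only: h poly_smult poly_prod_mset image_mset.compositionality o_def, simp)
  have swap: "(\<Prod>\<alpha>\<in>#A. \<Prod>\<beta>\<in>#B. \<alpha> - \<beta>) = ((-1) ^ size A) ^ size B * (\<Prod>\<beta>\<in>#B. \<Prod>\<alpha>\<in>#A. \<beta> - \<alpha>)"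
    for A B :: "'K multiset"
  proof (induction B)
    case (add b B)
    have "(\<Prod>\<alpha>\<in>#A. \<alpha> - b) = (\<Prod>\<alpha>\<in>#A. -1 * (b - \<alpha>))" by simp
    also have "\<dots> = (-1) ^ size A * (\<Prod>\<alpha>\<in>#A. b - \<alpha>)"
      by (subst prod_mset.distrib) (simp only: prod_mset_constant)
    finally have *: "(\<Prod>\<alpha>\<in>#A. \<alpha> - b) = (-1) ^ size A * (\<Prod>\<alpha>\<in>#A. b - \<alpha>)" .
    have "(\<Prod>\<alpha>\<in>#A. \<Prod>\<beta>\<in>#add_mset b B. \<alpha> - \<beta>) = (\<Prod>\<alpha>\<in>#A. \<alpha> - b) * (\<Prod>\<alpha>\<in>#A. \<Prod>\<beta>\<in>#B. \<alpha> - \<beta>)"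
      by (subst prod_mset.distrib [symmetric]) simp
    thus ?case unfolding add.IH * by (simp add: mult_ac)
  qed auto
  have "(\<Prod>\<alpha>\<in>#proots h. poly F \<alpha>) = lead_coeff F ^ size (proots h) * (\<Prod>\<alpha>\<in>#proots h. \<Prod>\<beta>\<in>#proots F. \<alpha> - \<beta>)"
  proof -
    have "image_mset (poly F) (proots h) = image_mset (\<lambda>\<alpha>. lead_coeff F * (\<Prod>\<beta>\<in>#proots F. \<alpha> - \<beta>)) (proots h)"
      by (intro image_mset_cong F)
    thus ?thesis by (simp add: prod_mset.distrib)
  qed
  also have "\<dots> = lead_coeff F ^ degree h * (((-1) ^ degree h) ^ degree F * (\<Prod>\<beta>\<in>#proots F. poly h \<beta>))"
    by (subst swap) (simp only: alg_closed_size_proots H [symmetric])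
  finally show ?thesis by (simp add: mult.assoc)
qed

section \<open>Norm, trace and symmetric functions of roots over F_Q\<close>

context finite_frobenius
begin

definition Nm :: "nat \<Rightarrow> 'K \<Rightarrow> 'K" where "Nm k x = (\<Prod>i<k. x ^ Q ^ i)"

definition Tr :: "nat \<Rightarrow> 'K \<Rightarrow> 'K" where "Tr k x = (\<Sum>i<k. x ^ Q ^ i)"

lemma proots_frob:
  assumes "base_poly h" "h \<noteq> 0" shows "image_mset (\<lambda>x. x ^ Q) (proots h) = proots h"
proof -
  have "frp (smult (lead_coeff h) (\<Prod>x\<in>#proots h. [:-x, 1:])) = h"
    unfolding alg_closed_prod_proots using assms by (simp add: base_poly_def)
  hence "smult (lead_coeff h ^ Q) (\<Prod>x\<in>#image_mset (\<lambda>x. x ^ Q) (proots h). [:-x, 1:]) = h"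
    by (simp add: fr.map_poly_smult_hom frp.hom_prod_mset image_mset.compositionality o_def
        fr.map_poly_pCons_hom fr.hom_minus)
  from arg_cong[OF this, of proots] show ?thesis
    using assms by (simp add: proots_prod_linear)
qed

lemma sum_proots_base_field:
  assumes "base_poly h" "h \<noteq> 0" shows "sum_mset (proots h) \<in> base_field"
proof -
  have "sum_mset B ^ Q = (\<Sum>x\<in>#B. x ^ Q)" for B :: "'K multiset"
    using Q_gt_1 by (induction B) (auto simp: fr.hom_add)
  thus ?thesis using proots_frob[OF assms] by (simp add: base_field_def)
qed

lemma prod_proots_base_field:
  assumes "base_poly h" "h \<noteq> 0" "base_poly F" shows "(\<Prod>x\<in>#proots h. poly F x) \<in> base_field"
proof -
  have *: "(\<Prod>x\<in>#B. poly F x) ^ Q = (\<Prod>x\<in>#image_mset (\<lambda>x. x ^ Q) B. poly F x)" for B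
    using base_poly_poly_power[OF assms(3), of _ 1] by (induction B) (auto simp: power_mult_distrib)
  show ?thesis using *[of "proots h"] proots_frob[OF assms(1,2)] by (simp add: base_field_def)
qed

lemma proots_orbit_poly: "proots (orbit_poly k x) = image_mset (\<lambda>i. x ^ Q ^ i) (mset_set {..<k})"
proof -
  have "orbit_poly k x = (\<Prod>y\<in>#image_mset (\<lambda>i. x ^ Q ^ i) (mset_set {..<k}). [:-y, 1:])"
    by (simp add: orbit_poly_def prod_unfold_prod_mset image_mset.compositionality o_def)
  thus ?thesis by (simp only: proots_prod_linear)
qed

text \<open>Uniqueness of division with remainder, applied to the Frobenius image of the
  division.\<close>

lemma base_poly_mod:
  assumes "base_poly h" "base_poly M" "degree M > 0" shows "base_poly (h mod M)"
proof -
  have "frp h = frp (h div M) * M + frp (h mod M)"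
    using assms(2) by (metis div_mult_mod_eq frp.hom_add frp.hom_mult base_poly_def)
  hence "h = frp (h div M) * M + frp (h mod M)" using assms(1) by (simp only: base_poly_def)
  hence "h mod M = (frp (h div M) * M + frp (h mod M)) mod M" by (rule arg_cong)
  also have "\<dots> = frp (h mod M) mod M" by (rule mod_mult_self3)
  also have "\<dots> = frp (h mod M)"
  proof (rule mod_poly_less)
    have "M \<noteq> 0" using assms(3) by auto
    thus "degree (frp (h mod M)) < degree M"
      using degree_mod_less'[of M h] assms(3) by (cases "h mod M = 0") (simp_all add: fr.degree_map_poly_hom)
  qed
  finally show ?thesis by (simp add: base_poly_def)
qed

end

section \<open>The L-function and the vanishing of its coefficients\<close>

locale char_sum = finite_frobenius Q t dummy for Q t and dummy :: "'K :: alg_closed_field itself" +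
  fixes F M :: "'K poly" and \<chi> \<psi> :: "'K \<Rightarrow> complex"
  assumes F: "base_poly F" "F \<noteq> 0" and M: "base_poly M" "lead_coeff M = 1" "degree M > 0"
    and FM: "\<And>x. poly F x = 0 \<Longrightarrow> poly M x = 0"
    and chi_mult: "\<And>x y. x \<in> base_field \<Longrightarrow> y \<in> base_field \<Longrightarrow> \<chi> (x * y) = \<chi> x * \<chi> y"
    and chi_1: "\<chi> 1 = 1"
    and psi_add: "\<And>x y. x \<in> base_field \<Longrightarrow> y \<in> base_field \<Longrightarrow> \<psi> (x + y) = \<psi> x * \<psi> y"
    and psi_0: "\<psi> 0 = 1"
begin

text \<open>A Dirichlet character of the residue of \<open>h\<close> modulo \<open>M\<close>, up to
  a constant that depends on the degree, times a character of the second coefficient of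
  \<open>h\<close>. On \<open>orbit_poly k x\<close> it takes the value of the summand over
  F_(Q^k).\<close>

definition \<Lambda> :: "'K poly \<Rightarrow> complex" where
  "\<Lambda> h = \<chi> (\<Prod>\<alpha>\<in>#proots h. poly F \<alpha>) * \<psi> (sum_mset (proots h))"

text \<open>The coefficients of the L-function attached to \<open>\<Lambda>\<close>.\<close>

definition A :: "nat \<Rightarrow> complex" where "A D = (\<Sum>h\<in>monics D. \<Lambda> h)"

definition Sk :: "nat \<Rightarrow> complex" where
  "Sk k = (\<Sum>x\<in>fixed_field k. \<chi> (Nm k (poly F x)) * \<psi> (Tr k x))"

text \<open>Up to the constant \<open>cst\<close>, the resultant of \<open>h\<close> and
  \<open>F\<close>. As \<open>M\<close> vanishes at all zeros of \<open>F\<close>, it depends only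
  on \<open>h\<close> modulo \<open>M\<close>.\<close>

definition B :: "'K poly \<Rightarrow> 'K" where "B h = (\<Prod>\<beta>\<in>#proots F. poly h \<beta>)"

definition cst :: "nat \<Rightarrow> 'K" where "cst D = lead_coeff F ^ D * ((-1) ^ D) ^ degree F"

lemma Lambda_orbit_poly: "\<Lambda> (orbit_poly k x) = \<chi> (Nm k (poly F x)) * \<psi> (Tr k x)"
  unfolding \<Lambda>_def proots_orbit_poly
  by (simp add: Nm_def Tr_def base_poly_poly_power[OF F(1)] image_mset.compositionality o_def
      flip: prod_unfold_prod_mset sum_unfold_sum_mset)

lemma Lambda_mult: "f \<in> monics a \<Longrightarrow> g \<in> monics b \<Longrightarrow> \<Lambda> (f * g) = \<Lambda> f * \<Lambda> g"
proof -
  assume "f \<in> monics a" "g \<in> monics b"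
  hence *: "base_poly f" "f \<noteq> 0" "base_poly g" "g \<noteq> 0" by (auto simp: monics_def)
  show ?thesis unfolding \<Lambda>_def proots_mult[OF *(2,4)]
    by (simp add: chi_mult psi_add prod_proots_base_field sum_proots_base_field * F)
qed

lemma A_0: "A 0 = 1"
  by (simp add: A_def monics_0 \<Lambda>_def chi_1 psi_0)

lemma recurrence: "of_nat D * A D = (\<Sum>k=1..D. Sk k * A (D - k))"
  using newton_identity[of \<Lambda> D, OF Lambda_mult] by (simp add: A_def Sk_def Lambda_orbit_poly)

lemma Lambda_eq:
  assumes "h \<in> monics D" "D > 0"
  shows "\<Lambda> h = \<chi> (cst D * B h) * \<psi> (- coeff h (D - 1))"
proof -
  have *: "lead_coeff h = 1" "degree h = D" using assms by (auto simp: monics_def)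
  show ?thesis using sum_proots_monic[OF *(1)] prod_proots_swap[OF *(1), of F] *(2) assms(2)
    by (simp add: \<Lambda>_def cst_def B_def)
qed

lemma B_cong:
  assumes "M dvd f - g" shows "B f = B g"
proof -
  have "poly f \<beta> = poly g \<beta>" if "\<beta> \<in># proots F" for \<beta>
  proof -
    have "poly M \<beta> = 0" using that F FM by simp
    moreover obtain k where "f - g = M * k" using assms by auto
    hence "poly f \<beta> - poly g \<beta> = poly M \<beta> * poly k \<beta>" by (metis poly_diff poly_mult)
    ultimately show ?thesis by simp
  qed
  thus ?thesis unfolding B_def by (intro arg_cong[of _ _ prod_mset] image_mset_cong)
qed

lemma B_mult: "B (f * g) = B f * B g"
  by (simp add: B_def prod_mset.distrib)

lemma B_base_field: "base_poly h \<Longrightarrow> B h \<in> base_field"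
  unfolding B_def using prod_proots_base_field[OF F] by simp

lemma cst_base_field: "cst D \<in> base_field"
proof -
  have "lead_coeff F \<in> base_field" using F by (simp add: base_poly_iff)
  moreover have "(-1 :: 'K) \<in> base_field" using base_field_minus[OF base_field_1] .
  moreover have "x ^ n \<in> base_field" if "x \<in> base_field" for x n using that by (induction n) (auto simp: base_field_1 base_field_mult)
  ultimately show ?thesis unfolding cst_def by (intro base_field_mult) auto
qed

text \<open>Translation by a suitable multiple of \<open>M\<close> permutes the monic polynomials of
  degree \<open>D\<close>, leaves \<open>B\<close> unchanged and moves the second coefficient by
  \<open>c\<close>; the whole sum is thereby multiplied by \<open>\<psi> c\<close>.\<close>

lemma A_vanish_additive:
  assumes c: "c \<in> base_field" "\<psi> c \<noteq> 1" and D: "D > degree M"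
  shows "A D = 0"
proof -
  \<comment> \<open>The multiple of \<open>M\<close> must reach degree exactly \<open>D - 1\<close>,
    which is why \<open>D > degree M\<close> is required.\<close>
  define E where "E = smult c (monom 1 (D - 1 - degree M) * M)"
  have ovrE: "base_poly E" unfolding E_def by (intro base_poly_smult base_poly_mult base_poly_monom M c base_field_1)
  have degE: "degree E < D"
  proof -
    have "degree E \<le> degree (monom (1::'K) (D - 1 - degree M) * M)" unfolding E_def by (rule degree_smult_le)
    also have "\<dots> \<le> (D - 1 - degree M) + degree M"
      by (rule order.trans[OF degree_mult_le]) (simp add: degree_monom_eq)
    finally show ?thesis using D by simp
  qed
  have "coeff (monom 1 n * M) (n + degree M) = 1" for n
    using M(2) by (simp add: coeff_monom_mult)
  moreover have "D - 1 - degree M + degree M = D - 1" using D by simp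
  ultimately have "coeff (monom 1 (D - 1 - degree M) * M) (D - 1) = 1" by metis
  hence coeffE: "coeff E (D - 1) = c" by (simp only: E_def coeff_smult mult_1_right)
  have ME: "M dvd E" unfolding E_def by (intro dvd_smult dvd_mult) simp
  have shift: "h + E \<in> monics D" if "h \<in> monics D" for h
    using that ovrE degE by (auto simp: monics_def base_poly_add degree_add_eq_left coeff_eq_0)
  have shift': "h - E \<in> monics D" if "h \<in> monics D" for h
  proof -
    have "degree (h + - E) = degree h" using that degE by (intro degree_add_eq_left) (auto simp: monics_def)
    thus ?thesis using that ovrE degE by (auto simp: monics_def base_poly_diff coeff_eq_0)
  qed
  have "A D = (\<Sum>h\<in>monics D. \<Lambda> (h - E))"
    unfolding A_def by (rule sum.reindex_bij_witness[of _ "\<lambda>h. h - E" "\<lambda>h. h + E"]) (auto simp: shift shift')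
  also have "\<dots> = (\<Sum>h\<in>monics D. \<psi> c * \<Lambda> h)"
  proof (intro sum.cong refl)
    fix h assume h: "h \<in> monics D"
    have "\<Lambda> (h - E) = \<chi> (cst D * B (h - E)) * \<psi> (- coeff (h - E) (D - 1))"
      using Lambda_eq[OF shift'[OF h]] D by simp
    also have "B (h - E) = B h" by (rule B_cong) (use ME in simp)
    also have "- coeff (h - E) (D - 1) = c + - coeff h (D - 1)" by (simp only: coeff_diff coeffE) simp
    also have "\<psi> \<dots> = \<psi> c * \<psi> (- coeff h (D - 1))"
      using h c by (intro psi_add base_field_minus) (auto simp: monics_def base_poly_iff)
    finally show "\<Lambda> (h - E) = \<psi> c * \<Lambda> h" using Lambda_eq[OF h] D by simp
  qed
  also have "\<dots> = \<psi> c * A D" by (simp add: A_def sum_distrib_left)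
  finally have "(1 - \<psi> c) * A D = 0" by (simp add: algebra_simps)
  thus ?thesis using c by simp
qed

text \<open>Without an additive character, \<open>\<Lambda>\<close> depends only on the remainder
  modulo \<open>M\<close>. Multiplication by \<open>h0\<close>, a unit modulo \<open>M\<close>,
  permutes the remainders and multiplies the sum by \<open>\<chi> (B h0)\<close>.\<close>

lemma A_vanish_multiplicative:
  assumes h0: "base_poly h0" "\<And>x. poly M x = 0 \<Longrightarrow> poly h0 x \<noteq> 0" "\<chi> (B h0) \<noteq> 1"
    and psi: "\<And>c. c \<in> base_field \<Longrightarrow> \<psi> c = 1" and D: "D \<ge> degree M"
  shows "A D = 0"
proof -
  define R where "R = {r. base_poly r \<and> degree r < degree M}"
  have finR: "finite R" by (rule finite_subset[OF _ finite_over[of "degree M"]]) (auto simp: R_def)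
  have Mnz: "M \<noteq> 0" using M by auto
  have modR: "h mod M \<in> R" if "base_poly h" for h
    using that M degree_mod_less'[OF Mnz, of h] base_poly_mod[OF that M(1,3)]
    by (cases "h mod M = 0") (auto simp: R_def)
  have chiB: "\<chi> (B (h mod M)) = \<chi> (B h)" for h
    by (rule arg_cong[OF B_cong]) (simp add: minus_mult_div_eq_mod [symmetric])
  have cancel: "M dvd r" if "M dvd h0 * r" for r
  proof (cases "r = 0")
    case False
    have "h0 \<noteq> 0" using h0(2) M alg_closed_imp_poly_has_root[of M] by auto
    show ?thesis
    proof (rule alg_closed_dvdI[OF Mnz])
      fix x
      have "order x M \<le> order x (h0 * r)"
        using that False \<open>h0 \<noteq> 0\<close> by (intro dvd_imp_order_le) auto
      also have "\<dots> = order x h0 + order x r" using False \<open>h0 \<noteq> 0\<close> by (simp add: order_mult)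
      finally show "order x M \<le> order x r"
        using h0(2)[of x] Mnz by (cases "poly M x = 0") (auto simp: order_0I)
    qed
  qed auto
  have bij: "bij_betw (\<lambda>r. (h0 * r) mod M) R R"
  proof -
    have "inj_on (\<lambda>r. (h0 * r) mod M) R"
    proof (rule inj_onI)
      fix r r' assume r: "r \<in> R" "r' \<in> R" "(h0 * r) mod M = (h0 * r') mod M"
      have "M dvd h0 * r - h0 * r'" using r(3) by (simp add: mod_eq_dvd_iff)
      hence "M dvd h0 * (r - r')" by (simp add: algebra_simps)
      hence "M dvd r - r'" by (rule cancel)
      moreover have "degree (r - r') < degree M" using r by (auto simp: R_def intro: degree_diff_less)
      ultimately show "r = r'" using dvd_imp_degree_le[of M "r - r'"] by auto
    qed
    moreover have "(\<lambda>r. (h0 * r) mod M) ` R \<subseteq> R"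
      using modR h0(1) by (auto simp: R_def intro!: base_poly_mult)
    ultimately show ?thesis using finR by (metis bij_betw_def endo_inj_surj)
  qed
  have "(\<Sum>r\<in>R. \<chi> (B r)) = (\<Sum>r\<in>R. \<chi> (B ((h0 * r) mod M)))"
    by (rule sum.reindex_bij_betw[OF bij, symmetric])
  also have "\<dots> = (\<Sum>r\<in>R. \<chi> (B h0) * \<chi> (B r))"
    by (intro sum.cong refl) (auto simp: chiB B_mult R_def B_base_field h0(1) intro!: chi_mult)
  also have "\<dots> = \<chi> (B h0) * (\<Sum>r\<in>R. \<chi> (B r))" by (simp add: sum_distrib_left)
  finally have sum0: "(\<Sum>r\<in>R. \<chi> (B r)) = 0" using h0(3) by (simp only: mult_cancel_right1) simp
  have "D > 0" using D M by simp
  have "A D = (\<Sum>h\<in>monics D. \<chi> (cst D) * \<chi> (B h))"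
    unfolding A_def
  proof (intro sum.cong refl)
    fix h assume h: "h \<in> monics D"
    hence "base_poly h" by (simp add: monics_def)
    thus "\<Lambda> h = \<chi> (cst D) * \<chi> (B h)"
      using Lambda_eq[OF h \<open>D > 0\<close>] psi[of "- coeff h (D - 1)"]
      by (simp add: chi_mult cst_base_field B_base_field base_field_minus base_poly_iff)
  qed
  \<comment> \<open>Division by \<open>M\<close>: the quotient runs over the monic polynomials of
    degree \<open>D - degree M\<close>, and independently the remainder over all of
    \<open>R\<close>.\<close>
  also have "\<dots> = (\<Sum>(u, r)\<in>monics (D - degree M) \<times> R. \<chi> (cst D) * \<chi> (B r))"
  proof (rule sum.reindex_bij_witness[of _ "\<lambda>(u, r). u * M + r" "\<lambda>h. (h div M, h mod M)"])
    fix h assume h: "h \<in> monics D"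
    hence h': "base_poly h" "lead_coeff h = 1" "degree h = D" by (auto simp: monics_def)
    have r: "h mod M \<in> R" by (rule modR) fact
    have "base_poly (h div M * M)" using base_poly_diff[OF h'(1) base_poly_mod[OF h'(1) M(1,3)]] by (simp add: minus_mod_eq_div_mult)
    hence "base_poly (h div M)" using base_poly_cancel[of M "h div M"] M Mnz by (simp add: mult.commute)
    moreover have lt: "degree (h mod M) < degree h" using r h' D by (simp add: R_def)
    have "degree (h - h mod M) = degree h \<and> lead_coeff (h - h mod M) = 1"
    proof -
      have "degree (h + - (h mod M)) = degree h" using lt by (intro degree_add_eq_left) simp
      thus ?thesis using lt h'(2) by (simp add: coeff_eq_0)
    qed
    hence "degree (h div M * M) = degree h \<and> lead_coeff (h div M * M) = 1"
      unfolding minus_mod_eq_div_mult .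
    hence *: "degree (h div M * M) = D" "lead_coeff (h div M * M) = 1"
      using h'(3) by blast+
    hence "h div M \<noteq> 0" using D M by auto
    hence "degree (h div M) + degree M = D" using *(1) Mnz by (simp add: degree_mult_eq)
    moreover have "lead_coeff (h div M) = 1" using *(2) M(2) by (simp only: lead_coeff_mult) simp
    ultimately have "h div M \<in> monics (D - degree M)" by (auto simp: monics_def)
    with r show "(h div M, h mod M) \<in> monics (D - degree M) \<times> R" by simp
    show "(case (h div M, h mod M) of (u, r) \<Rightarrow> u * M + r) = h" by simp
    show "(case (h div M, h mod M) of (u, r) \<Rightarrow> \<chi> (cst D) * \<chi> (B r)) = \<chi> (cst D) * \<chi> (B h)"
      by (simp add: chiB)
  next
    fix ur assume "ur \<in> monics (D - degree M) \<times> R"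
    then obtain u r where ur: "ur = (u, r)" "u \<in> monics (D - degree M)" "r \<in> R" by auto
    have "M \<in> monics (degree M)" using M by (simp add: monics_def)
    from mult_monics[OF ur(2) this] have uM: "u * M \<in> monics D" using D by simp
    have "degree r < degree (u * M)" using uM ur D by (simp add: monics_def R_def)
    hence "u * M + r \<in> monics D" using uM ur
      by (auto simp: monics_def R_def base_poly_add degree_add_eq_left coeff_eq_0)
    thus "(case ur of (u, r) \<Rightarrow> u * M + r) \<in> monics D" by (simp add: ur)
    show "((case ur of (u, r) \<Rightarrow> u * M + r) div M, (case ur of (u, r) \<Rightarrow> u * M + r) mod M) = ur"
      using ur Mnz by (simp add: R_def mod_poly_less div_poly_less)
  qed
  also have "\<dots> = 0"
    using sum0 by (simp add: sum.cartesian_product [symmetric] sum_distrib_left [symmetric])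
  finally show ?thesis .
qed

lemma power_sum_representation:
  assumes "\<And>D. D > degree M \<Longrightarrow> A D = 0"
  obtains w :: "nat \<Rightarrow> complex" and m where "m \<le> degree M" "\<And>k. k \<ge> 1 \<Longrightarrow> Sk k = - (\<Sum>i<m. w i ^ k)"
  using power_sums_of_recurrence[of A "degree M" Sk, OF A_0 assms recurrence] by metis

end

section \<open>The Weil bound\<close>

lemma sum_powers_root_of_unity:
  fixes z :: complex
  assumes "z ^ d = 1" "d > 0"
  shows "(\<Sum>j\<in>{1..<d}. z ^ j) = (if z = 1 then of_nat d else 0) - 1"
proof -
  have "(\<Sum>j\<in>{1..<d}. z ^ j) = (\<Sum>j<d. z ^ j) - 1"
    using assms(2) by (simp add: lessThan_atLeast0 sum.atLeast_Suc_lessThan)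
  also have "(\<Sum>j<d. z ^ j) = (if z = 1 then of_nat d else 0)"
    using assms by (simp add: geometric_sum)
  finally show ?thesis .
qed

text \<open>Since \<open>q\<close> takes the value \<open>b\<close> at \<open>z\<close> with
  multiplicity 1, the substitution is unramified there and preserves multiplicities.\<close>

lemma order_pcompose:
  fixes F q :: "'K :: idom poly"
  assumes F: "F \<noteq> 0" and q: "poly (pderiv q) z \<noteq> 0" "poly q z = b"
  shows "order z (pcompose F q) = order b F"
proof -
  obtain H where H: "F = [:-b, 1:] ^ order b F * H" "\<not> [:-b, 1:] dvd H"
    using order_decomp[OF F] by blast
  have Hb: "poly H b \<noteq> 0" using H(2) by (simp add: poly_eq_0_iff_dvd)
  have "q \<noteq> [:b:]"
  proof
    assume "q = [:b:]"
    hence "pderiv q = 0" by (simp add: pderiv_pCons)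
    thus False using q by simp
  qed
  hence qb: "q - [:b:] \<noteq> 0" by simp
  have eq: "pcompose F q = (q - [:b:]) ^ order b F * pcompose H q"
  proof -
    have "pcompose [:-b, 1:] q = q - [:b:]"
      by (rule poly_eqI) (simp add: pcompose_pCons coeff_pCons split: nat.split)
    thus ?thesis by (subst H(1)) (simp only: pcompose_mult pcompose_power)
  qed
  have Hq: "poly (pcompose H q) z \<noteq> 0" using q Hb by (simp add: poly_pcompose)
  hence Hq0: "pcompose H q \<noteq> 0" by auto
  have "order z (q - [:b:]) \<le> 1"
    by (rule order_le_1_if_pderiv_nz[OF qb]) (use q in \<open>simp add: pderiv_diff pderiv_pCons\<close>)
  moreover have "order z (q - [:b:]) \<noteq> 0" using q qb order_root[of "q - [:b:]" z] by simp
  ultimately have "order z (q - [:b:]) = 1" by simp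
  thus ?thesis unfolding eq using qb Hq0 Hq by (subst order_mult) (simp_all add: order_power order_0I)
qed

section \<open>The Artin-Schreier substitution\<close>

context finite_frobenius
begin

text \<open>The Artin-Schreier polynomial. Its derivative \<open>-1\<close> makes it unramified
  everywhere, and its fibres are translates of F_Q.\<close>

definition AS_poly :: "'K poly" where "AS_poly = monom 1 Q - [:0, 1:]"

lemma poly_AS: "poly AS_poly z = z ^ Q - z" by (simp add: AS_poly_def poly_monom)

lemma pderiv_AS: "pderiv AS_poly = -1"
proof -
  have "of_nat Q = (0 :: 'K)" using t by (simp add: of_nat_eq_0_iff_char_dvd Q)
  thus ?thesis by (simp add: AS_poly_def pderiv_diff pderiv_monom pderiv_pCons one_pCons)
qed

lemma degree_AS_diff: "degree (AS_poly - [:x:]) = Q"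
proof -
  have "AS_poly - [:x:] = monom 1 Q + [:-x, -1:]" by (simp add: AS_poly_def)
  also have "degree \<dots> = Q" using Q_gt_1 by (subst degree_add_eq_left) (auto simp: degree_monom_eq)
  finally show ?thesis .
qed

lemma card_AS_fibre: "card {z. z ^ Q - z = x} = Q" "finite {z. z ^ Q - z = (x :: 'K)}"
proof -
  have nz: "AS_poly - [:x:] \<noteq> 0" using degree_AS_diff[of x] Q_gt_1 by auto
  have eq: "{z. z ^ Q - z = x} = {z. poly (AS_poly - [:x:]) z = 0}" by (auto simp: poly_AS)
  show "card {z. z ^ Q - z = x} = Q" "finite {z. z ^ Q - z = x}"
    using card_roots_separable[OF nz] degree_AS_diff[of x] poly_roots_finite[OF nz] unfolding eq
    by (simp_all add: pderiv_diff pderiv_AS pderiv_pCons)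
qed

lemma Tr_AS: "Tr k (z ^ Q - z) = z ^ Q ^ k - z"
proof (induction k)
  case (Suc k)
  have "(z ^ Q - z) ^ Q ^ k = z ^ Q ^ Suc k - z ^ Q ^ k"
    by (simp add: frob_diff flip: power_mult)
  thus ?case using Suc by (simp add: Tr_def)
qed (simp add: Tr_def)

lemma fixed_field_frob: "x \<in> fixed_field k \<Longrightarrow> x ^ Q \<in> fixed_field k"
  by (simp add: fixed_field_def) (metis power_mult mult.commute)

lemma fixed_field_diff: "x \<in> fixed_field k \<Longrightarrow> y \<in> fixed_field k \<Longrightarrow> x - y \<in> fixed_field k"
  by (simp add: fixed_field_def frob_diff)

lemma fixed_field_poly: "base_poly h \<Longrightarrow> x \<in> fixed_field k \<Longrightarrow> poly h x \<in> fixed_field k"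
  using base_poly_poly_power[of h x k] by (simp add: fixed_field_def)

lemma Tr_base_field: assumes "x \<in> fixed_field k" shows "Tr k x \<in> base_field"
proof -
  have "Tr k x ^ Q = (\<Sum>i<k. x ^ Q ^ Suc i)"
    using frob_sum[of "\<lambda>i. x ^ Q ^ i" "{..<k}" 1] by (simp add: Tr_def mult.commute flip: power_mult)
  also have "\<dots> = Tr k x"
  proof -
    have "x ^ Q ^ 0 + (\<Sum>i<k. x ^ Q ^ Suc i) = (\<Sum>i<k. x ^ Q ^ i) + x ^ Q ^ k"
      by (rule trans[OF sum.lessThan_Suc_shift[of "\<lambda>i. x ^ Q ^ i" k, symmetric] sum.lessThan_Suc])
    thus ?thesis using assms by (simp add: Tr_def fixed_field_def)
  qed
  finally show ?thesis by (simp add: base_field_def)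
qed

lemma Nm_base_field: assumes "x \<in> fixed_field k" shows "Nm k x \<in> base_field"
proof (cases "x = 0")
  case True
  thus ?thesis using Q_gt_1 by (cases k) (auto simp: Nm_def base_field_def base_field_1 power_0_left)
next
  case False
  have "Nm k x ^ Q = (\<Prod>i<k. x ^ Q ^ Suc i)"
    by (simp add: Nm_def prod_power_distrib mult.commute flip: power_mult)
  also have "\<dots> = Nm k x"
  proof -
    have "x ^ Q ^ 0 * (\<Prod>i<k. x ^ Q ^ Suc i) = (\<Prod>i<k. x ^ Q ^ i) * x ^ Q ^ k"
      by (rule trans[OF prod.lessThan_Suc_shift[of "\<lambda>i. x ^ Q ^ i" k, symmetric] prod.lessThan_Suc])
    thus ?thesis using assms False by (simp add: Nm_def fixed_field_def)
  qed
  finally show ?thesis by (simp add: base_field_def)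
qed

lemma geometric_Q: "(\<Sum>i<k. Q ^ i) * (Q - 1) = Q ^ k - 1"
proof (induction k)
  case (Suc k)
  have "(\<Sum>i<Suc k. Q ^ i) * (Q - 1) = (Q ^ k - 1) + Q ^ k * (Q - 1)"
    using Suc by (simp add: distrib_right)
  also have "\<dots> = Q ^ Suc k - 1" using Q_gt_1 by (simp add: diff_mult_distrib2 mult.commute)
  finally show ?case .
qed auto

lemma Q_minus_1_dvd: "Q - 1 dvd Q ^ k - 1"
  using geometric_Q[of k] by (metis dvd_triv_right)

text \<open>The norm is the power with exponent \<open>(Q ^ k - 1) div (Q - 1)\<close>, so the d-th
  power residue symbols of F_(Q^k) and F_Q are compatible.\<close>

lemma Nm_power:
  assumes "d dvd Q - 1" "d > 0" shows "Nm k x ^ ((Q - 1) div d) = x ^ ((Q ^ k - 1) div d)"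
proof -
  have "Nm k x = x ^ (\<Sum>i<k. Q ^ i)" by (simp add: Nm_def power_sum)
  moreover have "(\<Sum>i<k. Q ^ i) * ((Q - 1) div d) = (Q ^ k - 1) div d"
    using assms geometric_Q[of k] by (metis div_mult_swap)
  ultimately show ?thesis by (simp flip: power_mult)
qed

text \<open>Additive Hilbert 90: by the telescoping \<open>Tr_AS\<close>, the values
  \<open>z ^ Q - z\<close> have trace 0, and every preimage of an element of trace 0 already lies in
  F_(Q^k). There are \<open>Q\<close> preimages each.\<close>

lemma sum_AS:
  assumes "k > 0"
  shows "(\<Sum>z\<in>fixed_field k. f (z ^ Q - z)) = of_nat Q * (\<Sum>x\<in>{x \<in> fixed_field k. Tr k x = 0}. f x :: complex)"
proof -
  have fin: "finite (fixed_field k)" using assms by (rule finite_fixed_field)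
  have im: "z ^ Q - z \<in> {x \<in> fixed_field k. Tr k x = 0}" if "z \<in> fixed_field k" for z
    using that fixed_field_diff[OF fixed_field_frob[OF that] that] by (simp add: Tr_AS) (simp add: fixed_field_def)
  have fib: "{z \<in> fixed_field k. z ^ Q - z = x} = {z. z ^ Q - z = x}" if "x \<in> {x \<in> fixed_field k. Tr k x = 0}" for x
    using that Tr_AS[of k] by (auto simp: fixed_field_def)
  have "(\<Sum>z\<in>fixed_field k. f (z ^ Q - z)) = (\<Sum>x\<in>{x \<in> fixed_field k. Tr k x = 0}. \<Sum>z\<in>{z \<in> fixed_field k. z ^ Q - z = x}. f (z ^ Q - z))"
    using fin im by (intro sum.group [symmetric]) auto
  also have "\<dots> = (\<Sum>x\<in>{x \<in> fixed_field k. Tr k x = 0}. of_nat Q * f x)"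
    by (intro sum.cong refl) (simp only: fib, simp add: card_AS_fibre)
  finally show ?thesis by (simp add: sum_distrib_left)
qed

end

text \<open>By \<open>chi_1\<close> the kernel of \<open>\<chi>\<close> on the units is the group of
  d-th powers, so exponents in \<open>{1..<d}\<close> give its nontrivial powers;
  \<open>psi_sum\<close> expresses by orthogonality that \<open>\<Psi>\<close> is the full group of
  additive characters.\<close>

locale weil = finite_frobenius Q t dummy for Q t and dummy :: "'K :: alg_closed_field itself" +
  fixes F M :: "'K poly" and \<chi> :: "'K \<Rightarrow> complex" and \<Psi> :: "('K \<Rightarrow> complex) set" and d :: nat
  assumes F: "base_poly F" "F \<noteq> 0" and M: "base_poly M" "lead_coeff M = 1" "degree M > 0"
    and FM: "\<And>x. poly F x = 0 \<Longrightarrow> poly M x = 0"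
    and d: "d \<ge> 2" "d dvd Q - 1"
    and ord: "\<And>l. prime l \<Longrightarrow> l dvd d \<Longrightarrow> \<exists>b. \<not> l dvd order b F"
    and chi_mult: "\<And>x y. x \<in> base_field \<Longrightarrow> y \<in> base_field \<Longrightarrow> \<chi> (x * y) = \<chi> x * \<chi> y"
    and chi_0: "\<chi> 0 = 0"
    and chi_1: "\<And>x. x \<in> base_field \<Longrightarrow> x \<noteq> 0 \<Longrightarrow> \<chi> x = 1 \<longleftrightarrow> x ^ ((Q - 1) div d) = 1"
    and fin_Psi: "finite \<Psi>"
    and psi_add: "\<And>\<psi> x y. \<psi> \<in> \<Psi> \<Longrightarrow> x \<in> base_field \<Longrightarrow> y \<in> base_field \<Longrightarrow> \<psi> (x + y) = \<psi> x * \<psi> y"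
    and psi_0: "\<And>\<psi>. \<psi> \<in> \<Psi> \<Longrightarrow> \<psi> 0 = 1"
    and psi_sum: "\<And>x. x \<in> base_field \<Longrightarrow> (\<Sum>\<psi>\<in>\<Psi>. \<psi> x) = (if x = 0 then of_nat Q else 0)"
begin

text \<open>The substitution \<open>z ^ Q - z\<close> parametrizes the elements of trace \<open>0\<close> and thereby replaces the
  sum over all additive characters.\<close>

definition G :: "'K poly" where "G = pcompose F AS_poly"

text \<open>The power with this exponent is the d-th power residue symbol of F_(Q^k).\<close>

definition expo :: "nat \<Rightarrow> nat" where "expo k = (Q ^ k - 1) div d"

lemma poly_G: "poly G z = poly F (z ^ Q - z)"
  by (simp add: G_def poly_pcompose poly_AS)

lemma order_G: "order z G = order (z ^ Q - z) F"
  unfolding G_def by (rule order_pcompose) (simp_all add: F pderiv_AS poly_AS)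

lemma AS_surj: "\<exists>z :: 'K. z ^ Q - z = b"
proof -
  have "card {z. z ^ Q - z = b} > 0" using card_AS_fibre[of b] Q_gt_1 by simp
  thus ?thesis by (auto simp: card_gt_0_iff)
qed

lemma pcompose_AS_nz: "P \<noteq> 0 \<Longrightarrow> pcompose P AS_poly \<noteq> 0"
  using pcompose_eq_0[of P AS_poly] degree_AS_diff[of 0] Q_gt_1 by auto

lemma G_nz: "G \<noteq> 0"
  unfolding G_def by (rule pcompose_AS_nz) (rule F(2))

definition C :: nat where "C = 3 * degree G + 3"

text \<open>Stepanov's bound with \<open>s = Q ^ k\<close>, hence for the extension of degree
  \<open>2 * k\<close>. The condition on orders passes from \<open>F\<close> to \<open>G\<close>
  because the Artin-Schreier map is surjective and unramified.\<close>

lemma stepanov_upper: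
  assumes k: "Q ^ k \<ge> 4 * d * (degree G + 1)"
  shows "d * card {z \<in> fixed_field (2 * k). poly G z ^ expo (2 * k) = \<zeta>} \<le> Q ^ (2 * k) + d * C * Q ^ k"
proof -
  have QQ: "Q ^ k * Q ^ k = Q ^ (2 * k)" by (simp add: mult_2 power_add)
  interpret st: stepanov d "Q ^ k" G "t * k"
  proof
    show "d dvd Q ^ k * Q ^ k - 1"
      unfolding QQ by (rule dvd_trans[OF d(2) Q_minus_1_dvd])
    show "\<exists>b. \<not> l dvd order b G" if l: "prime l" "l dvd d" for l
    proof -
      obtain b where "\<not> l dvd order b F" using ord[OF l] by blast
      thus ?thesis using AS_surj[of b] order_G by metis
    qed
    show "4 * d * (degree G + 1) \<le> Q ^ k" by fact
  qed (use d Q_gt_1 char Q_power G_nz in auto)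
  show ?thesis using st.bound[of \<zeta>] by (simp add: QQ fixed_field_def expo_def C_def)
qed

lemma root_of_unity_expo:
  assumes "z \<in> fixed_field (2 * k)" "poly G z \<noteq> 0" shows "(poly G z ^ expo (2 * k)) ^ d = 1"
proof -
  have "z ^ Q - z \<in> fixed_field (2 * k)" using assms fixed_field_diff fixed_field_frob by blast
  hence "poly G z ^ Q ^ (2 * k) = poly G z" using fixed_field_poly[OF F(1)] by (simp add: poly_G fixed_field_def)
  moreover have "Q ^ (2 * k) = Suc (Q ^ (2 * k) - 1)" using Q_gt_1 by simp
  ultimately have "poly G z * poly G z ^ (Q ^ (2 * k) - 1) = poly G z * 1" by (metis power_Suc mult_1_right)
  hence *: "poly G z ^ (Q ^ (2 * k) - 1) = 1" using assms(2) by simp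
  have "d dvd Q ^ (2 * k) - 1" by (rule dvd_trans[OF d(2) Q_minus_1_dvd])
  thus ?thesis using * by (simp add: expo_def flip: power_mult)
qed

definition U :: "'K set" where "U = {\<zeta>. \<zeta> ^ d = 1}"

lemma d_nz: "of_nat d \<noteq> (0 :: 'K)"
proof
  assume "of_nat d = (0 :: 'K)"
  hence "CHAR('K) dvd d" by (simp add: of_nat_eq_0_iff_char_dvd)
  hence "CHAR('K) dvd Q - 1" using d(2) by (rule dvd_trans)
  moreover have "CHAR('K) dvd Q" using t by (simp add: Q)
  ultimately have "CHAR('K) dvd Q - (Q - 1)" by (rule dvd_diff_nat[rotated])
  thus False using Q_gt_1 char by auto
qed

lemma card_U: "card U = d" and finite_U: "finite U"
  using card_roots_of_unity[OF d_nz] by (simp_all add: U_def)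

lemma class_partition:
  assumes "k > 0"
  shows "Q ^ (2 * k) \<le> (\<Sum>\<zeta>\<in>U. card {z \<in> fixed_field (2 * k). poly G z ^ expo (2 * k) = \<zeta>}) + degree G"
proof -
  have fin: "finite (fixed_field (2 * k))" using assms by (intro finite_fixed_field) simp
  have "fixed_field (2 * k) \<subseteq> (\<Union>\<zeta>\<in>U. {z \<in> fixed_field (2 * k). poly G z ^ expo (2 * k) = \<zeta>}) \<union> {z. poly G z = 0}"
    using root_of_unity_expo by (auto simp: U_def)
  hence "card (fixed_field (2 * k)) \<le> card ((\<Union>\<zeta>\<in>U. {z \<in> fixed_field (2 * k). poly G z ^ expo (2 * k) = \<zeta>}) \<union> {z. poly G z = 0})"
    using fin finite_U poly_roots_finite[OF G_nz] by (intro card_mono) auto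
  also have "\<dots> \<le> card (\<Union>\<zeta>\<in>U. {z \<in> fixed_field (2 * k). poly G z ^ expo (2 * k) = \<zeta>}) + card {z. poly G z = 0}"
    by (rule card_Un_le)
  also have "\<dots> \<le> (\<Sum>\<zeta>\<in>U. card {z \<in> fixed_field (2 * k). poly G z ^ expo (2 * k) = \<zeta>}) + degree G"
    by (intro add_mono card_UN_le finite_U card_poly_roots_bound G_nz)
  finally show ?thesis using assms by (simp add: card_fixed_field)
qed

text \<open>The classes together with the zeros of \<open>G\<close> exhaust the field, so the upper
  bounds for the other \<open>d - 1\<close> classes leave this much for the class of
  \<open>\<zeta>\<close>.\<close>

lemma stepanov_lower:
  assumes k: "Q ^ k \<ge> 4 * d * (degree G + 1)" "k > 0" and z: "\<zeta> \<in> U"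
  shows "Q ^ (2 * k) \<le> d * card {z \<in> fixed_field (2 * k). poly G z ^ expo (2 * k) = \<zeta>} + d * d * C * Q ^ k + d * degree G"
proof -
  define N where "N \<zeta> = card {z \<in> fixed_field (2 * k). poly G z ^ expo (2 * k) = \<zeta>}" for \<zeta>
  define R where "R = Q ^ (2 * k)"
  have "R \<le> (\<Sum>\<zeta>\<in>U. N \<zeta>) + degree G" using class_partition[OF k(2)] by (simp add: N_def R_def)
  also have "(\<Sum>\<zeta>\<in>U. N \<zeta>) = N \<zeta> + (\<Sum>\<zeta>\<in>U - {\<zeta>}. N \<zeta>)"
    using finite_U z by (intro sum.remove) auto
  finally have "d * R \<le> d * N \<zeta> + (\<Sum>\<zeta>\<in>U - {\<zeta>}. d * N \<zeta>) + d * degree G"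
    by (simp add: sum_distrib_left [symmetric] algebra_simps flip: distrib_left)
  also have "(\<Sum>\<zeta>\<in>U - {\<zeta>}. d * N \<zeta>) \<le> (\<Sum>\<zeta>\<in>U - {\<zeta>}. R + d * C * Q ^ k)"
    unfolding N_def R_def by (intro sum_mono stepanov_upper k)
  also have "\<dots> = (d - 1) * R + (d - 1) * (d * C * Q ^ k)"
    using finite_U z by (simp add: card_U algebra_simps)
  also have "(d - 1) * (d * C * Q ^ k) \<le> d * (d * C * Q ^ k)" by (intro mult_right_mono) auto
  finally have "d * R \<le> d * N \<zeta> + ((d - 1) * R + d * (d * C * Q ^ k)) + d * degree G" by simp
  moreover have "d * R = R + (d - 1) * R" using d by (cases d) auto
  ultimately show ?thesis unfolding N_def [symmetric] R_def [symmetric] by (simp add: algebra_simps)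
qed

lemma exists_large: "\<exists>k0>0. \<forall>k\<ge>k0. Q ^ k \<ge> B"
proof -
  have "B \<le> Q ^ k" if "k \<ge> B" for k
  proof -
    have "k < 2 ^ k" by (rule less_exp)
    also have "2 ^ k \<le> Q ^ k" using Q_gt_1 by (intro power_mono) auto
    finally show ?thesis using that by simp
  qed
  thus ?thesis by (intro exI[of _ "Suc B"]) auto
qed

text \<open>For large \<open>k\<close> the lower bound exceeds the number of zeros of
  \<open>M\<close> composed with \<open>AS_poly\<close>. From such points comes the polynomial
  \<open>h0\<close> that \<open>A_vanish_multiplicative\<close> asks for.\<close>

lemma class_inhabited:
  obtains k where "k > 0" "\<And>\<zeta>. \<zeta> \<in> U \<Longrightarrow> \<exists>z\<in>fixed_field (2 * k). poly G z ^ expo (2 * k) = \<zeta> \<and> poly M (z ^ Q - z) \<noteq> 0"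
proof -
  define MA where "MA = pcompose M AS_poly"
  have MAnz: "MA \<noteq> 0"
    unfolding MA_def by (rule pcompose_AS_nz) (use M in auto)
  obtain k where k: "k > 0" "Q ^ k \<ge> 4 * d * (degree G + 1) + d * d * C + d * degree G + d * degree MA + 1"
    using exists_large by blast
  show ?thesis
  proof (rule that[OF k(1)])
    fix \<zeta> assume z: "\<zeta> \<in> U"
    define N where "N = {z \<in> fixed_field (2 * k). poly G z ^ expo (2 * k) = \<zeta>}"
    have "Q ^ (2 * k) \<le> d * card N + d * d * C * Q ^ k + d * degree G"
      unfolding N_def using stepanov_lower[OF _ k(1) z] k(2) by linarith
    moreover have "Q ^ (2 * k) \<ge> d * d * C * Q ^ k + d * degree G + d * degree MA + 1"
    proof -
      have "Q ^ k \<ge> 1" using Q_gt_1 by simp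
      have "(d * d * C + d * degree G + d * degree MA + 1) * Q ^ k \<le> Q ^ k * Q ^ k"
        using k(2) by (intro mult_right_mono) auto
      moreover have "(d * degree G + d * degree MA + 1) * 1 \<le> (d * degree G + d * degree MA + 1) * Q ^ k"
        using \<open>Q ^ k \<ge> 1\<close> by (intro mult_left_mono) auto
      moreover have "Q ^ (2 * k) = Q ^ k * Q ^ k" by (simp add: mult_2 power_add)
      ultimately show ?thesis by (simp only: distrib_right mult_1_right)
    qed
    ultimately have "d * degree MA < d * card N" by linarith
    hence "degree MA < card N" by simp
    moreover have "card {z. poly MA z = 0} \<le> degree MA" by (rule card_poly_roots_bound[OF MAnz])
    ultimately have "\<not> N \<subseteq> {z. poly MA z = 0}"
      using card_mono[OF poly_roots_finite[OF MAnz], of N] by linarith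
    thus "\<exists>z\<in>fixed_field (2 * k). poly G z ^ expo (2 * k) = \<zeta> \<and> poly M (z ^ Q - z) \<noteq> 0"
      by (auto simp: N_def MA_def poly_pcompose poly_AS)
  qed
qed

lemma chi_one: "\<chi> 1 = 1"
  using chi_1[of 1] base_field_1 by simp

lemma chi_power_d: assumes "x \<in> base_field" "x \<noteq> 0" shows "\<chi> x ^ d = 1"
proof -
  have pw: "x ^ n \<in> base_field \<and> \<chi> (x ^ n) = \<chi> x ^ n" for n
    using assms by (induction n) (auto simp: base_field_1 base_field_mult chi_one chi_mult)
  have "x ^ Q = x" using assms by (simp add: base_field_def)
  hence "x * x ^ (Q - 1) = x * 1" using Q_gt_1 by (metis power_Suc Suc_diff_1 mult_1_right less_trans zero_less_one)
  hence "x ^ (Q - 1) = 1" using assms by simp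
  hence "(x ^ d) ^ ((Q - 1) div d) = 1" using d by (simp flip: power_mult)
  hence "\<chi> (x ^ d) = 1" using chi_1[of "x ^ d"] pw assms by simp
  thus ?thesis using pw by simp
qed

text \<open>Values of \<open>\<chi>\<close> are complex and power residue symbols lie in
  \<open>'K\<close>; comparing them only through the question whether a power is 1 avoids an
  identification of the two groups of roots of unity.\<close>

lemma chi_nm:
  assumes "z \<in> fixed_field (2 * k)" "poly G z \<noteq> 0"
  shows "\<chi> (Nm (2 * k) (poly G z)) ^ j = 1 \<longleftrightarrow> (poly G z ^ expo (2 * k)) ^ j = 1"
proof -
  have G: "poly G z \<in> fixed_field (2 * k)" unfolding poly_G using assms fixed_field_poly[OF F(1)] fixed_field_diff fixed_field_frob by blast
  have N: "Nm (2 * k) (poly G z) \<in> base_field" "Nm (2 * k) (poly G z) \<noteq> 0"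
    using Nm_base_field[OF G] assms(2) by (auto simp: Nm_def)
  have pw: "x \<in> base_field \<Longrightarrow> x ^ n \<in> base_field \<and> \<chi> (x ^ n) = \<chi> x ^ n" for x n
    by (induction n) (auto simp: base_field_1 base_field_mult chi_one chi_mult)
  have "\<chi> (Nm (2 * k) (poly G z)) ^ j = 1 \<longleftrightarrow> \<chi> (Nm (2 * k) (poly G z) ^ j) = 1" using pw[OF N(1)] by simp
  also have "\<dots> \<longleftrightarrow> (Nm (2 * k) (poly G z) ^ j) ^ ((Q - 1) div d) = 1" using N pw by (intro chi_1) auto
  also have "(Nm (2 * k) (poly G z) ^ j) ^ ((Q - 1) div d) = (Nm (2 * k) (poly G z) ^ ((Q - 1) div d)) ^ j"
    by (simp add: mult.commute flip: power_mult)
  also have "\<dots> = (poly G z ^ expo (2 * k)) ^ j" using d by (simp only: Nm_power[OF d(2)] expo_def)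
  finally show ?thesis .
qed

definition twisted_sum :: "nat \<Rightarrow> ('K \<Rightarrow> complex) \<Rightarrow> nat \<Rightarrow> complex" where
  "twisted_sum j \<psi> k = (\<Sum>x\<in>fixed_field k. \<chi> (Nm k (poly F x)) ^ j * \<psi> (Tr k x))"

text \<open>If \<open>\<psi>\<close> is nontrivial on F_Q, the L-coefficients vanish by translation.
  Otherwise the orbit polynomials of two points in different power classes yield a unit modulo
  \<open>M\<close> with nontrivial value.\<close>

lemma twisted_sum_representation:
  assumes j: "j \<in> {1..<d}" and psi: "\<psi> \<in> \<Psi>"
  shows "\<exists>w m. m \<le> degree M \<and> (\<forall>k\<ge>1. twisted_sum j \<psi> k = - (\<Sum>i<m. w i ^ k))"
proof -
  interpret cs: char_sum Q t dummy F M "\<lambda>x. \<chi> x ^ j" \<psi>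
    by unfold_locales (use F M FM chi_mult chi_one psi_add[OF psi] psi_0[OF psi] in \<open>auto simp: power_mult_distrib\<close>)
  have "cs.A D = 0" if D: "D > degree M" for D
  proof (cases "\<forall>c\<in>base_field. \<psi> c = 1")
    case False
    thus ?thesis using cs.A_vanish_additive D by blast
  next
    case True
    obtain k where k: "k > 0" "\<And>\<zeta>. \<zeta> \<in> U \<Longrightarrow> \<exists>z\<in>fixed_field (2 * k). poly G z ^ expo (2 * k) = \<zeta> \<and> poly M (z ^ Q - z) \<noteq> 0"
      using class_inhabited by blast
    obtain \<zeta> where \<zeta>: "\<zeta> \<in> U" "\<zeta> ^ j \<noteq> 1"
    proof -
      have "\<not> d dvd j" using j by (auto dest: dvd_imp_le)
      from root_of_unity_power_ne_1[OF d_nz this] show ?thesis using that by (auto simp: U_def)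
    qed
    obtain z1 where z1: "z1 \<in> fixed_field (2 * k)" "poly G z1 ^ expo (2 * k) = 1" "poly M (z1 ^ Q - z1) \<noteq> 0"
      using k(2)[of 1] by (auto simp: U_def)
    obtain z2 where z2: "z2 \<in> fixed_field (2 * k)" "poly G z2 ^ expo (2 * k) = \<zeta>" "poly M (z2 ^ Q - z2) \<noteq> 0"
      using k(2)[OF \<zeta>(1)] by auto
    have main: "orbit_poly (2 * k) x \<in> monics (2 * k) \<and> (\<forall>y. poly M y = 0 \<longrightarrow> poly (orbit_poly (2 * k) x) y \<noteq> 0) \<and>
        cs.\<Lambda> (orbit_poly (2 * k) x) = \<chi> (Nm (2 * k) (poly F x)) ^ j"
      if "x \<in> fixed_field (2 * k)" "poly M x \<noteq> 0" for x
    proof (intro conjI allI impI)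
      show "orbit_poly (2 * k) x \<in> monics (2 * k)" by (rule orbit_poly_monics) fact
      fix y assume y: "poly M y = 0"
      show "poly (orbit_poly (2 * k) x) y \<noteq> 0"
      proof
        assume "poly (orbit_poly (2 * k) x) y = 0"
        then obtain i where "y = x ^ Q ^ i" by (auto simp: orbit_poly_def poly_prod)
        hence "poly M x ^ Q ^ i = 0" using y M(1) by (simp add: base_poly_poly_power)
        thus False using that by simp
      qed
    next
      show "cs.\<Lambda> (orbit_poly (2 * k) x) = \<chi> (Nm (2 * k) (poly F x)) ^ j"
        using True Tr_base_field[OF that(1)] by (simp add: cs.Lambda_orbit_poly)
    qed
    define x1 where "x1 = z1 ^ Q - z1"
    define x2 where "x2 = z2 ^ Q - z2"
    have x: "x1 \<in> fixed_field (2 * k)" "poly M x1 \<noteq> 0" "x2 \<in> fixed_field (2 * k)" "poly M x2 \<noteq> 0"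
      using z1 z2 fixed_field_diff fixed_field_frob by (auto simp: x1_def x2_def)
    have nz: "poly G z1 \<noteq> 0" "poly G z2 \<noteq> 0" using z1(3) z2(3) FM by (auto simp: poly_G)
    have l1: "cs.\<Lambda> (orbit_poly (2 * k) x1) = 1"
      using main[OF x(1,2)] chi_nm[OF z1(1) nz(1), of j] z1(2) by (simp add: poly_G x1_def)
    have l2: "cs.\<Lambda> (orbit_poly (2 * k) x2) \<noteq> 1"
      using main[OF x(3,4)] chi_nm[OF z2(1) nz(2), of j] z2(2) \<zeta>(2) by (simp add: poly_G x2_def)
    have val: "cs.\<Lambda> (orbit_poly (2 * k) x) = \<chi> (cs.cst (2 * k)) ^ j * \<chi> (cs.B (orbit_poly (2 * k) x)) ^ j"
      if "x \<in> fixed_field (2 * k)" for x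
    proof -
      have *: "orbit_poly (2 * k) x \<in> monics (2 * k)" by (rule orbit_poly_monics) fact
      hence **: "base_poly (orbit_poly (2 * k) x)" by (simp add: monics_def)
      hence "\<psi> (- coeff (orbit_poly (2 * k) x) (2 * k - 1)) = 1"
        using True base_field_minus by (auto simp: base_poly_iff)
      thus ?thesis using cs.Lambda_eq[OF *] k(1) cs.cst_base_field cs.B_base_field[OF **]
        by (simp add: chi_mult power_mult_distrib)
    qed
    \<comment> \<open>Both orbit polynomials have degree \<open>2 * k\<close> and share the factor
      \<open>cst\<close>, while their values under \<open>\<Lambda>\<close> differ. So
      \<open>\<chi> (B h) ^ j\<close> cannot be 1 for both.\<close>
    have "\<exists>h. base_poly h \<and> (\<forall>x. poly M x = 0 \<longrightarrow> poly h x \<noteq> 0) \<and> \<chi> (cs.B h) ^ j \<noteq> 1"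
    proof (cases "\<chi> (cs.B (orbit_poly (2 * k) x1)) ^ j = 1")
      case False
      thus ?thesis using main[OF x(1,2)] by (auto simp: monics_def)
    next
      case True
      hence "\<chi> (cs.B (orbit_poly (2 * k) x2)) ^ j \<noteq> 1" using l1 l2 val[OF x(1)] val[OF x(3)] by auto
      thus ?thesis using main[OF x(3,4)] by (auto simp: monics_def)
    qed
    thus ?thesis using cs.A_vanish_multiplicative True D by (metis less_imp_le)
  qed
  then obtain w :: "nat \<Rightarrow> complex" and m where "m \<le> degree M" "\<And>k. k \<ge> 1 \<Longrightarrow> cs.Sk k = - (\<Sum>i<m. w i ^ k)"
    using cs.power_sum_representation by metis
  thus ?thesis by (auto simp: twisted_sum_def cs.Sk_def)
qed

text \<open>Orthogonality over \<open>\<Psi>\<close> keeps the \<open>x\<close> of trace 0 with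
  weight \<open>Q\<close>, and \<open>sum_AS\<close> turns them into a sum over all
  \<open>z\<close>. Orthogonality in \<open>j\<close> then counts d-th power values; the missing
  \<open>j = 0\<close> accounts for the subtracted term.\<close>

lemma twisted_sum_total:
  assumes k: "k > 0"
  shows "(\<Sum>j\<in>{1..<d}. \<Sum>\<psi>\<in>\<Psi>. twisted_sum j \<psi> (2 * k)) =
    of_nat d * of_nat (card {z \<in> fixed_field (2 * k). poly G z ^ expo (2 * k) = 1}) - of_nat (card {z \<in> fixed_field (2 * k). poly G z \<noteq> 0})"
proof -
  have fin: "finite (fixed_field (2 * k))" using k by (intro finite_fixed_field) simp
  define c where "c j x = \<chi> (Nm (2 * k) (poly F x)) ^ j" for j x
  have "(\<Sum>\<psi>\<in>\<Psi>. twisted_sum j \<psi> (2 * k)) = (\<Sum>z\<in>fixed_field (2 * k). c j (z ^ Q - z))" for j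
  proof -
    have "(\<Sum>\<psi>\<in>\<Psi>. twisted_sum j \<psi> (2 * k)) = (\<Sum>x\<in>fixed_field (2 * k). c j x * (\<Sum>\<psi>\<in>\<Psi>. \<psi> (Tr (2 * k) x)))"
      unfolding twisted_sum_def c_def sum_distrib_left by (rule sum.swap)
    also have "\<dots> = (\<Sum>x\<in>fixed_field (2 * k). if Tr (2 * k) x = 0 then of_nat Q * c j x else 0)"
      by (intro sum.cong refl) (simp add: psi_sum Tr_base_field)
    also have "\<dots> = of_nat Q * (\<Sum>x\<in>{x \<in> fixed_field (2 * k). Tr (2 * k) x = 0}. c j x)"
      using fin by (simp add: sum.inter_filter [symmetric] sum_distrib_left)
    also have "\<dots> = (\<Sum>z\<in>fixed_field (2 * k). c j (z ^ Q - z))" using k by (intro sum_AS [symmetric]) simp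
    finally show ?thesis .
  qed
  hence "(\<Sum>j\<in>{1..<d}. \<Sum>\<psi>\<in>\<Psi>. twisted_sum j \<psi> (2 * k)) = (\<Sum>z\<in>fixed_field (2 * k). \<Sum>j\<in>{1..<d}. c j (z ^ Q - z))"
    by (simp only:) (rule sum.swap)
  also have "\<dots> = (\<Sum>z\<in>fixed_field (2 * k). (if poly G z ^ expo (2 * k) = 1 then of_nat d else 0) - (if poly G z \<noteq> 0 then 1 else 0))"
  proof (intro sum.cong refl)
    fix z assume z: "z \<in> fixed_field (2 * k)"
    \<comment> \<open>A zero exponent would count the zeros of \<open>G\<close> as d-th powers by
      \<open>0 ^ 0 = 1\<close>.\<close>
    have e: "expo (2 * k) > 0"
    proof -
      have "d \<le> Q - 1" using d Q_gt_1 by (intro dvd_imp_le) auto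
      also have "\<dots> \<le> Q ^ (2 * k) - 1" using k Q_gt_1 by (intro diff_le_mono self_le_power) auto
      finally show ?thesis using d by (simp add: expo_def div_greater_zero_iff)
    qed
    show "(\<Sum>j\<in>{1..<d}. c j (z ^ Q - z)) = (if poly G z ^ expo (2 * k) = 1 then of_nat d else 0) - (if poly G z \<noteq> 0 then 1 else 0)"
    proof (cases "poly G z = 0")
      case True
      have "Nm (2 * k) 0 = (0 :: 'K)" unfolding Nm_def
        by (rule prod_zero, simp, rule bexI[of _ 0]) (use k Q_gt_1 in auto)
      thus ?thesis using True e by (simp add: c_def poly_G chi_0 power_0_left)
    next
      case False
      have G: "poly G z \<in> fixed_field (2 * k)" unfolding poly_G using z fixed_field_poly[OF F(1)] fixed_field_diff fixed_field_frob by blast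
      have "\<chi> (Nm (2 * k) (poly G z)) ^ d = 1"
        by (rule chi_power_d) (use Nm_base_field[OF G] False in \<open>auto simp: Nm_def\<close>)
      from sum_powers_root_of_unity[OF this] d chi_nm[OF z False, of 1] False
      show ?thesis by (simp add: c_def poly_G)
    qed
  qed
  also have "\<dots> = of_nat d * of_nat (card {z \<in> fixed_field (2 * k). poly G z ^ expo (2 * k) = 1}) - of_nat (card {z \<in> fixed_field (2 * k). poly G z \<noteq> 0})"
    using fin by (simp add: sum_subtractf sum.If_cases Int_def mult.commute)
  finally show ?thesis .
qed

text \<open>Both terms of \<open>twisted_sum_total\<close> equal \<open>Q ^ (2 * k)\<close> up to a
  multiple of \<open>Q ^ k\<close>, so the main terms cancel.\<close>

lemma twisted_sum_total_bound:
  assumes k: "Q ^ k \<ge> 4 * d * (degree G + 1)" "k > 0"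
  shows "norm (\<Sum>j\<in>{1..<d}. \<Sum>\<psi>\<in>\<Psi>. twisted_sum j \<psi> (2 * k)) \<le> real (d * d * C + d * degree G) * real Q ^ k"
proof -
  define N where "N = card {z \<in> fixed_field (2 * k). poly G z ^ expo (2 * k) = 1}"
  define P where "P = card {z \<in> fixed_field (2 * k). poly G z \<noteq> 0}"
  define R where "R = Q ^ (2 * k)"
  have fin: "finite (fixed_field (2 * k))" using k by (intro finite_fixed_field) simp
  have cF: "card (fixed_field (2 * k)) = R" using k by (simp add: card_fixed_field R_def)
  have up: "d * N \<le> R + d * C * Q ^ k" unfolding N_def R_def by (rule stepanov_upper[OF k(1)])
  have lo: "R \<le> d * N + d * d * C * Q ^ k + d * degree G" unfolding N_def R_def
    by (rule stepanov_lower[OF k]) (simp add: U_def)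
  have P1: "P \<le> R" unfolding P_def cF [symmetric] using fin by (intro card_mono) auto
  have P2: "R \<le> P + degree G"
  proof -
    have "R \<le> card ({z \<in> fixed_field (2 * k). poly G z \<noteq> 0} \<union> {z. poly G z = 0})"
      unfolding cF [symmetric] using fin poly_roots_finite[OF G_nz] by (intro card_mono) auto
    also have "\<dots> \<le> P + card {z. poly G z = 0}" unfolding P_def by (rule card_Un_le)
    finally show ?thesis using card_poly_roots_bound[OF G_nz] by simp
  qed
  have Q1: "1 \<le> Q ^ k" using Q_gt_1 by simp
  have a: "d * degree G \<le> d * degree G * Q ^ k" using Q1 by simp
  have b: "degree G \<le> d * degree G" using d by simp
  have c: "d * C * Q ^ k \<le> d * d * C * Q ^ k" using d by simp
  define E where "E = (d * d * C + d * degree G) * Q ^ k"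
  have E: "E = d * d * C * Q ^ k + d * degree G * Q ^ k" by (simp only: E_def distrib_right)
  have "d * N \<le> P + E" using up P2 a b c unfolding E by linarith
  hence "real (d * N) - real P \<le> real E" by linarith
  moreover have "P \<le> d * N + E" using lo P1 a unfolding E by linarith
  hence "real P - real (d * N) \<le> real E" by linarith
  moreover have "(\<Sum>j\<in>{1..<d}. \<Sum>\<psi>\<in>\<Psi>. twisted_sum j \<psi> (2 * k)) = complex_of_real (real (d * N) - real P)"
    unfolding twisted_sum_total[OF k(2)] by (simp add: N_def P_def)
  ultimately have "norm (\<Sum>j\<in>{1..<d}. \<Sum>\<psi>\<in>\<Psi>. twisted_sum j \<psi> (2 * k)) \<le> real E"
    by (simp only: norm_of_real)
  thus ?thesis by (simp add: E_def)
qed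

text \<open>The reciprocal roots for all \<open>j\<close> and \<open>\<psi>\<close> are pooled,
  because only their joint power sums of even degree are controlled; hence
  \<open>power_sums_bound\<close> is applied to the squares \<open>v x ^ 2\<close>. Degree 1 then
  returns the individual sum.\<close>

theorem weil_bound:
  assumes j: "j \<in> {1..<d}" and psi: "\<psi> \<in> \<Psi>"
  shows "norm (\<Sum>x\<in>base_field. \<chi> (poly F x) ^ j * \<psi> x) \<le> real (degree M) * sqrt (real Q)"
proof -
  have "\<forall>p\<in>{1..<d} \<times> \<Psi>. \<exists>wm. snd wm \<le> degree M \<and> (\<forall>k\<ge>1. twisted_sum (fst p) (snd p) k = - (\<Sum>i<snd wm. fst wm i ^ k))"
  proof
    fix p assume "p \<in> {1..<d} \<times> \<Psi>"
    hence "fst p \<in> {1..<d}" "snd p \<in> \<Psi>" by auto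
    from twisted_sum_representation[OF this] obtain w m
      where "m \<le> degree M" "\<forall>k\<ge>1. twisted_sum (fst p) (snd p) k = - (\<Sum>i<m. w i ^ k)" by blast
    thus "\<exists>wm. snd wm \<le> degree M \<and> (\<forall>k\<ge>1. twisted_sum (fst p) (snd p) k = - (\<Sum>i<snd wm. fst wm i ^ k))"
      by (intro exI[of _ "(w, m)"]) simp
  qed
  from bchoice[OF this] obtain wm where wm': "\<forall>p\<in>{1..<d} \<times> \<Psi>. snd (wm p) \<le> degree M \<and>
      (\<forall>k\<ge>1. twisted_sum (fst p) (snd p) k = - (\<Sum>i<snd (wm p). fst (wm p) i ^ k))"
    by blast
  have wm: "\<And>p. p \<in> {1..<d} \<times> \<Psi> \<Longrightarrow> snd (wm p) \<le> degree M"
    "\<And>p k. p \<in> {1..<d} \<times> \<Psi> \<Longrightarrow> k \<ge> 1 \<Longrightarrow> twisted_sum (fst p) (snd p) k = - (\<Sum>i<snd (wm p). fst (wm p) i ^ k)"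
    using wm' by blast+
  define I where "I = Sigma ({1..<d} \<times> \<Psi>) (\<lambda>p. {..<snd (wm p)})"
  define v where "v = (\<lambda>(p, i). fst (wm p) i)"
  have finI: "finite I" by (auto simp: I_def fin_Psi)
  obtain k0 where k0: "k0 > 0" "\<And>k. k \<ge> k0 \<Longrightarrow> Q ^ k \<ge> 4 * d * (degree G + 1)"
    using exists_large by blast
  have le: "norm (\<Sum>x\<in>I. (v x ^ 2) ^ k) \<le> real (d * d * C + d * degree G) * real Q ^ k" if "k \<ge> k0" for k
  proof -
    have "(\<Sum>x\<in>I. (v x ^ 2) ^ k) = (\<Sum>(p, i)\<in>I. fst (wm p) i ^ (2 * k))"
      by (intro sum.cong) (auto simp: v_def power_mult)
    also have "\<dots> = (\<Sum>p\<in>{1..<d} \<times> \<Psi>. \<Sum>i<snd (wm p). fst (wm p) i ^ (2 * k))"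
      unfolding I_def by (rule sum.Sigma [symmetric]) (auto simp: fin_Psi)
    also have "\<dots> = (\<Sum>p\<in>{1..<d} \<times> \<Psi>. - twisted_sum (fst p) (snd p) (2 * k))"
      using wm(2)[of _ "2 * k"] k0(1) that by (intro sum.cong) auto
    also have "\<dots> = - (\<Sum>j\<in>{1..<d}. \<Sum>\<psi>\<in>\<Psi>. twisted_sum j \<psi> (2 * k))"
      by (simp add: sum_negf sum.cartesian_product split_def)
    finally show ?thesis using twisted_sum_total_bound[OF k0(2)[OF that]] k0(1) that by simp
  qed
  have bound: "norm (v x) \<le> sqrt (real Q)" if "x \<in> I" for x
  proof -
    have "norm (v x ^ 2) \<le> real Q"
      using power_sums_bound[OF finI _ le that] Q_gt_1 by simp
    thus ?thesis by (simp add: norm_power real_le_rsqrt)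
  qed
  have p: "(j, \<psi>) \<in> {1..<d} \<times> \<Psi>" using j psi by simp
  have "(\<Sum>x\<in>base_field. \<chi> (poly F x) ^ j * \<psi> x) = twisted_sum j \<psi> 1"
    by (simp add: twisted_sum_def fixed_field_1[unfolded One_nat_def] Nm_def Tr_def)
  also have "\<dots> = - (\<Sum>i<snd (wm (j, \<psi>)). fst (wm (j, \<psi>)) i)" using wm(2)[OF p, of 1] by simp
  also have "norm \<dots> \<le> (\<Sum>i<snd (wm (j, \<psi>)). sqrt (real Q))"
    unfolding norm_minus_cancel
  proof (rule order.trans[OF norm_sum], rule sum_mono)
    fix i assume "i \<in> {..<snd (wm (j, \<psi>))}"
    thus "norm (fst (wm (j, \<psi>)) i) \<le> sqrt (real Q)"
      using bound[of "((j, \<psi>), i)"] p by (auto simp: I_def v_def)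
  qed
  also have "\<dots> \<le> real (degree M) * sqrt (real Q)" using wm(1)[OF p] by (simp add: mult_right_mono)
  finally show ?thesis .
qed

end

section \<open>Characters of a finite field\<close>

lemma CHAR_of_primepow_card:
  assumes "CARD('a :: {field, finite}) = p ^ t" "prime p"
  shows "CHAR('a) = p"
proof -
  have "CHAR('a) > 0" by (rule finite_imp_CHAR_pos) simp
  hence "prime CHAR('a)" by (rule prime_CHAR_semidom)
  moreover have "CHAR('a) dvd p ^ t" using CHAR_dvd_CARD[where 'a = 'a] assms by simp
  ultimately show ?thesis using assms(2) by (metis prime_dvd_power primes_dvd_imp_eq)
qed

lemma finite_field_power_card:
  fixes x :: "'a :: {field, finite}" shows "x ^ CARD('a) = x"
proof (cases "x = 0")
  case False
  have "CARD('a) > 0" by (simp add: finite_UNIV_card_ge_0)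
  have "(\<Prod>y\<in>UNIV-{0}. y) = (\<Prod>y\<in>UNIV-{0}. x * y)"
    by (rule prod.reindex_bij_witness[of _ "\<lambda>y. x * y" "\<lambda>y. y / x"]) (use False in auto)
  also have "\<dots> = x ^ (CARD('a) - 1) * (\<Prod>y\<in>UNIV-{0}. y)" by (simp add: prod.distrib)
  finally have "x ^ (CARD('a) - 1) = 1" by simp
  hence "x * x ^ (CARD('a) - 1) = x" by simp
  thus ?thesis using \<open>CARD('a) > 0\<close> by (metis Suc_diff_1 power_Suc)
qed (simp add: finite_UNIV_card_ge_0 power_0_left)

lemma finite_field_generator:
  obtains \<gamma> :: "'a :: {field, finite}" where "\<gamma> \<noteq> 0" "\<And>x. x \<noteq> 0 \<Longrightarrow> \<exists>i. x = \<gamma> ^ i"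
proof -
  define R where "R = (ring_of_type_algebra :: 'a ring)"
  interpret R: field R unfolding R_def by (rule field_from_type_algebra)
  have "finite (carrier R)" by (simp add: R_def ring_of_type_algebra_def)
  obtain a where a: "a \<in> carrier (Multiplicative_Group.mult_of R)" "carrier (Multiplicative_Group.mult_of R) = {a [^]\<^bsub>R\<^esub> i | i :: nat. i \<in> UNIV}"
    by (rule bexE[OF R.finite_field_mult_group_has_gen[OF \<open>finite (carrier R)\<close>]])
  have "a [^]\<^bsub>R\<^esub> i = a ^ i" for i :: nat
  proof (induction i)
    case (Suc i)
    thus ?case using R.nat_pow_Suc[of a i] by (simp add: R_def ring_of_type_algebra_def mult.commute)
  qed (simp add: R_def ring_of_type_algebra_def)
  moreover have "carrier (Multiplicative_Group.mult_of R) = UNIV - {0}"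
    by (simp add: R_def ring_of_type_algebra_def Multiplicative_Group.mult_of_def)
  ultimately have eq: "UNIV - {0} = {a ^ i | i. i \<in> UNIV}" "a \<noteq> 0" using a by auto
  show ?thesis
  proof (rule that[OF eq(2)])
    fix x :: 'a assume "x \<noteq> 0"
    hence "x \<in> {a ^ i | i. i \<in> UNIV}" using eq(1) by auto
    thus "\<exists>i. x = a ^ i" by auto
  qed
qed

locale finite_field_chars =
  fixes \<gamma> :: "'a :: {field, finite}" and Q p t :: nat
  assumes gen: "\<gamma> \<noteq> 0" "\<And>x. x \<noteq> 0 \<Longrightarrow> \<exists>i. x = \<gamma> ^ i"
    and Q_card: "Q = CARD('a)" and card: "Q = p ^ t" and p: "prime p" and t: "t > 0"
begin

definition N :: nat where "N = Q - 1"

lemma Q_gt_1': "Q > 1"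
  using prime_gt_1_nat[OF p] t by (simp only: card one_less_power)

lemma N_pos: "N > 0" using Q_gt_1' by (simp add: N_def)

lemma CHAR_p: "CHAR('a) = p"
  by (rule CHAR_of_primepow_card[OF card[unfolded Q_card] p])

lemma power_Q: "x ^ Q = (x :: 'a)"
  by (simp only: Q_card finite_field_power_card)

sublocale finite_frobenius Q t "TYPE('a alg_closure)"
  by unfold_locales (simp_all add: CHAR_p p t card)

lemma base_field_eq: "base_field = range to_ac"
proof (rule sym, rule card_subset_eq[OF finite_base_field])
  show "range to_ac \<subseteq> base_field"
  proof
    fix y :: "'a alg_closure" assume "y \<in> range to_ac"
    then obtain x where "y = to_ac x" by auto
    thus "y \<in> base_field" using power_Q[of x] by (simp add: base_field_def flip: to_ac_power)
  qed
  show "card (range (to_ac :: 'a \<Rightarrow> 'a alg_closure)) = card base_field"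
    using card_base_field by (simp add: card_image inj_to_ac flip: Q_card)
qed

lemma Suc_N: "Suc N = Q" using Q_gt_1' by (simp add: N_def)

lemma power_N:
  assumes "x \<noteq> 0" shows "x ^ N = (1 :: 'a)"
proof -
  have "x ^ Suc N = x" unfolding Suc_N by (rule power_Q)
  hence "x * x ^ N = x * 1" by (simp only: power_Suc mult_1_right)
  thus ?thesis using assms by (simp only: mult_cancel_left) simp
qed

lemma gen_mod: "\<gamma> ^ (i mod N) = \<gamma> ^ i"
proof -
  have "\<gamma> ^ i = (\<gamma> ^ N) ^ (i div N) * \<gamma> ^ (i mod N)" by (simp flip: power_mult power_add)
  thus ?thesis using power_N[OF gen(1)] by simp
qed

lemma gen_image: "(\<lambda>i. \<gamma> ^ i) ` {..<N} = UNIV - {0}"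
proof
  show "UNIV - {0} \<subseteq> (\<lambda>i. \<gamma> ^ i) ` {..<N}"
  proof
    fix x :: 'a assume "x \<in> UNIV - {0}"
    then obtain i where "x = \<gamma> ^ i" using gen(2) by auto
    hence "x = \<gamma> ^ (i mod N)" by (simp add: gen_mod)
    thus "x \<in> (\<lambda>i. \<gamma> ^ i) ` {..<N}" using N_pos by auto
  qed
qed (use gen in auto)

lemma gen_inj: "inj_on (\<lambda>i. \<gamma> ^ i) {..<N}"
proof (rule eq_card_imp_inj_on)
  show "card ((\<lambda>i. \<gamma> ^ i) ` {..<N}) = card {..<N}"
    unfolding gen_image by (simp add: N_def card_Diff_singleton flip: Q_card)
qed simp

section \<open>Discrete logarithm and multiplicative characters\<close>

definition ind :: "'a \<Rightarrow> nat" where "ind x = the_inv_into {..<N} (\<lambda>i. \<gamma> ^ i) x"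

lemma ind_less: "x \<noteq> 0 \<Longrightarrow> ind x < N" and gen_ind: "x \<noteq> 0 \<Longrightarrow> \<gamma> ^ ind x = x"
proof -
  assume "x \<noteq> 0"
  hence x: "x \<in> (\<lambda>i. \<gamma> ^ i) ` {..<N}" by (simp add: gen_image)
  show "ind x < N" unfolding ind_def using the_inv_into_into[OF gen_inj x order.refl] by simp
  show "\<gamma> ^ ind x = x" unfolding ind_def by (rule f_the_inv_into_f[OF gen_inj x])
qed

lemma gen_eq_iff: "\<gamma> ^ i = \<gamma> ^ j \<longleftrightarrow> i mod N = j mod N"
proof
  assume "\<gamma> ^ i = \<gamma> ^ j"
  hence "\<gamma> ^ (i mod N) = \<gamma> ^ (j mod N)" by (simp add: gen_mod)
  thus "i mod N = j mod N" using inj_onD[OF gen_inj] N_pos by auto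
qed (metis gen_mod)

lemma ind_gen: "ind (\<gamma> ^ i) = i mod N"
  using gen_eq_iff[of "ind (\<gamma> ^ i)" i] gen_ind[of "\<gamma> ^ i"] ind_less[of "\<gamma> ^ i"] gen(1) by simp

lemma ind_mult: "x \<noteq> 0 \<Longrightarrow> y \<noteq> 0 \<Longrightarrow> ind (x * y) = (ind x + ind y) mod N"
  using ind_gen[of "ind x + ind y"] by (simp add: power_add gen_ind)

definition \<omega> :: complex where "\<omega> = cis (2 * pi / real N)"

lemma omega_power: "\<omega> ^ k = 1 \<longleftrightarrow> N dvd k"
proof -
  have "\<omega> ^ k = cis (2 * pi * (real k / real N))" by (simp add: \<omega>_def DeMoivre mult_ac)
  also have "\<dots> = 1 \<longleftrightarrow> (\<exists>m :: int. real k / real N = of_int m)"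
  proof -
    have "cis a = 1 \<longleftrightarrow> cos a = 1" for a
      using cos_one_sin_zero[of a] by (auto simp: complex_eq_iff)
    moreover have "2 * pi * a = of_int m * 2 * pi \<longleftrightarrow> a = of_int m" for a m by (auto simp: mult.commute)
    ultimately show ?thesis by (simp only: cos_one_2pi_int)
  qed
  also have "\<dots> \<longleftrightarrow> N dvd k"
  proof
    assume "\<exists>m :: int. real k / real N = of_int m"
    then obtain m :: int where "real k / real N = of_int m" by blast
    hence "real k = of_int (m * int N)" using N_pos by (simp add: field_simps)
    hence "int k = m * int N" by linarith
    thus "N dvd k" by (metis dvd_triv_right of_nat_dvd_iff)
  next
    assume "N dvd k"
    then obtain m where "k = N * m" by auto
    thus "\<exists>m :: int. real k / real N = of_int m" using N_pos by (intro exI[of _ "int m"]) simp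
  qed
  finally show ?thesis .
qed

lemma omega_mod: "\<omega> ^ (k mod N) = \<omega> ^ k"
proof -
  have "\<omega> ^ k = (\<omega> ^ N) ^ (k div N) * \<omega> ^ (k mod N)" by (simp flip: power_mult power_add)
  thus ?thesis using omega_power[of N] by simp
qed

text \<open>The value at 0 is 0 even for the trivial character \<open>u = 0\<close>.\<close>

definition mchar :: "nat \<Rightarrow> 'a \<Rightarrow> complex" where
  "mchar u x = (if x = 0 then 0 else \<omega> ^ (u * ind x))"

lemma mchar_0 [simp]: "mchar u 0 = 0" by (simp add: mchar_def)

lemma mchar_mult: "mchar u (x * y) = mchar u x * mchar u y"
proof (cases "x = 0 \<or> y = 0")
  case False
  hence "\<omega> ^ (u * ind (x * y)) = (\<omega> ^ u) ^ ((ind x + ind y) mod N)"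
    by (simp add: ind_mult power_mult)
  also have "\<dots> = \<omega> ^ (u * ((ind x + ind y) mod N) mod N)" by (simp add: omega_mod power_mult)
  also have "\<dots> = \<omega> ^ (u * (ind x + ind y))" by (simp add: mod_mult_right_eq omega_mod)
  finally show ?thesis using False by (simp add: mchar_def distrib_left power_add)
qed auto

lemma mchar_add: "mchar (u + v) x = mchar u x * mchar v x"
  by (simp add: mchar_def distrib_right power_add)

lemma mchar_mod: "mchar (u mod N) x = mchar u x"
proof -
  have "\<omega> ^ (u mod N * ind x) = \<omega> ^ (u mod N * ind x mod N)" by (simp add: omega_mod)
  also have "\<dots> = \<omega> ^ (u * ind x)" by (simp add: mod_mult_left_eq omega_mod)
  finally show ?thesis by (simp add: mchar_def)
qed

lemma mchar_zero: "x \<noteq> 0 \<Longrightarrow> mchar 0 x = 1" by (simp add: mchar_def)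

lemma mchar_one: "mchar u 1 = 1"
  using ind_gen[of 0] by (simp add: mchar_def)

lemma mchar_power: "x \<noteq> 0 \<Longrightarrow> mchar u x ^ k = mchar (u * k) x"
  by (simp add: mchar_def mult_ac flip: power_mult)

lemma mchar_power_arg: "mchar u (x ^ k) = mchar u x ^ k"
  by (induction k) (simp_all add: mchar_one mchar_mult)

lemma mchar_N: "x \<noteq> 0 \<Longrightarrow> N dvd u \<Longrightarrow> mchar u x = 1"
  using omega_power[of "u * ind x"] by (simp add: mchar_def)

lemma mchar_eq_1_iff:
  assumes "x \<noteq> 0" "g dvd N"
  shows "mchar g x = 1 \<longleftrightarrow> x ^ g = 1"
proof -
  have "x ^ g = \<gamma> ^ (ind x * g)" using gen_ind[OF assms(1)] by (simp add: power_mult)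
  hence "x ^ g = 1 \<longleftrightarrow> N dvd g * ind x" using gen_eq_iff[of "ind x * g" 0] by (simp add: dvd_eq_mod_eq_0 mult.commute)
  thus ?thesis using assms omega_power by (simp add: mchar_def)
qed

lemma sum_mchar: "(\<Sum>x\<in>UNIV - {0}. mchar u x) = (if N dvd u then of_nat N else 0)"
proof -
  have "(\<Sum>x\<in>UNIV - {0}. mchar u x) = (\<Sum>i<N. mchar u (\<gamma> ^ i))"
    unfolding gen_image [symmetric] by (simp add: sum.reindex[OF gen_inj])
  also have "\<dots> = (\<Sum>i<N. (\<omega> ^ u) ^ i)"
    using gen(1) by (intro sum.cong) (auto simp: mchar_def ind_gen power_mult)
  also have "\<dots> = (if N dvd u then of_nat N else 0)"
  proof (cases "N dvd u")
    case True
    hence "\<omega> ^ u = 1" by (simp add: omega_power)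
    thus ?thesis using True by simp
  next
    case False
    moreover have "(\<omega> ^ u) ^ N = 1" using omega_power[of "u * N"] by (simp flip: power_mult)
    ultimately show ?thesis by (simp add: omega_power geometric_sum)
  qed
  finally show ?thesis .
qed

section \<open>Absolute trace and additive characters\<close>

definition atr :: "'a \<Rightarrow> 'a" where "atr x = (\<Sum>i<t. x ^ p ^ i)"

lemma p_add: "(x + y :: 'a) ^ p ^ i = x ^ p ^ i + y ^ p ^ i"
  by (rule freshmans_dream') (simp_all add: CHAR_p p)

lemma atr_add: "atr (x + y) = atr x + atr y"
  by (simp add: atr_def p_add sum.distrib)

lemma atr_fixed: "atr x ^ p = atr x"
proof -
  have "atr x ^ p = (\<Sum>i<t. (x ^ p ^ i) ^ p)"
    unfolding atr_def by (rule freshmans_dream_sum) (simp_all add: CHAR_p p)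
  also have "\<dots> = (\<Sum>i<t. x ^ p ^ Suc i)" by (simp add: mult.commute flip: power_mult)
  also have "\<dots> = atr x"
  proof -
    have "x ^ p ^ 0 + (\<Sum>i<t. x ^ p ^ Suc i) = (\<Sum>i<t. x ^ p ^ i) + x ^ p ^ t"
      by (rule trans[OF sum.lessThan_Suc_shift[of "\<lambda>i. x ^ p ^ i" t, symmetric] sum.lessThan_Suc])
    thus ?thesis using power_Q[of x] by (simp add: atr_def card)
  qed
  finally show ?thesis .
qed

text \<open>The trace is a root of \<open>X ^ p - X\<close>, which has at most \<open>p\<close>
  roots; the \<open>p\<close> residues \<open>of_nat j\<close> are already that many.\<close>

lemma atr_nat: "\<exists>j<p. atr x = of_nat j"
proof -
  define P :: "'a poly" where "P = monom 1 p - [:0, 1:]"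
  have deg: "degree P = p" unfolding P_def
    by (subst diff_conv_add_uminus, subst degree_add_eq_left) (use prime_gt_1_nat[OF p] in \<open>auto simp: degree_monom_eq\<close>)
  hence "P \<noteq> 0" using p by auto
  have roots: "{x. poly P x = 0} = {x. x ^ p = x}" by (auto simp: P_def poly_monom)
  have "of_nat ` {..<p} \<subseteq> {x :: 'a. x ^ p = x}"
  proof
    fix y :: 'a assume "y \<in> of_nat ` {..<p}"
    then obtain j where "y = of_nat j" by auto
    moreover have "of_nat j ^ p = (of_nat j :: 'a)"
      by (induction j) (use p_add[of _ _ 1] prime_gt_0_nat[OF p] in \<open>auto simp: power_0_left\<close>)
    ultimately show "y \<in> {x. x ^ p = x}" by simp
  qed
  moreover have "inj_on (of_nat :: nat \<Rightarrow> 'a) {..<p}"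
    by (intro inj_onI) (auto simp: of_nat_eq_iff_cong_CHAR CHAR_p cong_def)
  hence "card (of_nat ` {..<p} :: 'a set) = p" by (simp add: card_image)
  moreover have "card {x :: 'a. x ^ p = x} \<le> p" using card_poly_roots_bound[OF \<open>P \<noteq> 0\<close>] by (simp add: deg roots)
  ultimately have "of_nat ` {..<p} = {x :: 'a. x ^ p = x}" by (intro card_seteq) auto
  thus ?thesis using atr_fixed[of x] by auto
qed

text \<open>The canonical additive character. By \<open>psi0_eq\<close> the choice of the
  representative \<open>j\<close> of the trace does not matter.\<close>

definition \<psi>0 :: "'a \<Rightarrow> complex" where
  "\<psi>0 x = cis (2 * pi * real (SOME j. atr x = of_nat j) / real p)"

lemma psi0_eq: "atr x = of_nat j \<Longrightarrow> \<psi>0 x = cis (2 * pi * real j / real p)"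
proof -
  assume j: "atr x = of_nat j"
  define i where "i = (SOME j. atr x = of_nat j)"
  have "atr x = of_nat i" unfolding i_def by (rule someI[of _ j]) fact
  hence "i mod p = j mod p" using j by (simp add: of_nat_eq_iff_cong_CHAR CHAR_p cong_def)
  have *: "cis (2 * pi * real k / real p) = cis (2 * pi * real (k mod p) / real p)" for k
  proof -
    have "real k = real (k mod p) + real p * real (k div p)" by (metis mod_mult_div_eq of_nat_add of_nat_mult)
    hence "2 * pi * real k / real p = 2 * pi * real (k mod p) / real p + 2 * pi * real (k div p)"
      using prime_gt_0_nat[OF p] by (simp add: field_simps)
    thus ?thesis by (simp add: cis_mult [symmetric] cis_multiple_2pi)
  qed
  show ?thesis unfolding \<psi>0_def i_def [symmetric] by (subst (1 2) *) (simp add: \<open>i mod p = j mod p\<close>)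
qed

lemma psi0_add: "\<psi>0 (x + y) = \<psi>0 x * \<psi>0 y"
proof -
  obtain i j where ij: "atr x = of_nat i" "atr y = of_nat j" using atr_nat by metis
  hence "atr (x + y) = of_nat (i + j)" by (simp add: atr_add)
  from psi0_eq[OF this] show ?thesis
    using ij by (simp add: psi0_eq cis_mult add_divide_distrib distrib_left)
qed

text \<open>As a polynomial the trace has degree \<open>p ^ (t - 1)\<close>, less than
  \<open>Q\<close>, so it does not vanish on the whole field.\<close>

lemma psi0_nontrivial: "\<exists>x. \<psi>0 x \<noteq> 1"
proof -
  define P :: "'a poly" where "P = (\<Sum>i<t. monom 1 (p ^ i))"
  obtain t' where t': "t = Suc t'" using t by (cases t) auto
  have "coeff P (p ^ t') = (\<Sum>i<t. if i = t' then 1 else 0)"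
    unfolding P_def coeff_sum using prime_gt_1_nat[OF p] by (intro sum.cong) (auto simp: power_inject_exp)
  hence "P \<noteq> 0" using t' by auto
  have "degree P \<le> p ^ t'" unfolding P_def
    by (intro degree_sum_le order.trans[OF degree_monom_le] power_increasing) (use prime_gt_0_nat[OF p] t' in auto)
  also have "\<dots> < Q" using prime_gt_1_nat[OF p] by (simp add: card t')
  finally have "card {x. poly P x = 0} < Q" using card_poly_roots_bound[OF \<open>P \<noteq> 0\<close>] by simp
  hence "{x. poly P x = 0} \<noteq> UNIV" by (auto simp: Q_card)
  then obtain x where x: "atr x \<noteq> 0" by (auto simp: P_def atr_def poly_sum poly_monom)
  obtain j where j: "j < p" "atr x = of_nat j" using atr_nat by blast
  have "\<psi>0 x \<noteq> 1"
  proof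
    assume "\<psi>0 x = 1"
    hence "cos (2 * pi * real j / real p) = 1" using psi0_eq[OF j(2)] by (metis cis.sel(1) one_complex.sel(1))
    then obtain m :: int where "2 * pi * real j / real p = of_int m * 2 * pi" by (auto simp: cos_one_2pi_int)
    hence "real j = of_int (m * int p)" using prime_gt_0_nat[OF p] by (simp add: field_simps)
    hence "int j = m * int p" by linarith
    hence "p dvd j" by (metis dvd_triv_right of_nat_dvd_iff)
    hence "j = 0" using j(1) by (auto dest: dvd_imp_le)
    thus False using x j by simp
  qed
  thus ?thesis by blast
qed

definition achar :: "'a \<Rightarrow> 'a \<Rightarrow> complex" where "achar c x = \<psi>0 (c * x)"

lemma achar_commute: "achar c x = achar x c" by (simp add: achar_def mult.commute)

lemma achar_add: "achar c (x + y) = achar c x * achar c y"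
  by (simp add: achar_def distrib_left psi0_add)

lemma achar_add_left: "achar (c + c') x = achar c x * achar c' x"
  by (simp add: achar_def distrib_right psi0_add)

lemma achar_0: "achar c 0 = 1" and achar_0_left: "achar 0 x = 1"
proof -
  have "p \<noteq> 0" using p by auto
  hence "atr 0 = of_nat 0" by (simp add: atr_def power_0_left)
  from psi0_eq[OF this] show "achar c 0 = 1" "achar 0 x = 1" by (simp_all add: achar_def)
qed

lemma norm_achar: "norm (achar c x) = 1" by (simp add: achar_def \<psi>0_def)

lemma sum_achar: "(\<Sum>x\<in>UNIV. achar c x) = (if c = 0 then of_nat Q else 0)"
proof (cases "c = 0")
  case False
  obtain y where y: "\<psi>0 y \<noteq> 1" using psi0_nontrivial by blast
  have "(\<Sum>x\<in>UNIV. achar c x) = (\<Sum>x\<in>UNIV. achar c (x + y / c))"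
    by (rule sum.reindex_bij_witness[of _ "\<lambda>x. x + y / c" "\<lambda>x. x - y / c"]) auto
  also have "achar c (y / c) = \<psi>0 y" using False by (simp add: achar_def)
  hence "(\<Sum>x\<in>UNIV. achar c (x + y / c)) = \<psi>0 y * (\<Sum>x\<in>UNIV. achar c x)"
    by (simp add: achar_add sum_distrib_left mult.commute)
  finally have "(1 - \<psi>0 y) * (\<Sum>x\<in>UNIV. achar c x) = 0" by (simp add: algebra_simps)
  thus ?thesis using y False by simp
qed (simp add: achar_0_left Q_card)

lemma sum_achar_left: "(\<Sum>c\<in>UNIV. achar c x) = (if x = 0 then of_nat Q else 0)"
  using sum_achar[of x] by (simp add: achar_commute)

lemma inj_achar: "inj achar"
proof (rule injI)
  fix c c' assume eq: "achar c = achar c'"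
  have "achar (c - c') x = 1" for x
  proof -
    have "achar (c - c') x * achar c' x = achar c' x" using achar_add_left[of "c - c'" c' x] eq by simp
    thus ?thesis using norm_achar[of c' x] by auto
  qed
  hence "(\<Sum>x\<in>UNIV. achar (c - c') x) = of_nat Q" by (simp add: Q_card)
  thus "c = c'" using sum_achar[of "c - c'"] Q_gt_1' by (auto split: if_splits)
qed

end

section \<open>Expansions with small absolute coefficient sum\<close>

text \<open>The norm of the Wiener algebra; it is submultiplicative if the \<open>e i\<close> are closed under products.\<close>

definition wiener :: "('i \<Rightarrow> 'x \<Rightarrow> complex) \<Rightarrow> 'i set \<Rightarrow> 'x set \<Rightarrow> ('x \<Rightarrow> complex) \<Rightarrow> real \<Rightarrow> bool" where
  "wiener e I A f B \<longleftrightarrow>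
     (\<exists>a. (\<forall>x\<in>A. f x = (\<Sum>i\<in>I. a i * e i x)) \<and> (\<Sum>i\<in>I. norm (a i)) \<le> B)"

lemma wiener_mult:
  assumes fin: "finite I"
    and closed: "\<And>i j. i \<in> I \<Longrightarrow> j \<in> I \<Longrightarrow> m i j \<in> I"
      "\<And>i j x. i \<in> I \<Longrightarrow> j \<in> I \<Longrightarrow> x \<in> A \<Longrightarrow> e i x * e j x = e (m i j) x"
    and f: "wiener e I A f B" and g: "wiener e I A g C"
  shows "wiener e I A (\<lambda>x. f x * g x) (B * C)"
proof -
  obtain a where a: "\<And>x. x \<in> A \<Longrightarrow> f x = (\<Sum>i\<in>I. a i * e i x)" "(\<Sum>i\<in>I. norm (a i)) \<le> B"
    using f by (auto simp: wiener_def)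
  obtain b where b: "\<And>x. x \<in> A \<Longrightarrow> g x = (\<Sum>i\<in>I. b i * e i x)" "(\<Sum>i\<in>I. norm (b i)) \<le> C"
    using g by (auto simp: wiener_def)
  define M where "M = (\<lambda>(i, j). m i j)"
  define c where "c k = (\<Sum>p\<in>{p \<in> I \<times> I. M p = k}. a (fst p) * b (snd p))" for k
  have grp: "(\<Sum>k\<in>I. \<Sum>p\<in>{p \<in> I \<times> I. M p = k}. h p) = (\<Sum>p\<in>I \<times> I. h p)" for h :: "'a \<times> 'a \<Rightarrow> 'z :: comm_monoid_add"
    by (rule sum.group) (use fin closed(1) in \<open>auto simp: M_def\<close>)
  have "f x * g x = (\<Sum>k\<in>I. c k * e k x)" if "x \<in> A" for x
  proof -
    have "f x * g x = (\<Sum>p\<in>I \<times> I. a (fst p) * b (snd p) * e (M p) x)"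
      unfolding a(1)[OF that] b(1)[OF that] sum_product sum.cartesian_product
      by (intro sum.cong) (auto simp: M_def that simp flip: closed(2))
    also have "\<dots> = (\<Sum>k\<in>I. \<Sum>p\<in>{p \<in> I \<times> I. M p = k}. a (fst p) * b (snd p) * e (M p) x)" by (rule grp [symmetric])
    also have "\<dots> = (\<Sum>k\<in>I. c k * e k x)"
      unfolding c_def sum_distrib_right by (intro sum.cong) auto
    finally show ?thesis .
  qed
  moreover have "(\<Sum>k\<in>I. norm (c k)) \<le> B * C"
  proof -
    have "(\<Sum>k\<in>I. norm (c k)) \<le> (\<Sum>k\<in>I. \<Sum>p\<in>{p \<in> I \<times> I. M p = k}. norm (a (fst p)) * norm (b (snd p)))"
      unfolding c_def by (intro sum_mono order.trans[OF norm_sum]) (simp add: norm_mult)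
    also have "\<dots> = (\<Sum>p\<in>I \<times> I. norm (a (fst p)) * norm (b (snd p)))" by (rule grp)
    also have "\<dots> = (\<Sum>i\<in>I. norm (a i)) * (\<Sum>i\<in>I. norm (b i))"
      by (simp add: sum_product sum.cartesian_product split_def)
    also have "\<dots> \<le> B * C"
      using a(2) b(2) by (intro mult_mono) (auto intro: sum_nonneg order.trans[OF sum_nonneg a(2)])
    finally show ?thesis .
  qed
  ultimately show ?thesis unfolding wiener_def by blast
qed

lemma wiener_one:
  assumes "finite I" "i0 \<in> I" "\<And>x. x \<in> A \<Longrightarrow> e i0 x = 1"
  shows "wiener e I A (\<lambda>_. 1) 1"
  unfolding wiener_def using assms
  by (intro exI[of _ "\<lambda>i. if i = i0 then 1 else 0"]) (auto simp: if_distrib[of norm] if_distrib[of "\<lambda>a. a * _"] cong: if_cong)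

lemma wiener_prod:
  assumes fin: "finite I"
    and closed: "\<And>i j. i \<in> I \<Longrightarrow> j \<in> I \<Longrightarrow> m i j \<in> I"
      "\<And>i j x. i \<in> I \<Longrightarrow> j \<in> I \<Longrightarrow> x \<in> A \<Longrightarrow> e i x * e j x = e (m i j) x"
    and one: "i0 \<in> I" "\<And>x. x \<in> A \<Longrightarrow> e i0 x = 1"
    and H: "finite H" "\<And>h. h \<in> H \<Longrightarrow> wiener e I A (f h) (B h)"
  shows "wiener e I A (\<lambda>x. \<Prod>h\<in>H. f h x) (\<Prod>h\<in>H. B h)"
  using H
proof (induction H rule: finite_induct)
  case empty
  show ?case using wiener_one[where e = e and I = I and A = A, OF fin one] by simp
next
  case (insert h H)
  have "wiener e I A (\<lambda>x. f h x * (\<Prod>h\<in>H. f h x)) (B h * (\<Prod>h\<in>H. B h))"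
    by (rule wiener_mult[where m = m, OF fin closed]) (use insert in auto)
  thus ?case using insert by simp
qed

text \<open>With \<open>P\<close> as the group of characters trivial on a subgroup of index
  \<open>card P\<close>, its indicator is the average over \<open>P\<close>. After complementation
  the trivial character has coefficient \<open>1 - v\<close>, and the others contribute
  \<open>card P - 1\<close> times \<open>v\<close>, which is again \<open>1 - v\<close>.\<close>

lemma wiener_complement:
  fixes e :: "'i \<Rightarrow> 'x \<Rightarrow> complex"
  assumes I: "finite I" "P \<subseteq> I" "i0 \<in> P" and v: "real (card P) * v = 1"
    and one: "\<And>x. x \<in> A \<Longrightarrow> e i0 x = 1"
    and ind: "\<And>x. x \<in> A \<Longrightarrow> of_real v * (\<Sum>i\<in>P. e i x) = (if h x then 1 else 0)"
  shows "wiener e I A (\<lambda>x. if h x then 0 else 1) (2 * (1 - v))"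
proof -
  define a where "a i = (if i = i0 then 1 else 0) - (if i \<in> P then of_real v else 0 :: complex)" for i
  have finP: "finite P" using I finite_subset by blast
  have "card P \<ge> 1" using I(3) finP by (auto simp: Suc_le_eq card_gt_0_iff)
  hence "v = 1 / real (card P)" using v by (simp add: nonzero_eq_divide_eq mult.commute)
  hence v01: "v \<ge> 0" "v \<le> 1" using \<open>card P \<ge> 1\<close> by simp_all
  have "(\<Sum>i\<in>I. a i * e i x) = (if h x then 0 else 1)" if "x \<in> A" for x
  proof -
    have "(\<Sum>i\<in>I. a i * e i x) = (\<Sum>i\<in>P. a i * e i x)"
      using I by (intro sum.mono_neutral_right) (auto simp: a_def)
    also have "\<dots> = (\<Sum>i\<in>P. if i = i0 then e i x else 0) - (\<Sum>i\<in>P. of_real v * e i x)"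
      unfolding sum_subtractf [symmetric] by (intro sum.cong) (auto simp: a_def algebra_simps)
    also have "\<dots> = 1 - (if h x then 1 else 0)"
      using finP I(3) that by (simp add: one ind flip: sum_distrib_left)
    finally show ?thesis by simp
  qed
  moreover have "(\<Sum>i\<in>I. norm (a i)) \<le> 2 * (1 - v)"
  proof -
    have "(\<Sum>i\<in>I. norm (a i)) = (\<Sum>i\<in>P. norm (a i))"
      using I by (intro sum.mono_neutral_right) (auto simp: a_def)
    also have "\<dots> = norm (a i0) + (\<Sum>i\<in>P - {i0}. norm (a i))" using I finP by (intro sum.remove) auto
    also have "(\<Sum>i\<in>P - {i0}. norm (a i)) = (\<Sum>i\<in>P - {i0}. v)"
      using v01 by (intro sum.cong) (auto simp: a_def)
    also have "\<dots> = 1 - v" using \<open>card P \<ge> 1\<close> I(3) finP v by (simp add: of_nat_diff algebra_simps)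
    also have "a i0 = complex_of_real (1 - v)" using I(3) by (simp add: a_def)
    also have "norm \<dots> = 1 - v" using v01 by (simp only: norm_of_real)
    finally show ?thesis by simp
  qed
  ultimately show ?thesis unfolding wiener_def by (intro exI[of _ a]) auto
qed

section \<open>Expansions of the factors for primitivity and for subgroups\<close>

context finite_field_chars
begin

lemma mchar_closed:
  "u \<in> {..<N} \<Longrightarrow> v \<in> {..<N} \<Longrightarrow> (u + v) mod N \<in> {..<N}"
  "mchar u x * mchar v x = mchar ((u + v) mod N) x"
  using N_pos by (simp_all add: mchar_mod mchar_add)

lemma wiener_nonpower:
  assumes l: "prime l" "l dvd N"
  shows "wiener mchar {..<N} (UNIV - {0}) (\<lambda>x. if l dvd ind x then 0 else 1) (2 * (1 - 1 / real l))"
proof -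
  obtain m where m: "N = m * l" using l(2) by (metis dvd_def mult.commute)
  have "l > 0" using prime_gt_0_nat[OF l(1)] .
  have "m > 0" using m N_pos by (cases m) auto
  \<comment> \<open>The exponents of the characters of order dividing \<open>l\<close>, that is, of
    those trivial on all l-th powers.\<close>
  define T where "T = (\<lambda>s. m * s) ` {..<l}"
  have T: "T = {u \<in> {..<N}. m dvd u}" "0 \<in> T" "card T = l" "finite T"
    using \<open>m > 0\<close> \<open>l > 0\<close> by (auto simp: T_def m card_image inj_on_def elim!: dvdE)
  have sumT: "(\<Sum>u\<in>T. mchar u x) = (if l dvd ind x then of_nat l else 0)" if "x \<noteq> 0" for x
  proof -
    have "(\<Sum>u\<in>T. mchar u x) = (\<Sum>s<l. mchar (m * s) x)"
      unfolding T_def using \<open>m > 0\<close> by (subst sum.reindex) (auto simp: inj_on_def)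
    also have "\<dots> = (\<Sum>s<l. (\<omega> ^ (m * ind x)) ^ s)"
      using that by (intro sum.cong) (auto simp: mchar_def mult_ac simp flip: power_mult)
    also have "\<dots> = (if l dvd ind x then of_nat l else 0)"
    proof (cases "l dvd ind x")
      case True
      hence "\<omega> ^ (m * ind x) = 1" by (simp add: omega_power m)
      thus ?thesis using True by simp
    next
      case False
      hence "\<omega> ^ (m * ind x) \<noteq> 1" using \<open>m > 0\<close> by (simp add: omega_power m)
      moreover have "(\<omega> ^ (m * ind x)) ^ l = 1"
        using omega_power[of "N * ind x"] by (simp add: m mult_ac flip: power_mult)
      ultimately show ?thesis using False by (simp add: geometric_sum)
    qed
    finally show ?thesis .
  qed
  show ?thesis
    by (rule wiener_complement[where P = T and ?i0.0 = 0])
       (use T sumT \<open>l > 0\<close> mchar_zero in auto)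
qed

definition prim_ind :: "'a \<Rightarrow> complex" where
  "prim_ind x = (\<Prod>l\<in>prime_factors N. if l dvd ind x then 0 else 1)"

lemma prim_ind_eq: "prim_ind x = (if coprime (ind x) N then 1 else 0)"
proof (cases "coprime (ind x) N")
  case True
  have "\<not> l dvd ind x" if "l \<in> prime_factors N" for l
    using that True coprime_common_divisor[of "ind x" N l] by (auto simp: in_prime_factors_iff)
  thus ?thesis using True by (simp add: prim_ind_def)
next
  case False
  hence "gcd (ind x) N \<noteq> 1" unfolding coprime_iff_gcd_eq_1 .
  then obtain l where "prime l" "l dvd gcd (ind x) N" using prime_factor_nat by blast
  hence "prime l" "l dvd ind x" "l dvd N" by auto
  hence "\<exists>l\<in>prime_factors N. l dvd ind x" using N_pos by (intro bexI[of _ l]) (auto simp: in_prime_factors_iff)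
  thus ?thesis using False by (auto simp: prim_ind_def intro!: prod_zero)
qed

lemma primitive_if_coprime:
  assumes "x \<noteq> 0" "coprime (ind x) N" shows "primitive_elem x"
proof -
  obtain m where m: "[ind x * m = 1] (mod N)" using cong_solve_coprime_nat[OF assms(2)] by auto
  have "x ^ m = \<gamma> ^ (ind x * m)" using gen_ind[OF assms(1)] by (simp add: power_mult)
  also have "\<dots> = \<gamma> ^ 1" using m by (subst gen_eq_iff) (simp add: cong_def)
  finally have xm: "x ^ m = \<gamma>" by simp
  have "y \<in> range (\<lambda>k :: int. x powi k)" if y: "y \<noteq> 0" for y
  proof -
    obtain i where "y = \<gamma> ^ i" using gen(2)[OF y] by auto
    hence "y = x powi int (m * i)" by (simp only: xm [symmetric] power_int_of_nat power_mult)
    thus ?thesis by blast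
  qed
  thus ?thesis using assms(1) unfolding primitive_elem_def by auto
qed

text \<open>The density \<open>totient N / N\<close> of the primitive elements among the
  units.\<close>

definition \<theta> :: real where "\<theta> = (\<Prod>l\<in>prime_factors N. 1 - 1 / real l)"

lemma theta_pos: "\<theta> > 0"
  unfolding \<theta>_def by (intro prod_pos) (auto simp: in_prime_factors_iff dest!: prime_gt_1_nat)

lemma sum_prim_ind: "(\<Sum>x\<in>UNIV - {0}. prim_ind x) = of_real (\<theta> * real N)"
proof -
  have "(\<Sum>x\<in>UNIV - {0}. prim_ind x) = (\<Sum>i<N. prim_ind (\<gamma> ^ i))"
    unfolding gen_image [symmetric] by (simp add: sum.reindex[OF gen_inj])
  also have "\<dots> = (\<Sum>i<N. if coprime i N then 1 else 0)"
    by (intro sum.cong) (auto simp: prim_ind_eq ind_gen)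
  also have "\<dots> = of_nat (card {i \<in> {..<N}. coprime i N})" by (simp add: sum.If_cases Int_def)
  also have "card {i \<in> {..<N}. coprime i N} = totient N"
  \<comment> \<open>Residues start at 0 here and at 1 in \<open>totatives\<close>; this makes a
    difference only for \<open>N = 1\<close>.\<close>
  proof (cases "N = 1")
    case False
    hence "{i \<in> {..<N}. coprime i N} = totatives N"
      using N_pos by (auto simp: totatives_def intro!: Nat.gr0I le_neq_implies_less)
    thus ?thesis by (simp add: totient_def)
  qed (auto simp: Suc_lessI card_1_singleton_iff intro!: exI[of _ 0])
  also have "of_nat (totient N) = complex_of_real (real (totient N))" by simp
  also have "\<dots> = of_real (\<theta> * real N)"
    by (simp only: totient_formula2 \<theta>_def mult.commute)
  finally show ?thesis .
qed

lemma prim_ind_expansion: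
  obtains a where "\<And>x. x \<noteq> 0 \<Longrightarrow> prim_ind x = (\<Sum>u<N. a u * mchar u x)"
    "(\<Sum>u<N. norm (a u)) \<le> \<theta> * 2 ^ card (prime_factors N)" "a 0 = of_real \<theta>"
proof -
  have "wiener mchar {..<N} (UNIV - {0}) (\<lambda>x. \<Prod>l\<in>prime_factors N. if l dvd ind x then 0 else 1)
     (\<Prod>l\<in>prime_factors N. 2 * (1 - 1 / real l))"
  proof (rule wiener_prod[where m = "\<lambda>u v. (u + v) mod N" and ?i0.0 = 0])
    show "wiener mchar {..<N} (UNIV - {0}) (\<lambda>x. if l dvd ind x then 0 else 1) (2 * (1 - 1 / real l))"
      if "l \<in> prime_factors N" for l
      using that by (intro wiener_nonpower) (auto simp: in_prime_factors_iff)
  qed (use N_pos mchar_closed mchar_zero in auto)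
  then obtain a where a: "\<And>x. x \<noteq> 0 \<Longrightarrow> prim_ind x = (\<Sum>u<N. a u * mchar u x)"
    "(\<Sum>u<N. norm (a u)) \<le> (\<Prod>l\<in>prime_factors N. 2 * (1 - 1 / real l))"
    unfolding wiener_def prim_ind_def by auto
  \<comment> \<open>Summation over the units isolates the coefficient of the trivial character,
    which is therefore the mean \<open>\<theta>\<close>.\<close>
  have "(\<Sum>x\<in>UNIV - {0}. prim_ind x) = (\<Sum>u<N. a u * (\<Sum>x\<in>UNIV - {0}. mchar u x))"
    by (simp add: a(1) sum_distrib_left) (rule sum.swap)
  also have "\<dots> = (\<Sum>u<N. if u = 0 then a 0 * of_nat N else 0)"
    by (intro sum.cong refl) (auto simp: sum_mchar dest: dvd_imp_le)
  also have "\<dots> = a 0 * of_nat N" using N_pos by simp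
  finally have e1: "(\<Sum>x\<in>UNIV - {0}. prim_ind x) = a 0 * of_nat N" .
  have eq: "a 0 * of_nat N = of_real \<theta> * of_nat N" unfolding e1 [symmetric] sum_prim_ind by simp
  have "of_nat N \<noteq> (0 :: complex)" using N_pos by simp
  from mult_right_cancel[THEN iffD1, OF this eq] have "a 0 = of_real \<theta>" .
  moreover have "(\<Prod>l\<in>prime_factors N. 2 * (1 - 1 / real l)) = \<theta> * 2 ^ card (prime_factors N)"
    by (simp only: prod.distrib \<theta>_def prod_constant mult.commute)
  ultimately show ?thesis using that[of a] a by simp
qed

text \<open>Poisson summation for the subgroup \<open>V\<close> and its annihilator
  \<open>P\<close>; evaluating the expansion of the indicator at 0 gives
  \<open>card P * card V = Q\<close>.\<close>

lemma wiener_nonmember: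
  assumes V: "0 \<in> V" "\<And>x y. x \<in> V \<Longrightarrow> y \<in> V \<Longrightarrow> x + y \<in> V" "\<And>x. x \<in> V \<Longrightarrow> - x \<in> V"
  shows "wiener achar UNIV UNIV (\<lambda>x. if x \<in> V then 0 else 1) (2 * (1 - real (card V) / real Q))"
proof -
  define P where "P = {c. \<forall>v\<in>V. achar c v = 1}"
  have Q: "Q > 0" using Q_gt_1' by simp
  have sumV: "(\<Sum>v\<in>V. achar c (- v)) = (if c \<in> P then of_nat (card V) else 0)" for c
  proof (cases "c \<in> P")
    case True
    thus ?thesis using V(3) by (simp add: P_def)
  next
    case False
    then obtain w where w: "w \<in> V" "achar c w \<noteq> 1" by (auto simp: P_def)
    have "v - w \<in> V" if "v \<in> V" for v using V(2)[OF that V(3)[OF w(1)]] by simp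
    hence "(\<Sum>v\<in>V. achar c (- v)) = (\<Sum>v\<in>V. achar c (w + - v))"
      by (intro sum.reindex_bij_witness[of _ "\<lambda>v. v - w" "\<lambda>v. v + w"]) (use w V in auto)
    hence "(1 - achar c w) * (\<Sum>v\<in>V. achar c (- v)) = 0"
      by (simp only: achar_add sum_distrib_left [symmetric] left_diff_distrib mult_1) simp
    thus ?thesis using w False by simp
  qed
  have ind: "(\<Sum>c\<in>UNIV. (if c \<in> P then of_nat (card V) / of_nat Q else 0) * achar c x) = (if x \<in> V then 1 else 0)" for x
  proof -
    have "(\<Sum>c\<in>UNIV. (if c \<in> P then of_nat (card V) / of_nat Q else 0) * achar c x)
       = (\<Sum>c\<in>UNIV. (\<Sum>v\<in>V. achar c (- v)) / of_nat Q * achar c x)"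
      by (intro sum.cong refl) (simp add: sumV)
    also have "\<dots> = (\<Sum>v\<in>V. (\<Sum>c\<in>UNIV. achar c (x + - v)) / of_nat Q)"
      unfolding sum_divide_distrib sum_distrib_right
      by (subst sum.swap) (intro sum.cong refl, simp only: achar_add, simp add: mult.commute)
    also have "\<dots> = (\<Sum>v\<in>V. if v = x then 1 else 0)"
      using Q by (intro sum.cong refl) (auto simp: sum_achar_left)
    finally show ?thesis by simp
  qed
  have "0 \<in> P" by (simp add: P_def achar_0_left)
  have cardP: "real (card P) * real (card V) = real Q"
  proof -
    have "(\<Sum>c\<in>UNIV. (if c \<in> P then of_nat (card V) / of_nat Q else 0) * achar c 0) = of_nat (card P) * (of_nat (card V) / of_nat Q :: complex)"
      by (simp add: achar_0 sum.If_cases)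
    hence "complex_of_real (real (card P) * real (card V)) = of_real (real Q)" using ind[of 0] V(1) Q by (simp add: field_simps)
    thus ?thesis by (simp only: of_real_eq_iff)
  qed
  define v where "v = real (card V) / real Q"
  have Pv: "real (card P) * v = 1" using cardP Q by (simp add: v_def)
  have "of_real v * (\<Sum>c\<in>P. achar c x) = (if x \<in> V then 1 else 0)" for x
  proof -
    have "of_real v * (\<Sum>c\<in>P. achar c x) = (\<Sum>c\<in>UNIV. (if c \<in> P then of_nat (card V) / of_nat Q else 0) * achar c x)"
      by (simp add: v_def sum_distrib_left if_distrib[of "\<lambda>z. z * _"] sum.If_cases cong: if_cong)
    thus ?thesis by (simp only: ind)
  qed
  thus ?thesis
    using wiener_complement[where P = P and ?i0.0 = 0 and I = UNIV and A = UNIV and e = achar and h = "\<lambda>x. x \<in> V", OF _ _ _ Pv]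
      \<open>0 \<in> P\<close> achar_0_left by (simp add: v_def)
qed

end

section \<open>Mixed character sums of rational functions\<close>

context finite_field_chars
begin

lemma to_ac_hom: "field_hom (to_ac :: 'a \<Rightarrow> 'a alg_closure)"
  by unfold_locales auto

interpretation ac: field_hom "to_ac :: 'a \<Rightarrow> 'a alg_closure" by (rule to_ac_hom)
interpretation mac: field_hom "map_poly (to_ac :: 'a \<Rightarrow> 'a alg_closure)" by (rule ac.map_poly_hom)

abbreviation up :: "'a poly \<Rightarrow> 'a alg_closure poly" where "up \<equiv> map_poly to_ac"

lemma base_poly_up: "base_poly (up h)"
  by (simp add: base_poly_iff ac.coeff_map_poly_hom base_field_eq)

lemma base_poly_descend: assumes "base_poly h" shows "\<exists>c. h = up c"
proof
  show "h = up (map_poly of_ac h)"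
    using assms by (intro poly_eqI) (auto simp: ac.coeff_map_poly_hom coeff_map_poly base_poly_iff base_field_eq to_ac_of_ac)
qed

lemma up_dvd_iff: "up f dvd up g \<longleftrightarrow> f dvd g"
proof
  assume "up f dvd up g"
  then obtain r where r: "up g = up f * r" by auto
  show "f dvd g"
  proof (cases "f = 0")
    case True
    thus ?thesis using r mac.hom_inj[of g] by simp
  next
    case False
    hence "base_poly r" using r base_poly_up[of f] base_poly_up[of g] mac.hom_inj[of f] by (intro base_poly_cancel[of "up f" r]) auto
    then obtain c where "r = up c" using base_poly_descend by blast
    hence "up g = up (f * c)" using r by (simp add: mac.hom_mult)
    hence "g = f * c" by (simp add: mac.hom_eq_iff)
    thus ?thesis by simp
  qed
qed (auto elim!: dvdE simp: mac.hom_mult)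

lemma order_unit: "is_unit r \<Longrightarrow> order x (up r) = 0"
  by (auto simp: is_unit_poly_iff ac.map_poly_pCons_hom intro!: order_0I)

text \<open>The minimal polynomial of \<open>\<beta>\<close> is the product over its Frobenius orbit, so it has simple roots.\<close>

lemma minimal_polynomial:
  assumes "h \<noteq> 0" "poly (up h) \<beta> = 0"
  obtains c where "degree c > 0" "order \<beta> (up c) = 1" "\<And>f. f \<noteq> 0 \<Longrightarrow> poly (up f) \<beta> = 0 \<Longrightarrow> c dvd f"
proof -
  define h' where "h' = smult (inverse (lead_coeff h)) h"
  have "up h' \<in> monics (degree h)" "poly (up h') \<beta> = 0"
  proof -
    have "lead_coeff (up h') = 1" using assms(1) unfolding ac.lead_coeff_map_poly_hom by (simp add: h'_def)
    moreover have "degree (up h') = degree h" using assms(1) by (simp add: ac.degree_map_poly_hom h'_def)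
    ultimately show "up h' \<in> monics (degree h)" using base_poly_up[of h'] by (simp add: monics_def)
    show "poly (up h') \<beta> = 0" using assms(2) by (simp add: h'_def ac.map_poly_smult_hom)
  qed
  from orbit_exponent[OF this] obtain e where e: "e > 0" "\<beta> \<in> fixed_field e" "inj_on (\<lambda>i. \<beta> ^ Q ^ i) {..<e}"
    by metis
  obtain c where c: "orbit_poly e \<beta> = up c" using base_poly_descend[OF base_poly_orbit_poly[OF e(2)]] by blast
  have ord: "order y (orbit_poly e \<beta>) = (if y \<in> (\<lambda>i. \<beta> ^ Q ^ i) ` {..<e} then 1 else 0)" for y
    using order_cp_power[OF e(3), of y 1] by simp
  show ?thesis
  proof (rule that[of c])
    show "degree c > 0" using degree_orbit_poly[of e \<beta>] e(1) by (simp add: c ac.degree_map_poly_hom)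
    have "\<beta> \<in> (\<lambda>i. \<beta> ^ Q ^ i) ` {..<e}" using e(1) by (intro image_eqI[of _ _ 0]) auto
    thus "order \<beta> (up c) = 1" using ord[of \<beta>] by (simp add: c)
    fix f assume f: "f \<noteq> 0" "poly (up f) \<beta> = 0"
    have nz: "up f \<noteq> 0" using f mac.hom_inj by auto
    hence "order \<beta> (up f) \<ge> 1" using f(2) order_root[of "up f" \<beta>] by auto
    hence "order y (orbit_poly e \<beta>) \<le> order y (up f)" for y
      using base_poly_order_le[OF base_poly_up nz, of \<beta>] by (auto simp: ord intro: order.trans)
    hence "orbit_poly e \<beta> dvd up f" by (intro alg_closed_dvdI orbit_poly_nz)
    thus "c dvd f" by (simp add: c up_dvd_iff)
  qed
qed

text \<open>An irreducible \<open>g\<close> has simple roots over a finite field, so a root of it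
  has multiplicity exactly \<open>a\<close> in \<open>f1 * f2\<close>. Coprimality puts this zero
  into one of the two factors, and \<open>g \<noteq> [:0, 1:]\<close> keeps it away from 0.\<close>

lemma exact_power_order:
  fixes f1 f2 g :: "'a poly"
  assumes f: "f1 \<noteq> 0" "f2 \<noteq> 0" "coprime f1 f2"
    and g: "irreducible g" "lead_coeff g = 1" "g \<noteq> [:0, 1:]"
    and a: "a > 0" "g ^ a dvd f1 * f2" "\<not> g ^ (a + 1) dvd f1 * f2"
  obtains \<beta> where "\<beta> \<noteq> 0" "order \<beta> (up f1) = a \<and> order \<beta> (up f2) = 0 \<or> order \<beta> (up f1) = 0 \<and> order \<beta> (up f2) = a"
proof -
  have gnz: "g \<noteq> 0" using g by auto
  have "degree g > 0" using g(1) gnz by (metis irreducible_not_unit is_unit_iff_degree neq0_conv)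
  then obtain \<beta> where \<beta>: "poly (up g) \<beta> = 0"
    using alg_closed_imp_poly_has_root[of "up g"] by (auto simp: ac.degree_map_poly_hom)
  obtain c where c: "degree c > 0" "order \<beta> (up c) = 1"
    "\<And>f. f \<noteq> 0 \<Longrightarrow> poly (up f) \<beta> = 0 \<Longrightarrow> c dvd f"
    using minimal_polynomial[OF gnz \<beta>] by blast
  have cnu: "\<not> is_unit c" using c(1) by (auto simp: is_unit_poly_iff)
  obtain r where r: "g = c * r" using c(3)[OF gnz \<beta>] by auto
  hence ru: "is_unit r" using g(1) cnu Factorial_Ring.irreducibleD by blast
  have cnz: "c \<noteq> 0" "r \<noteq> 0" using r gnz by auto
  have "up c \<noteq> 0" "up r \<noteq> 0" using cnz by (simp_all add: mac.hom_eq_0_iff)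
  hence ordg: "order \<beta> (up g) = 1"
    using c(2) order_unit[OF ru] by (simp add: r mac.hom_mult order_mult)
  have "\<beta> \<noteq> 0"
  proof
    assume "\<beta> = 0"
    hence "poly g 0 = 0" using \<beta> ac.poly_map_poly_hom[of g 0] by simp
    hence "[:0, 1:] dvd g" using poly_eq_0_iff_dvd[of g 0] by simp
    then obtain s where s: "g = [:0, 1:] * s" by auto
    have "\<not> is_unit [:0, 1 :: 'a:]" by (simp add: is_unit_poly_iff)
    hence "is_unit s" using g(1) s Factorial_Ring.irreducibleD by blast
    then obtain k where k: "s = [:k:]" by (auto simp: is_unit_poly_iff)
    hence "g = [:0, k:]" using s by simp
    moreover have "k \<noteq> 0" using gnz calculation by auto
    ultimately have "g = [:0, 1:]" using g(2) by simp
    thus False using g(3) by simp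
  qed
  obtain s where s: "f1 * f2 = g ^ a * s" using a(2) by auto
  have snz: "s \<noteq> 0" using s f by auto
  have "poly (up s) \<beta> \<noteq> 0"
  proof
    assume "poly (up s) \<beta> = 0"
    hence "c dvd s" by (rule c(3)[OF snz])
    hence "g dvd s" using r ru by (simp add: mult_unit_dvd_iff)
    hence "g ^ a * g dvd f1 * f2" unfolding s by (intro mult_dvd_mono) auto
    thus False using a(3) by (simp add: mult.commute)
  qed
  moreover have "up g \<noteq> 0" "up s \<noteq> 0" using gnz snz by (simp_all add: mac.hom_eq_0_iff)
  ultimately have "order \<beta> (up (f1 * f2)) = a"
    unfolding s mac.hom_mult mac.hom_power by (simp add: order_mult order_power ordg order_0I)
  hence sum: "order \<beta> (up f1) + order \<beta> (up f2) = a"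
  proof -
    have "up f1 \<noteq> 0" "up f2 \<noteq> 0" using f by (simp_all add: mac.hom_eq_0_iff)
    thus ?thesis using \<open>order \<beta> (up (f1 * f2)) = a\<close> by (simp add: mac.hom_mult order_mult)
  qed
  have "order \<beta> (up f1) = 0 \<or> order \<beta> (up f2) = 0"
  proof (rule ccontr)
    assume "\<not> ?thesis"
    hence "poly (up f1) \<beta> = 0" "poly (up f2) \<beta> = 0" by (simp_all add: order_root)
    hence "c dvd f1" "c dvd f2" using c(3) f by auto
    thus False using f(3) cnu by (meson coprime_common_divisor)
  qed
  thus ?thesis using sum that[OF \<open>\<beta> \<noteq> 0\<close>] by auto
qed

section \<open>Reduction of a mixed sum to a single multiplicative character\<close>

definition good :: "'a poly \<Rightarrow> 'a poly \<Rightarrow> 'a set" where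
  "good f1 f2 = {x. x \<noteq> 0 \<and> poly f1 x \<noteq> 0 \<and> poly f2 x \<noteq> 0}"

definition mixed_sum :: "'a poly \<Rightarrow> 'a poly \<Rightarrow> nat \<Rightarrow> nat \<Rightarrow> 'a \<Rightarrow> complex" where
  "mixed_sum f1 f2 u v c = (\<Sum>x\<in>good f1 f2. mchar u x * mchar v (poly f1 x / poly f2 x) * achar c x)"

lemma card_bad:
  assumes "f1 \<noteq> 0" "f2 \<noteq> 0"
  shows "card (UNIV - good f1 f2) \<le> degree f1 + degree f2 + 1"
proof -
  have "UNIV - good f1 f2 = {x. poly ([:0, 1:] * f1 * f2) x = 0}" by (auto simp: good_def)
  moreover have "[:0, 1:] * f1 * f2 \<noteq> 0" using assms by simp
  moreover have "degree ([:0, 1:] * f1 * f2) = degree f1 + degree f2 + 1"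
    using assms by (simp add: degree_mult_eq del: mult_pCons_left)
  ultimately show ?thesis using card_poly_roots_bound by metis
qed

text \<open>With \<open>e = gcd N (gcd u v)\<close> both characters are powers of
  \<open>mchar e\<close>, which has exact order \<open>d = N div e\<close>. The product of the two
  becomes \<open>mchar e\<close> of the polynomial \<open>F0\<close>, to which the Weil bound
  applies.\<close>

lemma mixed_sum_bound:
  assumes f: "f1 \<noteq> 0" "f2 \<noteq> 0" "coprime f1 f2"
    and g: "irreducible g" "lead_coeff g = 1" "g \<noteq> [:0, 1:]"
    and a: "a > 0" "g ^ a dvd f1 * f2" "\<not> g ^ (a + 1) dvd f1 * f2" "coprime a N"
    and uv: "u < N" "v < N" "\<not> (u = 0 \<and> v = 0 \<and> c = 0)"
  shows "norm (mixed_sum f1 f2 u v c) \<le> real (degree f1 + degree f2 + 1) * sqrt (real Q)"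
proof (cases "u = 0 \<and> v = 0")
  case True
  hence c: "c \<noteq> 0" using uv by simp
  \<comment> \<open>The complete additive sum vanishes, so only the few excluded points are
    left.\<close>
  have "(\<Sum>x\<in>good f1 f2. achar c x) = (\<Sum>x\<in>UNIV. achar c x) - (\<Sum>x\<in>UNIV - good f1 f2. achar c x)"
    by (subst sum_diff) auto
  hence "norm (mixed_sum f1 f2 u v c) = norm (\<Sum>x\<in>UNIV - good f1 f2. achar c x)"
    using True c by (simp add: mixed_sum_def good_def mchar_zero sum_achar)
  also have "\<dots> \<le> (\<Sum>x\<in>UNIV - good f1 f2. norm (achar c x))" by (rule norm_sum)
  also have "\<dots> = real (card (UNIV - good f1 f2))" by (simp add: norm_achar)
  also have "\<dots> \<le> real (degree f1 + degree f2 + 1)" using card_bad[OF f(1,2)] by (simp only: of_nat_le_iff)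
  also have "\<dots> \<le> real (degree f1 + degree f2 + 1) * sqrt (real Q)"
    using mult_left_mono[of 1 "sqrt (real Q)" "real (degree f1 + degree f2 + 1)"] Q_gt_1' by simp
  finally show ?thesis .
next
  case False
  define e where "e = gcd N (gcd u v)"
  define d where "d = N div e"
  have e: "e dvd N" "e dvd u" "e dvd v" "e > 0" using N_pos by (auto simp: e_def intro: dvd_trans)
  have Nde: "N = e * d" using e by (simp add: d_def)
  have d0: "d > 0" using Nde N_pos by (cases d) auto
  have "d \<noteq> 1"
  proof
    assume "d = 1"
    hence "N dvd u" "N dvd v" using Nde e by auto
    thus False using uv False by (auto dest: dvd_imp_le)
  qed
  hence d2: "d \<ge> 2" using d0 by simp
  \<comment> \<open>The exponent \<open>d\<close> in place of 0 keeps the character trivial on units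
    but makes \<open>F0\<close> vanish at 0, so that the complete sum has no terms outside
    \<open>good f1 f2\<close>; likewise for \<open>v'\<close>.\<close>
  define u' where "u' = (if u = 0 then d else u div e)"
  define v' where "v' = (if v = 0 then d else v div e)"
  have u': "u' > 0" using e d0 by (auto simp: u'_def dvd_div_eq_0_iff intro!: Nat.gr0I)
  have v': "v' > 0" using e d0 by (auto simp: v'_def dvd_div_eq_0_iff intro!: Nat.gr0I)
  have "v' \<le> d" using Nde e uv by (auto simp: v'_def d_def div_le_mono)
  have mu: "mchar u x = mchar (e * u') x" if "x \<noteq> 0" for x
    using e that by (auto simp: u'_def Nde [symmetric] mchar_zero mchar_N)
  have mv: "mchar v x = mchar (e * v') x" if "x \<noteq> 0" for x
    using e that by (auto simp: v'_def Nde [symmetric] mchar_zero mchar_N)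
  have gcd1: "\<exists>x\<in>{u', v'}. \<not> l dvd x" if l: "prime l" "l dvd d" for l
  proof (rule ccontr)
    assume "\<not> ?thesis"
    hence "l dvd u'" "l dvd v'" by auto
    hence "e * l dvd u" "e * l dvd v" using e by (auto simp: u'_def v'_def dvd_mult_imp_div mult_dvd_mono div_dvd_iff_mult split: if_splits elim!: dvdE)
    moreover have "e * l dvd N" using l Nde by (simp add: mult_dvd_mono)
    ultimately have "e * l dvd e" unfolding e_def by simp
    thus False using e(4) l(1) by (auto dest: dvd_imp_le prime_gt_1_nat)
  qed
  \<comment> \<open>The last exponent represents \<open>- v'\<close> modulo \<open>d\<close>. As
    \<open>v'\<close> may equal \<open>d\<close>, only \<open>2 * d - v'\<close> is sure to be
    positive.\<close>
  define F0 where "F0 = [:0, 1:] ^ u' * f1 ^ v' * f2 ^ (2 * d - v')"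
  \<comment> \<open>The modulus need only vanish at the zeros of \<open>F0\<close>, so its degree
    does not grow with the exponents.\<close>
  define M0 where "M0 = [:0, 1:] * f1 * f2"
  have M0: "M0 \<noteq> 0" "degree M0 = degree f1 + degree f2 + 1"
    using f by (simp_all add: M0_def degree_mult_eq del: mult_pCons_left)
  define M1 where "M1 = smult (inverse (lead_coeff M0)) M0"
  have M1: "lead_coeff M1 = 1" "degree M1 = degree f1 + degree f2 + 1" proof -
    have "lead_coeff M0 \<noteq> 0" using M0(1) by (simp only: leading_coeff_0_iff) simp
    thus "lead_coeff M1 = 1" "degree M1 = degree f1 + degree f2 + 1"
      unfolding M1_def lead_coeff_smult degree_smult_eq using M0(2) by auto
  qed
  have F0: "F0 \<noteq> 0" using f by (simp add: F0_def)
  have nz: "up [:0, 1:] \<noteq> 0" "up f1 \<noteq> 0" "up f2 \<noteq> 0"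
    using f by (simp_all add: mac.hom_eq_0_iff)
  have upX: "up [:0, 1:] = [:0, 1:]" by (simp add: ac.map_poly_pCons_hom)
  have ordF: "order b (up F0) = u' * order b [:0, 1:] + v' * order b (up f1) + (2 * d - v') * order b (up f2)" for b
    using nz unfolding F0_def mac.hom_mult mac.hom_power
    by (subst order_mult, simp, subst order_mult, simp) (simp add: order_power upX)
  interpret w: weil Q t "TYPE('a alg_closure)" "up F0" "up M1" "\<lambda>y. mchar e (of_ac y)"
    "range (\<lambda>c y. achar c (of_ac y))" d
  proof
    show "base_poly (up F0)" "base_poly (up M1)" by (rule base_poly_up)+
    show "up F0 \<noteq> 0" using F0 mac.hom_inj by auto
    show "lead_coeff (up M1) = 1" using M1 by (simp only: ac.lead_coeff_map_poly_hom ac.hom_one)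
    show "0 < degree (up M1)" using M1 by (simp add: ac.degree_map_poly_hom)
    show "poly (up M1) x = 0" if "poly (up F0) x = 0" for x
      using that by (auto simp: F0_def M1_def M0_def mac.hom_mult mac.hom_power ac.map_poly_smult_hom simp del: mult_pCons_left)
    show "d \<ge> 2" by (rule d2)
    show "d dvd Q - 1" using Nde by (simp add: N_def)
    \<comment> \<open>If \<open>l\<close> divided all orders, the one at \<beta> would give
      \<open>l dvd v'\<close>, since \<open>a\<close> is prime to \<open>N\<close>. Then the order
      at 0 gives \<open>l dvd u'\<close>, contradicting \<open>gcd1\<close>.\<close>
    show "\<exists>b. \<not> l dvd order b (up F0)" if l: "prime l" "l dvd d" for l
    proof (rule ccontr)
      assume "\<not> ?thesis"
      hence all: "l dvd order b (up F0)" for b by blast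
      obtain \<beta> where \<beta>: "\<beta> \<noteq> 0" "order \<beta> (up f1) = a \<and> order \<beta> (up f2) = 0 \<or> order \<beta> (up f1) = 0 \<and> order \<beta> (up f2) = a"
        using exact_power_order[OF f g a(1,2,3)] by blast
      have "order \<beta> [:0, 1:] = 0" using \<beta>(1) by (intro order_0I) simp
      hence "l dvd v' * a \<or> l dvd (2 * d - v') * a" using all[of \<beta>] \<beta>(2) by (auto simp: ordF)
      moreover have "\<not> l dvd a"
        using l Nde a(4) coprime_common_divisor[of a N l] by auto
      ultimately have "l dvd v' \<or> l dvd 2 * d - v'" using l(1) by (auto simp: prime_dvd_mult_iff)
      moreover have "l dvd 2 * d" using l(2) by simp
      ultimately have lv: "l dvd v'" using \<open>v' \<le> d\<close> by (metis dvd_diffD1 le_trans mult_2 le_add1)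
      have "l dvd 2 * d - v'" using lv \<open>l dvd 2 * d\<close> by (rule dvd_diff_nat[rotated])
      have "order 0 [:0, 1 :: 'a alg_closure:] = 1" using order_linear_factor_same[of "0 :: 'a alg_closure"] by simp
      hence "l dvd u' + v' * order 0 (up f1) + (2 * d - v') * order 0 (up f2)" using all[of 0] by (simp add: ordF)
      hence "l dvd u'" using lv \<open>l dvd 2 * d - v'\<close> by (simp add: dvd_add_left_iff)
      thus False using gcd1[OF l] lv by auto
    qed
    show "mchar e (of_ac (x * y)) = mchar e (of_ac x) * mchar e (of_ac y)" if xy: "x \<in> base_field" "y \<in> base_field" for x y
    proof -
      obtain x' y' where "x = to_ac x'" "y = to_ac y'" using xy by (auto simp: base_field_eq)
      thus ?thesis by (simp add: mchar_mult flip: to_ac_mult)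
    qed
    show "mchar e (of_ac 0) = 0" by simp
    show "(mchar e (of_ac x) = 1) = (x ^ ((Q - 1) div d) = 1)" if x: "x \<in> base_field" "x \<noteq> 0" for x
    proof -
      obtain x' where x': "x = to_ac x'" using x by (auto simp: base_field_eq)
      have "(Q - 1) div d = e" using Nde d0 by (simp add: N_def)
      moreover have "x' \<noteq> 0" using x x' by auto
      ultimately show ?thesis using mchar_eq_1_iff[OF _ e(1), of x'] by (simp add: x' flip: to_ac_power)
    qed
    show "finite (range (\<lambda>c y. achar c (of_ac y)))" by simp
    fix \<psi> assume "\<psi> \<in> range (\<lambda>c y. achar c (of_ac y))"
    then obtain c where psi: "\<psi> = (\<lambda>y. achar c (of_ac y))" by auto
    show "\<psi> 0 = 1" by (simp add: psi achar_0)
    show "\<psi> (x + y) = \<psi> x * \<psi> y" if xy: "x \<in> base_field" "y \<in> base_field" for x y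
    proof -
      obtain x' y' where "x = to_ac x'" "y = to_ac y'" using xy by (auto simp: base_field_eq)
      thus ?thesis by (simp add: psi achar_add flip: to_ac_add)
    qed
  next
    show "(\<Sum>\<psi>\<in>range (\<lambda>c y. achar c (of_ac y)). \<psi> x) = (if x = 0 then of_nat Q else 0)" if "x \<in> base_field" for x
    proof -
      obtain x' where x': "x = to_ac x'" using \<open>x \<in> base_field\<close> by (auto simp: base_field_eq)
      have "inj (\<lambda>c y. achar c (of_ac y))"
      proof (rule injI)
        fix c c' :: 'a assume eq: "(\<lambda>y. achar c (of_ac y)) = (\<lambda>y. achar c' (of_ac y))"
        have "achar c x = achar c' x" for x using fun_cong[OF eq, of "to_ac x"] by simp
        thus "c = c'" using inj_achar by (auto simp: inj_def fun_eq_iff)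
      qed
      hence "(\<Sum>\<psi>\<in>range (\<lambda>c y. achar c (of_ac y)). \<psi> x) = (\<Sum>c\<in>UNIV. achar c x')"
        by (subst sum.reindex) (auto simp: x')
      thus ?thesis by (simp add: sum_achar_left x')
    qed
  qed
  have "mixed_sum f1 f2 u v c = (\<Sum>x\<in>UNIV. mchar e (poly F0 x) * achar c x)"
  proof -
    have "(\<Sum>x\<in>UNIV. mchar e (poly F0 x) * achar c x) = (\<Sum>x\<in>good f1 f2. mchar e (poly F0 x) * achar c x)"
    proof (rule sum.mono_neutral_right)
      show "\<forall>x\<in>UNIV - good f1 f2. mchar e (poly F0 x) * achar c x = 0"
        using u' v' \<open>v' \<le> d\<close> d0 by (auto simp: good_def F0_def power_0_left)
    qed auto
    also have "\<dots> = mixed_sum f1 f2 u v c"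
      unfolding mixed_sum_def
    proof (intro sum.cong refl)
      fix x assume "x \<in> good f1 f2"
      hence x: "x \<noteq> 0" "poly f1 x \<noteq> 0" "poly f2 x \<noteq> 0" by (auto simp: good_def)
      have "mchar e (poly f2 x) ^ (2 * d - v') * mchar e (poly f2 x) ^ v' = mchar e (poly f2 x) ^ (2 * d)"
        using \<open>v' \<le> d\<close> by (simp flip: power_add)
      also have "\<dots> = 1" using x mchar_N[of "poly f2 x" "e * (2 * d)"] by (simp add: mchar_power Nde)
      finally have f2: "mchar e (poly f2 x) ^ (2 * d - v') * mchar v (poly f2 x) = 1"
        using x by (simp add: mv mchar_power)
      have "mchar v (poly f1 x / poly f2 x) * mchar v (poly f2 x) = mchar v (poly f1 x)"
        using x by (simp flip: mchar_mult)
      hence "mchar v (poly f1 x / poly f2 x) * (mchar e (poly f2 x) ^ (2 * d - v') * mchar v (poly f2 x))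
          = mchar v (poly f1 x) * mchar e (poly f2 x) ^ (2 * d - v')"
        by (simp add: mult_ac)
      hence "mchar v (poly f1 x / poly f2 x) = mchar v (poly f1 x) * mchar e (poly f2 x) ^ (2 * d - v')"
        by (simp only: f2 mult_1_right)
      moreover have "mchar e (poly F0 x) = mchar u x * mchar v (poly f1 x) * mchar e (poly f2 x) ^ (2 * d - v')"
        using x by (simp add: F0_def mchar_mult mchar_power_arg mu mv mchar_power)
      ultimately show "mchar e (poly F0 x) * achar c x = mchar u x * mchar v (poly f1 x / poly f2 x) * achar c x"
        by simp
    qed
    finally show ?thesis ..
  qed
  also have "\<dots> = (\<Sum>y\<in>base_field. mchar e (of_ac (poly (up F0) y)) ^ 1 * achar c (of_ac y))"
    unfolding base_field_eq by (subst sum.reindex) (auto simp: inj_to_ac ac.poly_map_poly_hom)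
  also have "norm \<dots> \<le> real (degree (up M1)) * sqrt (real Q)"
    using w.weil_bound[of 1 "\<lambda>y. achar c (of_ac y)"] d2 by auto
  finally show ?thesis by (simp only: ac.degree_map_poly_hom M1(2))
qed

end

section \<open>Normal elements\<close>

lemma monic_irreducible_factor:
  fixes s :: "'k :: field poly"
  assumes "degree s > 0"
  obtains h where "irreducible h" "lead_coeff h = 1" "h dvd s"
proof -
  define P where "P m \<longleftrightarrow> (\<exists>h. h dvd s \<and> degree h = m \<and> m > 0)" for m
  have "P (degree s)" unfolding P_def using assms by (intro exI[of _ s]) auto
  define m where "m = (LEAST m. P m)"
  have "P m" unfolding m_def by (rule LeastI) fact
  then obtain h where h: "h dvd s" "degree h = m" "m > 0" by (auto simp: P_def)
  have hnz: "h \<noteq> 0" using h by auto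
  have min: "m \<le> degree a" if "a dvd s" "degree a > 0" for a
    unfolding m_def by (rule Least_le) (use that in \<open>auto simp: P_def\<close>)
  have irr: "irreducible h"
  proof (rule Factorial_Ring.irreducibleI)
    show "\<not> is_unit h" using h by (auto simp: is_unit_poly_iff)
    fix a b assume ab: "h = a * b"
    hence nz: "a \<noteq> 0" "b \<noteq> 0" using hnz by auto
    have deg: "degree a + degree b = m" using ab nz h by (simp add: degree_mult_eq)
    have dvd: "a dvd s" "b dvd s" using h(1) ab dvd_mult_left dvd_mult_right by blast+
    show "is_unit a \<or> is_unit b"
    proof (cases "degree a = 0")
      case True
      thus ?thesis using nz by (auto simp: is_unit_iff_degree)
    next
      case False
      hence "degree b = 0" using min[OF dvd(1)] deg by simp
      thus ?thesis using nz by (auto simp: is_unit_iff_degree)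
    qed
  qed (fact hnz)
  define h' where "h' = smult (inverse (lead_coeff h)) h"
  have lc: "lead_coeff h \<noteq> 0" using hnz by simp
  have eq: "h = smult (lead_coeff h) h'" using lc by (simp add: h'_def)
  show ?thesis
  proof (rule that[of h'])
    have "h' = [:inverse (lead_coeff h):] * h" by (simp add: h'_def)
    moreover have "is_unit [:inverse (lead_coeff h):]" using lc by (simp add: is_unit_const_poly_iff dvd_field_iff)
    ultimately show "irreducible h'" using irr by (simp only: irreducible_mult_unit_left)
    show "lead_coeff h' = 1" using lc unfolding h'_def lead_coeff_smult by simp
    show "h' dvd s" using h(1) lc by (simp add: h'_def smult_dvd_iff)
  qed
qed

lemma monic_irreducible_dvd_eq:
  fixes h h' :: "'k :: field poly"
  assumes "irreducible h" "irreducible h'" "lead_coeff h = 1" "lead_coeff h' = 1" "h dvd h'"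
  shows "h = h'"
proof -
  obtain r where r: "h' = h * r" using assms(5) by auto
  have "is_unit r" using assms(1,2) r Factorial_Ring.irreducibleD[OF assms(2) r] irreducible_not_unit by blast
  then obtain k where "r = [:k:]" by (auto simp: is_unit_poly_iff)
  hence "h' = smult k h" using r by simp
  moreover from this have "k = 1" using assms(3,4) by (metis lead_coeff_smult mult.right_neutral)
  ultimately show ?thesis by simp
qed

lemma irreducible_dvd_prod:
  fixes h :: "'k :: field poly"
  assumes "irreducible h" "finite T" "h dvd \<Prod>T"
  shows "\<exists>h'\<in>T. h dvd h'"
  using assms(2,3)
proof (induction T rule: finite_induct)
  case empty
  thus ?case using assms(1) irreducible_not_unit by auto
next
  case (insert x T)
  have "prime_elem h" using assms(1) by (rule field_poly_irreducible_imp_prime)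
  hence "h dvd x \<or> h dvd \<Prod>T" using insert by (simp add: prime_elem_dvd_mult_iff)
  thus ?case using insert by auto
qed

lemma prod_irreducible_dvd:
  fixes s :: "'k :: field poly"
  assumes "finite T" "\<And>h. h \<in> T \<Longrightarrow> irreducible h \<and> lead_coeff h = 1 \<and> h dvd s"
  shows "\<Prod>T dvd s"
  using assms
proof (induction T rule: finite_induct)
  case (insert h T)
  then obtain w where w: "s = \<Prod>T * w" by auto
  have irr: "irreducible h" using insert.prems by simp
  have "\<not> h dvd \<Prod>T"
  proof
    assume "h dvd \<Prod>T"
    then obtain h' where "h' \<in> T" "h dvd h'" using irreducible_dvd_prod[OF irr insert.hyps(1)] by auto
    hence "h = h'" using monic_irreducible_dvd_eq insert.prems by blast
    thus False using \<open>h' \<in> T\<close> insert.hyps by simp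
  qed
  moreover have "h dvd \<Prod>T * w" using insert.prems w by auto
  ultimately have "h dvd w"
    using field_poly_irreducible_imp_prime[OF irr] by (simp add: prime_elem_dvd_mult_iff)
  thus ?case using insert w by (auto elim!: dvdE simp: mult_ac)
qed auto

section \<open>Square-free divisors from sets of irreducible factors\<close>

definition monic_factors :: "'k :: field poly \<Rightarrow> 'k poly set" where
  "monic_factors P = {h. irreducible h \<and> lead_coeff h = 1 \<and> h dvd P}"

lemma finite_bounded_degree: "finite {h :: 'k :: {field, finite} poly. degree h \<le> D}"
proof (rule finite_subset)
  show "{h :: 'k poly. degree h \<le> D} \<subseteq> Poly ` {xs. set xs \<subseteq> UNIV \<and> length xs \<le> Suc D}"
  proof
    fix h :: "'k poly" assume "h \<in> {h. degree h \<le> D}"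
    hence "length (coeffs h) \<le> Suc D" by (auto simp: coeffs_def)
    thus "h \<in> Poly ` {xs. set xs \<subseteq> UNIV \<and> length xs \<le> Suc D}"
      by (intro image_eqI[of _ _ "coeffs h"]) auto
  qed
  show "finite (Poly ` {xs :: 'k list. set xs \<subseteq> UNIV \<and> length xs \<le> Suc D})"
    using finite_lists_length_le[of "UNIV :: 'k set"] by simp
qed

lemma finite_divisors:
  assumes "(P :: 'k :: {field, finite} poly) \<noteq> 0" shows "finite {d. d dvd P}"
  by (rule finite_subset[OF _ finite_bounded_degree[of "degree P"]])
     (use assms dvd_imp_degree_le in auto)

text \<open>By unique factorization, different sets of monic irreducible factors have different
  products, each a square-free divisor.\<close>

lemma W_poly_ge:
  assumes "(P :: 'k :: {field, finite} poly) \<noteq> 0"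
  shows "2 ^ card (monic_factors P) \<le> W_poly P"
proof -
  have fin: "finite (monic_factors P)"
    by (rule finite_subset[OF _ finite_divisors[OF assms]]) (auto simp: monic_factors_def)
  have finT: "finite T" if "T \<subseteq> monic_factors P" for T using that fin finite_subset by blast
  have mem: "h \<in> T" if T: "T \<subseteq> monic_factors P" "irreducible h" "lead_coeff h = 1" "h dvd \<Prod>T" for h T
  proof -
    obtain h' where "h' \<in> T" "h dvd h'" using irreducible_dvd_prod[OF T(2) finT[OF T(1)] T(4)] by auto
    hence "h = h'" using T by (intro monic_irreducible_dvd_eq) (auto simp: monic_factors_def)
    thus ?thesis using \<open>h' \<in> T\<close> by simp
  qed
  have "inj_on Prod (Pow (monic_factors P))"
  proof (rule inj_onI)
    fix T U assume TU: "T \<in> Pow (monic_factors P)" "U \<in> Pow (monic_factors P)" "\<Prod>T = \<Prod>U"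
    have sub: "T \<subseteq> U" if "T \<subseteq> monic_factors P" "U \<subseteq> monic_factors P" "\<Prod>T = \<Prod>U" for T U
    proof
      fix h assume "h \<in> T"
      hence "h dvd \<Prod>T" using finT[OF that(1)] by (intro dvd_prodI[of T h "\<lambda>x. x"]) auto
      thus "h \<in> U" using that \<open>h \<in> T\<close> by (intro mem) (auto simp: monic_factors_def)
    qed
    have "T \<subseteq> U" by (rule sub) (use TU in auto)
    moreover have "U \<subseteq> T" by (rule sub) (use TU in auto)
    ultimately show "T = U" by simp
  qed
  moreover have "Prod ` Pow (monic_factors P) \<subseteq> {d. lead_coeff d = 1 \<and> squarefree d \<and> d dvd P}"
  proof
    fix d assume "d \<in> Prod ` Pow (monic_factors P)"
    then obtain T where T: "T \<subseteq> monic_factors P" "d = \<Prod>T" by auto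
    have "lead_coeff d = 1" unfolding T(2) lead_coeff_prod using T(1) by (intro prod.neutral) (auto simp: monic_factors_def)
    moreover have "d dvd P" unfolding T(2) by (rule prod_irreducible_dvd[OF finT[OF T(1)]]) (use T in \<open>auto simp: monic_factors_def\<close>)
    moreover have "squarefree d"
    proof (rule squarefreeI)
      fix y assume y: "y ^ 2 dvd d"
      show "is_unit y"
      proof (rule ccontr)
        assume nu: "\<not> is_unit y"
        have dnz: "d \<noteq> 0" using \<open>lead_coeff d = 1\<close> by auto
        hence "y \<noteq> 0" using y by auto
        hence "degree y > 0" using nu by (auto simp: is_unit_iff_degree)
        then obtain h where h: "irreducible h" "lead_coeff h = 1" "h dvd y" by (rule monic_irreducible_factor)
        have "h * h dvd d" using h(3) y by (metis dvd_trans mult_dvd_mono power2_eq_square)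
        hence "h \<in> T" using T h by (intro mem) (auto dest: dvd_mult_left)
        hence "d = h * \<Prod>(T - {h})" using finT[OF T(1)] T(2) by (simp add: prod.remove[of T h])
        hence "h dvd \<Prod>(T - {h})" using \<open>h * h dvd d\<close> h(1) by (auto simp: irreducible_def)
        hence "h \<in> T - {h}" using T h by (intro mem) auto
        thus False by simp
      qed
    qed
    ultimately show "d \<in> {d. lead_coeff d = 1 \<and> squarefree d \<and> d dvd P}" by simp
  qed
  moreover have "finite {d. lead_coeff d = 1 \<and> squarefree d \<and> d dvd P}"
    by (rule finite_subset[OF _ finite_divisors[OF assms]]) auto
  ultimately have "card (Pow (monic_factors P)) \<le> card {d. lead_coeff d = 1 \<and> squarefree d \<and> d dvd P}"
    by (rule card_inj_on_le)
  thus ?thesis using fin by (simp add: card_Pow W_poly_def)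
qed

lemma W_ge:
  assumes "N > 0" shows "2 ^ card (prime_factors N) \<le> W N"
proof -
  have finT: "finite T" if "T \<subseteq> prime_factors N" for T using that finite_subset by blast
  have pr: "prime l" if "T \<subseteq> prime_factors N" "l \<in> T" for T l using that by auto
  have mem: "l \<in> T" if T: "T \<subseteq> prime_factors N" "prime l" "l dvd \<Prod>T" for l T
  proof -
    obtain l' where "l' \<in> T" "l dvd l'" using T finT[OF T(1)] by (auto simp: prime_dvd_prod_iff)
    thus ?thesis using primes_dvd_imp_eq[of l l'] pr[OF T(1)] T by auto
  qed
  have "inj_on Prod (Pow (prime_factors N))"
  proof (rule inj_onI)
    fix T U assume TU: "T \<in> Pow (prime_factors N)" "U \<in> Pow (prime_factors N)" "\<Prod>T = \<Prod>U"
    have sub: "T \<subseteq> U" if "T \<subseteq> prime_factors N" "U \<subseteq> prime_factors N" "\<Prod>T = \<Prod>U" for T U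
    proof
      fix l assume "l \<in> T"
      hence "l dvd \<Prod>T" using finT[OF that(1)] by (intro dvd_prodI[of T l "\<lambda>x. x"]) auto
      thus "l \<in> U" using that \<open>l \<in> T\<close> pr by (intro mem) auto
    qed
    have "T \<subseteq> U" by (rule sub) (use TU in auto)
    moreover have "U \<subseteq> T" by (rule sub) (use TU in auto)
    ultimately show "T = U" by simp
  qed
  moreover have "Prod ` Pow (prime_factors N) \<subseteq> {d. d dvd N \<and> squarefree d}"
  proof
    fix d assume "d \<in> Prod ` Pow (prime_factors N)"
    then obtain T where T: "T \<subseteq> prime_factors N" "d = \<Prod>T" by auto
    have "squarefree d" unfolding T(2)
      using T(1) by (intro squarefree_prod_coprime) (auto intro: squarefree_prime primes_coprime)
    moreover have "\<Prod>T dvd N"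
      using finT[OF T(1)] T(1)
    proof (induction T rule: finite_induct)
      case (insert l T)
      have "coprime l (\<Prod>T)"
      proof (rule ccontr)
        assume "\<not> coprime l (\<Prod>T)"
        moreover have "prime l" using insert.prems by auto
        ultimately have "l dvd \<Prod>T" using prime_imp_coprime[of l "\<Prod>T"] by blast
        thus False using mem[of T l] insert by auto
      qed
      thus ?case using insert by (auto intro!: divides_mult)
    qed auto
    ultimately show "d \<in> {d. d dvd N \<and> squarefree d}" using T by simp
  qed
  moreover have "finite {d. d dvd N \<and> squarefree d}"
    using assms by (intro finite_subset[OF _ finite_divisors_nat[of N]]) auto
  ultimately have "card (Pow (prime_factors N)) \<le> card {d. d dvd N \<and> squarefree d}"
    by (rule card_inj_on_le)
  thus ?thesis by (simp add: card_Pow W_def)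
qed

section \<open>The field as an F_q[X]-module under the Frobenius\<close>

locale finite_extension = finite_field_chars \<gamma> Q p t for \<gamma> :: "'a :: {field, finite}" and Q p t +
  fixes \<iota> :: "'k :: {field, finite} \<Rightarrow> 'a" and q n :: nat
  assumes emb: "field_embedding \<iota>" and q: "q = CARD('k)" and Qq: "Q = q ^ n" and n: "n > 0"
begin

sublocale io: field_hom \<iota>
proof
  fix x assume x: "\<iota> x = 0"
  show "x = 0"
  proof (rule ccontr)
    assume "x \<noteq> 0"
    hence "\<iota> 1 = \<iota> x * \<iota> (inverse x)" using emb by (simp add: field_embedding_def flip: right_inverse)
    thus False using x emb by (simp add: field_embedding_def)
  qed
qed (use emb in \<open>simp_all add: field_embedding_def\<close>)

lemma q_gt_1: "q > 1"
proof -
  have "card {0, 1 :: 'k} \<le> CARD('k)" by (intro card_mono) auto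
  thus ?thesis by (simp add: q)
qed

lemma q_power: obtains s where "q = p ^ s"
proof -
  have "q dvd p ^ t" using card Qq n by (metis dvd_power)
  thus ?thesis using that p by (auto simp: divides_primepow_nat)
qed

lemma q_add: "(x + y :: 'a) ^ q ^ i = x ^ q ^ i + y ^ q ^ i"
proof -
  obtain s where "q = p ^ s" by (rule q_power)
  thus ?thesis using p_add[of x y "s * i"] by (simp add: power_mult)
qed

lemma q_io: "\<iota> c ^ q ^ i = \<iota> c"
proof (induction i)
  case (Suc i)
  have "\<iota> c ^ q ^ Suc i = (\<iota> c ^ q ^ i) ^ q" by (simp add: mult.commute flip: power_mult)
  also have "\<dots> = \<iota> (c ^ q)" by (simp add: Suc io.hom_power)
  finally show ?case using finite_field_power_card[of c] by (simp add: q)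
qed auto

text \<open>The module structure in which \<open>X\<close> acts as the q-th power map; as a function
  of \<open>x\<close> this is the linearized polynomial attached to \<open>r\<close>.\<close>

definition act :: "'k poly \<Rightarrow> 'a \<Rightarrow> 'a" where
  "act r x = (\<Sum>i\<le>degree r. \<iota> (coeff r i) * x ^ q ^ i)"

lemma act_bound: "degree r \<le> m \<Longrightarrow> act r x = (\<Sum>i\<le>m. \<iota> (coeff r i) * x ^ q ^ i)"
  unfolding act_def by (rule sum.mono_neutral_left) (auto simp: coeff_eq_0 io.hom_zero)

lemma act_add_poly: "act (r + s) x = act r x + act s x"
proof -
  define m where "m = max (degree r) (degree s)"
  have "degree (r + s) \<le> m" unfolding m_def by (rule degree_add_le_max)
  thus ?thesis using act_bound[of r m] act_bound[of s m] act_bound[of "r + s" m]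
    by (simp add: m_def io.hom_add distrib_right sum.distrib)
qed

lemma act_smult: "act (smult c r) x = \<iota> c * act r x"
  using act_bound[of "smult c r" "degree r"] by (simp add: act_def io.hom_mult sum_distrib_left mult.assoc degree_smult_le)

lemma act_0_poly [simp]: "act 0 x = 0" by (simp add: act_def io.hom_zero)

lemma act_0 [simp]: "act r 0 = 0"
  using q_gt_1 by (simp add: act_def power_0_left)

lemma act_pCons: "act (pCons c r) x = \<iota> c * x + act r (x ^ q)"
proof -
  have "act (pCons c r) x = (\<Sum>i\<le>Suc (degree r). \<iota> (coeff (pCons c r) i) * x ^ q ^ i)"
    by (rule act_bound) (simp add: degree_pCons_le)
  also have "\<dots> = \<iota> c * x + (\<Sum>i\<le>degree r. \<iota> (coeff r i) * x ^ q ^ Suc i)"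
    by (subst sum.atMost_Suc_shift) simp
  finally show ?thesis by (simp add: act_def flip: power_mult)
qed

lemma act_add: "act r (x + y) = act r x + act r y"
  by (simp add: act_def q_add distrib_left sum.distrib)

lemma act_minus: "act r (- x) = - act r x"
  using act_add[of r x "- x"] by (simp add: eq_neg_iff_add_eq_0 add.commute)

lemma act_diff: "act r (x - y) = act r x - act r y"
  using act_add[of r x "- y"] by (simp add: act_minus)

lemma act_frob: "act r (x ^ q) = act r x ^ q"
proof -
  obtain s where s: "q = p ^ s" by (rule q_power)
  have "act r x ^ q = (\<Sum>i\<le>degree r. (\<iota> (coeff r i) * x ^ q ^ i) ^ q)"
    unfolding act_def by (rule freshmans_dream_sum'[of _ s]) (simp_all add: CHAR_p p s)
  also have "\<dots> = act r (x ^ q)"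
    unfolding act_def using q_io[of _ 1]
    by (intro sum.cong) (simp_all add: power_mult_distrib mult.commute flip: power_mult)
  finally show ?thesis ..
qed

lemma act_mult: "act (r * s) x = act r (act s x)"
proof (induction r arbitrary: x)
  case (pCons c r)
  have "act (pCons c r * s) x = act (smult c s) x + act (pCons 0 (r * s)) x"
    by (simp add: act_add_poly)
  also have "act (pCons 0 (r * s)) x = act (r * s) (x ^ q)" by (simp add: act_pCons io.hom_zero)
  also have "\<dots> = act r (act s x ^ q)" using pCons.IH by (simp add: act_frob)
  finally show ?case by (simp add: act_smult act_pCons)
qed auto

definition XP :: "'k poly" where "XP = monom 1 n - 1"

lemma degree_XP: "degree XP = n"
  unfolding XP_def by (subst diff_conv_add_uminus, subst degree_add_eq_left) (use n in \<open>auto simp: degree_monom_eq\<close>)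

lemma XP_nz: "XP \<noteq> 0" using degree_XP n by auto

lemma act_XP: "act XP x = 0"
proof -
  have "act (monom 1 n) x = x ^ q ^ n"
    using act_bound[of "monom 1 n" n x]
    by (simp add: degree_monom_le if_distrib[of \<iota>] if_distrib[of "\<lambda>a. a * _"] io.hom_zero io.hom_one cong: if_cong)
  moreover have "act (- 1) x = - x" by (simp add: act_def io.hom_minus io.hom_one)
  ultimately show ?thesis
    using act_add_poly[of "monom 1 n" "- 1" x] power_Q[of x] by (simp add: XP_def Qq)
qed

definition Ker :: "'k poly \<Rightarrow> 'a set" where "Ker r = {x. act r x = 0}"

lemma card_Ker_le:
  assumes "r \<noteq> 0" shows "card (Ker r) \<le> q ^ degree r"
proof -
  define L where "L = (\<Sum>i\<le>degree r. monom (\<iota> (coeff r i)) (q ^ i))"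
  have L: "poly L x = act r x" for x by (simp add: L_def poly_sum poly_monom act_def)
  have "coeff L (q ^ degree r) = (\<Sum>i\<le>degree r. if i = degree r then \<iota> (lead_coeff r) else 0)"
    unfolding L_def coeff_sum using q_gt_1 by (intro sum.cong) (auto simp: power_inject_exp)
  hence "L \<noteq> 0" using assms by (auto simp: io.hom_eq_0_iff)
  moreover have "degree L \<le> q ^ degree r" unfolding L_def
    by (intro degree_sum_le order.trans[OF degree_monom_le] power_increasing) (use q_gt_1 in auto)
  ultimately show ?thesis using card_poly_roots_bound[of L] by (simp add: Ker_def L)
qed

text \<open>With \<open>XP = r * s\<close>, the image of \<open>act s\<close> lies in
  \<open>Ker r\<close> and its fibres have at most \<open>q ^ degree s\<close> elements. As the
  whole field has \<open>q ^ n\<close> elements, the upper bound for \<open>Ker r\<close> is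
  attained.\<close>

lemma card_Ker:
  assumes "r dvd XP" shows "card (Ker r) = q ^ degree r"
proof -
  obtain s where s: "XP = r * s" using assms by auto
  have nz: "r \<noteq> 0" "s \<noteq> 0" using XP_nz s by auto
  have deg: "degree r + degree s = n" using degree_XP nz by (simp add: s degree_mult_eq)
  have fib: "card {x. act s x = y} \<le> card (Ker s)" if y: "y \<in> range (act s)" for y
  proof -
    obtain x0 where x0: "y = act s x0" using y by auto
    show ?thesis by (rule card_inj_on_le[of "\<lambda>x. x - x0"]) (auto simp: inj_on_def Ker_def act_diff x0)
  qed
  have "CARD('a) = card (\<Union>y\<in>range (act s). {x. act s x = y})" by (rule arg_cong[of _ _ card]) auto
  also have "\<dots> \<le> (\<Sum>y\<in>range (act s). card {x. act s x = y})" by (rule card_UN_le) simp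
  also have "\<dots> \<le> (\<Sum>y\<in>range (act s). card (Ker s))" by (intro sum_mono fib)
  also have "\<dots> = card (range (act s)) * card (Ker s)" by simp
  also have "\<dots> \<le> card (Ker r) * q ^ degree s"
  proof (intro mult_le_mono card_mono card_Ker_le nz)
    show "range (act s) \<subseteq> Ker r" using act_XP by (auto simp: Ker_def s act_mult)
  qed simp
  finally have "q ^ degree r * q ^ degree s \<le> card (Ker r) * q ^ degree s"
    using Qq Q_card by (simp add: deg flip: power_add)
  hence "q ^ degree r \<le> card (Ker r)" using q_gt_1 by simp
  thus ?thesis using card_Ker_le[OF nz(1)] by simp
qed

text \<open>Division with remainder by an annihilating polynomial of least degree;
  \<open>act_XP\<close> ensures that one exists and that it divides \<open>XP\<close>.\<close>

lemma annihilator: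
  obtains g where "g dvd XP" "act g x = 0" "\<And>r. act r x = 0 \<Longrightarrow> g dvd r"
proof -
  define P where "P m \<longleftrightarrow> (\<exists>g. g \<noteq> 0 \<and> act g x = 0 \<and> degree g = m)" for m
  have "P n" unfolding P_def using XP_nz act_XP degree_XP by blast
  define m where "m = (LEAST m. P m)"
  have "P m" unfolding m_def by (rule LeastI) fact
  then obtain g where g: "g \<noteq> 0" "act g x = 0" "degree g = m" by (auto simp: P_def)
  have dvd: "g dvd r" if "act r x = 0" for r
  proof (rule ccontr)
    assume "\<not> g dvd r"
    hence nz: "r mod g \<noteq> 0" by (simp add: dvd_eq_mod_eq_0)
    have "act r x = act (r div g * g) x + act (r mod g) x"
      by (simp only: act_add_poly [symmetric] div_mult_mod_eq)
    hence "act (r mod g) x = 0" using that g(2) by (simp add: act_mult)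
    hence "P (degree (r mod g))" using nz by (auto simp: P_def)
    hence "m \<le> degree (r mod g)" unfolding m_def by (rule Least_le)
    thus False using degree_mod_less'[OF g(1) nz] g(3) by simp
  qed
  show ?thesis using that[OF dvd[OF act_XP] g(2) dvd] .
qed

section \<open>Subgroups obstructing normality\<close>

definition XP_factors :: "'k poly set" where "XP_factors = monic_factors XP"

lemma finite_XP_factors: "finite XP_factors"
  by (rule finite_subset[OF _ finite_divisors[OF XP_nz]]) (auto simp: XP_factors_def monic_factors_def)

text \<open>The maximal proper submodules: an element outside all of them generates the module and
  is normal.\<close>

definition defect :: "'k poly \<Rightarrow> 'a set" where "defect h = Ker (XP div h)"

text \<open>If \<open>g\<close> generates the annihilator of \<open>x\<close>, membership in
  \<open>defect h\<close> says that \<open>h\<close> divides \<open>XP div g\<close>. For distinct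
  monic irreducible \<open>h\<close> this holds jointly exactly if their product divides it.\<close>

lemma inter_defect:
  assumes "T \<subseteq> XP_factors" shows "(\<Inter>h\<in>T. defect h) = Ker (XP div \<Prod>T)"
proof -
  have fin: "finite T" using assms finite_XP_factors finite_subset by blast
  have T: "irreducible h \<and> lead_coeff h = 1 \<and> h dvd XP" if "h \<in> T" for h
    using that assms by (auto simp: XP_factors_def monic_factors_def)
  have dv: "\<Prod>T dvd XP" by (rule prod_irreducible_dvd[OF fin T])
  hence Tnz: "\<Prod>T \<noteq> 0" using XP_nz by auto
  show ?thesis
  proof (intro Set.set_eqI iffI)
    fix x assume x: "x \<in> (\<Inter>h\<in>T. defect h)"
    obtain g where g: "g dvd XP" "act g x = 0" "\<And>r. act r x = 0 \<Longrightarrow> g dvd r"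
      using annihilator by blast
    obtain s where s: "XP = g * s" using g(1) by auto
    have gnz: "g \<noteq> 0" using s XP_nz by auto
    have "h dvd s" if "h \<in> T" for h
    proof -
      have "g dvd XP div h" using x that g(3) by (auto simp: defect_def Ker_def)
      then obtain w where "XP div h = g * w" by auto
      hence "XP = h * (g * w)" using T[OF that] by (metis dvd_mult_div_cancel)
      hence "g * s = g * (h * w)" using s by (simp add: mult_ac)
      hence "s = h * w" using gnz by simp
      thus ?thesis by simp
    qed
    hence "\<Prod>T dvd s" using T by (intro prod_irreducible_dvd[OF fin]) auto
    then obtain w where w: "s = \<Prod>T * w" by auto
    have "XP div \<Prod>T = w * g" using Tnz by (simp add: s w mult_ac)
    thus "x \<in> Ker (XP div \<Prod>T)" by (simp add: Ker_def act_mult g(2))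
  next
    fix x assume x: "x \<in> Ker (XP div \<Prod>T)"
    have "x \<in> defect h" if "h \<in> T" for h
    proof -
      have hnz: "h \<noteq> 0" using T[OF that] XP_nz by auto
      have "XP = (XP div \<Prod>T) * (h * \<Prod>(T - {h}))"
        using dv prod.remove[OF fin that, of "\<lambda>x. x"] by (metis dvd_div_mult_self)
      hence "XP div h = \<Prod>(T - {h}) * (XP div \<Prod>T)"
        using hnz by (metis mult.assoc mult.commute nonzero_mult_div_cancel_left)
      thus ?thesis using x by (simp add: defect_def Ker_def act_mult)
    qed
    thus "x \<in> (\<Inter>h\<in>T. defect h)" by simp
  qed
qed

lemma card_inter_defect:
  assumes "T \<subseteq> XP_factors"
  shows "real (card (\<Inter>h\<in>T. defect h)) = real Q * (\<Prod>h\<in>T. 1 / real q ^ degree h)"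
proof -
  have fin: "finite T" using assms finite_XP_factors finite_subset by blast
  have T: "irreducible h \<and> lead_coeff h = 1 \<and> h dvd XP" if "h \<in> T" for h
    using that assms by (auto simp: XP_factors_def monic_factors_def)
  have dv: "\<Prod>T dvd XP" by (rule prod_irreducible_dvd[OF fin T])
  then obtain s where s: "XP = \<Prod>T * s" by auto
  have nz: "\<Prod>T \<noteq> 0" "s \<noteq> 0" using s XP_nz by auto
  have deg: "degree (\<Prod>T) = (\<Sum>h\<in>T. degree h)"
    using degree_prod_eq_sum_degree[of T "\<lambda>x. x"] nz(1) fin by auto
  have n_eq: "n = (\<Sum>h\<in>T. degree h) + degree s" using degree_XP nz by (simp add: s degree_mult_eq deg)
  have "XP div \<Prod>T = s" using nz by (simp add: s)
  hence "card (\<Inter>h\<in>T. defect h) = q ^ degree s"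
    unfolding inter_defect[OF assms] using s by (simp add: card_Ker)
  moreover have "real Q = real q ^ degree s * (\<Prod>h\<in>T. real q ^ degree h)"
    by (simp add: Qq n_eq power_add power_sum)
  ultimately show ?thesis using q_gt_1 fin by (simp add: prod_dividef)
qed

lemma card_defect: "h \<in> XP_factors \<Longrightarrow> real (card (defect h)) / real Q = 1 / real q ^ degree h"
  using card_inter_defect[of "{h}"] Q_gt_1 by simp

text \<open>Inclusion-exclusion without an alternating sum: the additional set \<open>S\<close> of
  defects to be met lets each step split by membership in one more \<open>defect h\<close>.\<close>

lemma card_avoid:
  assumes "finite T" "T \<subseteq> XP_factors" "S \<subseteq> XP_factors" "T \<inter> S = {}"
  shows "real (card {x. (\<forall>h\<in>S. x \<in> defect h) \<and> (\<forall>h\<in>T. x \<notin> defect h)}) =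
    real Q * (\<Prod>h\<in>S. 1 / real q ^ degree h) * (\<Prod>h\<in>T. 1 - 1 / real q ^ degree h)"
  using assms
proof (induction T arbitrary: S rule: finite_induct)
  case empty
  have "{x. \<forall>h\<in>S. x \<in> defect h} = (\<Inter>h\<in>S. defect h)" by auto
  thus ?case using card_inter_defect[of S] empty by simp
next
  case (insert h T)
  have finS: "finite S" using insert.prems finite_XP_factors finite_subset by blast
  define E where "E S T = {x. (\<forall>h\<in>S. x \<in> defect h) \<and> (\<forall>h\<in>T. x \<notin> defect h)}" for S T
  have "E S T = E S (insert h T) \<union> E (insert h S) T" "E S (insert h T) \<inter> E (insert h S) T = {}"
    by (auto simp: E_def)
  hence "card (E S T) = card (E S (insert h T)) + card (E (insert h S) T)"
    by (simp add: card_Un_disjoint)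
  moreover have "real (card (E S T)) = real Q * (\<Prod>h\<in>S. 1 / real q ^ degree h) * (\<Prod>h\<in>T. 1 - 1 / real q ^ degree h)"
    unfolding E_def using insert by auto
  moreover have "real (card (E (insert h S) T)) = real Q * (\<Prod>h\<in>insert h S. 1 / real q ^ degree h) * (\<Prod>h\<in>T. 1 - 1 / real q ^ degree h)"
    unfolding E_def by (rule insert.IH) (use insert in auto)
  moreover have "h \<notin> S" using insert.prems by auto
  ultimately have "real (card (E S (insert h T))) = real Q * (\<Prod>h\<in>S. 1 / real q ^ degree h) * (\<Prod>h\<in>insert h T. 1 - 1 / real q ^ degree h)"
    using insert.hyps finS by (simp add: algebra_simps)
  thus ?case by (simp only: E_def)
qed

definition nrm_ind :: "'a \<Rightarrow> complex" where
  "nrm_ind x = (\<Prod>h\<in>XP_factors. if x \<in> defect h then 0 else 1)"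

definition \<Theta> :: real where "\<Theta> = (\<Prod>h\<in>XP_factors. 1 - 1 / real q ^ degree h)"

lemma XP_factors_degree: "h \<in> XP_factors \<Longrightarrow> degree h > 0"
proof -
  assume "h \<in> XP_factors"
  hence "irreducible h" "h \<noteq> 0" by (auto simp: XP_factors_def monic_factors_def)
  thus ?thesis by (metis irreducible_not_unit is_unit_iff_degree neq0_conv)
qed

lemma Theta_pos: "\<Theta> > 0"
  unfolding \<Theta>_def
proof (rule prod_pos)
  fix h assume "h \<in> XP_factors"
  hence "real q ^ degree h > 1" using q_gt_1 XP_factors_degree by (intro one_less_power) auto
  moreover have "1 / a < 1" if "a > 1" for a :: real using that by simp
  ultimately show "1 - 1 / real q ^ degree h > 0" by (simp only: diff_gt_0_iff_gt)
qed

lemma nrm_ind_eq: "nrm_ind x = (if \<forall>h\<in>XP_factors. x \<notin> defect h then 1 else 0)"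
  using finite_XP_factors by (auto simp: nrm_ind_def intro: prod_zero)

lemma nrm_ind_expansion:
  obtains b where "\<And>x. nrm_ind x = (\<Sum>c\<in>UNIV. b c * achar c x)"
    "(\<Sum>c\<in>UNIV. norm (b c)) \<le> \<Theta> * 2 ^ card XP_factors" "b 0 = of_real \<Theta>"
proof -
  have "wiener achar UNIV UNIV (\<lambda>x. \<Prod>h\<in>XP_factors. if x \<in> defect h then 0 else 1)
     (\<Prod>h\<in>XP_factors. 2 * (1 - 1 / real q ^ degree h))"
  proof (rule wiener_prod[where m = "\<lambda>u v. u + v" and ?i0.0 = 0])
    show "wiener achar UNIV UNIV (\<lambda>x. if x \<in> defect h then 0 else 1) (2 * (1 - 1 / real q ^ degree h))"
      if "h \<in> XP_factors" for h
      unfolding card_defect[OF that, symmetric]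
      by (rule wiener_nonmember) (auto simp: defect_def Ker_def act_add act_minus)
  qed (use finite_XP_factors in \<open>auto simp: achar_add_left achar_0_left\<close>)
  then obtain b where b: "\<And>x. nrm_ind x = (\<Sum>c\<in>UNIV. b c * achar c x)"
    "(\<Sum>c\<in>UNIV. norm (b c)) \<le> (\<Prod>h\<in>XP_factors. 2 * (1 - 1 / real q ^ degree h))"
    unfolding wiener_def nrm_ind_def by auto
  have "(\<Sum>x\<in>UNIV. nrm_ind x) = of_nat (card {x. (\<forall>h\<in>{}. x \<in> defect h) \<and> (\<forall>h\<in>XP_factors. x \<notin> defect h)})"
    by (simp add: nrm_ind_eq sum.If_cases)
  also have "\<dots> = complex_of_real (real (card {x. (\<forall>h\<in>{}. x \<in> defect h) \<and> (\<forall>h\<in>XP_factors. x \<notin> defect h)}))" by simp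
  also have "\<dots> = of_real (real Q * \<Theta>)"
    by (subst card_avoid) (use finite_XP_factors in \<open>auto simp: \<Theta>_def\<close>)
  finally have s1: "(\<Sum>x\<in>UNIV. nrm_ind x) = of_real (real Q * \<Theta>)" .
  have "(\<Sum>x\<in>UNIV. nrm_ind x) = (\<Sum>c\<in>UNIV. b c * (\<Sum>x\<in>UNIV. achar c x))"
    by (simp only: b(1) sum_distrib_left) (rule sum.swap)
  also have "\<dots> = b 0 * of_nat Q"
    by (simp add: sum_achar if_distrib[of "\<lambda>z. _ * z"] cong: if_cong)
  finally have e1: "(\<Sum>x\<in>UNIV. nrm_ind x) = b 0 * of_nat Q" .
  have eq: "b 0 * of_nat Q = of_real \<Theta> * of_nat Q"
    unfolding e1 [symmetric] s1 by (simp add: mult.commute)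
  have "of_nat Q \<noteq> (0 :: complex)" using Q_gt_1 by simp
  from mult_right_cancel[THEN iffD1, OF this eq] have "b 0 = of_real \<Theta>" .
  moreover have "(\<Prod>h\<in>XP_factors. 2 * (1 - 1 / real q ^ degree h)) = \<Theta> * 2 ^ card XP_factors"
    by (simp only: prod.distrib \<Theta>_def prod_constant mult.commute)
  ultimately show ?thesis using that[of b] b by simp
qed

text \<open>A nonzero \<open>r\<close> of degree below \<open>n\<close> with
  \<open>act r x = 0\<close> would make the annihilator of \<open>x\<close> a proper divisor of
  \<open>XP\<close>, and any irreducible factor \<open>h\<close> of the cofactor puts
  \<open>x\<close> into \<open>defect h\<close>. So the conjugates are independent, and a count of
  combinations shows that they span.\<close>

lemma normal_if_avoids:
  assumes "\<forall>h\<in>XP_factors. x \<notin> defect h" shows "normal_elem \<iota> n x"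
proof -
  have free: "r = 0" if "act r x = 0" "degree r < n" for r
  proof (rule ccontr)
    assume "r \<noteq> 0"
    obtain g where g: "g dvd XP" "act g x = 0" "\<And>r. act r x = 0 \<Longrightarrow> g dvd r"
      using annihilator by blast
    obtain s where s: "XP = g * s" using g(1) by auto
    have nz: "g \<noteq> 0" "s \<noteq> 0" using s XP_nz by auto
    have "degree g \<le> degree r" using g(3)[OF that(1)] \<open>r \<noteq> 0\<close> by (rule dvd_imp_degree_le)
    moreover have "degree g + degree s = n" using degree_XP nz by (simp add: s degree_mult_eq)
    ultimately have "degree s > 0" using that by simp
    then obtain h where h: "irreducible h" "lead_coeff h = 1" "h dvd s" by (rule monic_irreducible_factor)
    obtain w where w: "s = h * w" using h(3) by auto
    have hnz: "h \<noteq> 0" using nz w by auto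
    have "h \<in> XP_factors" using h by (auto simp: XP_factors_def monic_factors_def s)
    moreover have "XP div h = w * g" using hnz by (simp add: s w mult.left_commute[of g h] mult.commute)
    hence "x \<in> defect h" by (simp add: defect_def Ker_def act_mult g(2))
    ultimately show False using assms by auto
  qed
  have free': "f i = 0" if "(\<Sum>i<n. \<iota> (f i) * x ^ q ^ i) = 0" "i < n" for f i
  proof -
    define r where "r = (\<Sum>i<n. monom (f i) i)"
    have co: "coeff r i = (if i < n then f i else 0)" for i by (simp add: r_def coeff_sum)
    have "degree r \<le> n - 1" using n by (intro degree_le) (auto simp: co)
    hence "act r x = (\<Sum>i\<le>n-1. \<iota> (coeff r i) * x ^ q ^ i)" by (rule act_bound)
    also have "{..n-1} = {..<n}" using n by auto
    finally have "act r x = 0" using that(1) by (simp add: co)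
    hence "r = 0" using \<open>degree r \<le> n - 1\<close> n by (intro free) auto
    thus ?thesis using co[of i] that(2) by simp
  qed
  define B where "B = {x ^ (CARD('k) ^ i) | i. i < n}"
  have B: "B = (\<lambda>i. x ^ q ^ i) ` {..<n}" by (auto simp: B_def q)
  \<comment> \<open>Coinciding conjugates would collapse in the set \<open>B\<close> and hide a
    dependence of the family; their difference is excluded as a linear relation.\<close>
  have inj: "inj_on (\<lambda>i. x ^ q ^ i) {..<n}"
  proof (rule inj_onI)
    fix i j assume ij: "i \<in> {..<n}" "j \<in> {..<n}" "x ^ q ^ i = x ^ q ^ j"
    show "i = j"
    proof (rule ccontr)
      assume "i \<noteq> j"
      define f :: "nat \<Rightarrow> 'k" where "f k = (if k = i then 1 else if k = j then -1 else 0)" for k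
      have "(\<Sum>k<n. \<iota> (f k) * x ^ q ^ k) = (\<Sum>k\<in>{i, j}. \<iota> (f k) * x ^ q ^ k)"
        using ij by (intro sum.mono_neutral_right) (auto simp: f_def io.hom_zero)
      also have "\<dots> = 0" using \<open>i \<noteq> j\<close> ij(3) by (simp add: f_def io.hom_one io.hom_minus)
      finally have "f i = 0" using ij by (intro free'[of f]) auto
      thus False by (simp add: f_def)
    qed
  qed
  interpret vs: vector_space "ext_scale \<iota>" by (rule vector_space_ext_scale[OF emb])
  have "\<not> vs.dependent B"
  proof
    assume "vs.dependent B"
    then obtain u where u: "\<exists>v\<in>B. u v \<noteq> 0" "(\<Sum>v\<in>B. \<iota> (u v) * v) = 0"
      using vs.dependent_finite[of B] by (auto simp: B)
    have "(\<Sum>i<n. \<iota> (u (x ^ q ^ i)) * x ^ q ^ i) = 0"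
      using u(2) unfolding B by (simp add: sum.reindex[OF inj])
    hence "u (x ^ q ^ i) = 0" if "i < n" for i using free'[of "\<lambda>i. u (x ^ q ^ i)"] that by simp
    thus False using u(1) by (auto simp: B)
  qed
  moreover have "vs.span B = UNIV"
  proof -
    \<comment> \<open>An injective map from the \<open>q ^ n\<close> coefficient tuples into a field
      of that size is surjective.\<close>
    define \<Phi> where "\<Phi> f = (\<Sum>i<n. \<iota> (f i) * x ^ q ^ i)" for f
    have "inj_on \<Phi> ({..<n} \<rightarrow>\<^sub>E UNIV)"
    proof (rule inj_onI)
      fix f g assume fg: "f \<in> {..<n} \<rightarrow>\<^sub>E UNIV" "g \<in> {..<n} \<rightarrow>\<^sub>E UNIV" "\<Phi> f = \<Phi> g"
      have "(\<Sum>i<n. \<iota> (f i - g i) * x ^ q ^ i) = 0"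
        using fg(3) by (simp add: \<Phi>_def io.hom_diff left_diff_distrib sum_subtractf)
      hence "f i - g i = 0" if "i < n" for i using free'[of "\<lambda>i. f i - g i"] that by simp
      thus "f = g" using fg(1,2) by (intro PiE_ext[of f "{..<n}" "\<lambda>_. UNIV" g]) auto
    qed
    hence "card (\<Phi> ` ({..<n} \<rightarrow>\<^sub>E (UNIV :: 'k set))) = CARD('a)"
      using Qq Q_card by (simp add: card_image card_PiE q)
    hence "\<Phi> ` ({..<n} \<rightarrow>\<^sub>E (UNIV :: 'k set)) = UNIV"
      by (intro card_eq_UNIV_imp_eq_UNIV) auto
    hence surj: "\<exists>f. y = \<Phi> f" for y by blast
    have "\<Phi> f \<in> vs.span B" for f
      unfolding \<Phi>_def
    proof (rule vs.span_sum)
      fix i assume "i \<in> {..<n}"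
      hence "x ^ q ^ i \<in> vs.span B" by (intro vs.span_base) (simp add: B)
      thus "\<iota> (f i) * x ^ q ^ i \<in> vs.span B" by (rule vs.span_scale)
    qed
    hence "y \<in> vs.span B" for y using surj[of y] by auto
    thus ?thesis by auto
  qed
  ultimately show ?thesis unfolding normal_elem_def B_def [symmetric] Let_def by blast
qed

end

section \<open>Primitive normal elements with primitive image\<close>

lemma sum_product3:
  "(\<Sum>i\<in>A. f i) * (\<Sum>j\<in>B. g j) * (\<Sum>k\<in>C. h k) = (\<Sum>i\<in>A. \<Sum>j\<in>B. \<Sum>k\<in>C. f i * g j * h k)"
  for f :: "_ \<Rightarrow> 'z :: comm_semiring_0"
proof -
  define z where "z = (\<Sum>k\<in>C. h k)"
  have "(\<Sum>i\<in>A. f i) * (\<Sum>j\<in>B. g j) * z = (\<Sum>i\<in>A. \<Sum>j\<in>B. f i * g j * z)"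
    unfolding sum_product by (simp only: sum_distrib_right)
  thus ?thesis unfolding z_def by (simp only: sum_distrib_left)
qed

context finite_extension
begin

text \<open>If no such \<open>x\<close> existed, the product of the three indicators would vanish on
  \<open>good f1 f2\<close>. Expanded in characters, the trivial triple would then have to be
  cancelled by mixed sums that are too small.\<close>

lemma exists_good_element:
  assumes f: "f1 \<noteq> 0" "f2 \<noteq> 0" "coprime f1 f2"
    and g: "irreducible g" "lead_coeff g = 1" "g \<noteq> [:0, 1:]"
    and a: "a > 0" "g ^ a dvd f1 * f2" "\<not> g ^ (a + 1) dvd f1 * f2" "coprime a N"
    and large: "sqrt (real Q) \<ge> real (degree f1 + degree f2 + 1) * (2 ^ card (prime_factors N)) ^ 2 * 2 ^ card XP_factors"
  shows "\<exists>x. primitive_elem x \<and> normal_elem \<iota> n x \<and> poly f2 x \<noteq> 0 \<and> primitive_elem (poly f1 x / poly f2 x)"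
proof (rule ccontr)
  assume none: "\<not> ?thesis"
  obtain \<alpha> where \<alpha>: "\<And>x. x \<noteq> 0 \<Longrightarrow> prim_ind x = (\<Sum>u<N. \<alpha> u * mchar u x)"
    "(\<Sum>u<N. norm (\<alpha> u)) \<le> \<theta> * 2 ^ card (prime_factors N)" "\<alpha> 0 = of_real \<theta>"
    using prim_ind_expansion by blast
  obtain b where b: "\<And>x. nrm_ind x = (\<Sum>c\<in>UNIV. b c * achar c x)"
    "(\<Sum>c\<in>UNIV. norm (b c)) \<le> \<Theta> * 2 ^ card XP_factors" "b 0 = of_real \<Theta>"
    using nrm_ind_expansion by blast
  define Gd where "Gd = good f1 f2"
  have zero: "prim_ind x * prim_ind (poly f1 x / poly f2 x) * nrm_ind x = 0" if "x \<in> Gd" for x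
  proof (rule ccontr)
    assume "prim_ind x * prim_ind (poly f1 x / poly f2 x) * nrm_ind x \<noteq> 0"
    hence "coprime (ind x) N" "coprime (ind (poly f1 x / poly f2 x)) N" "\<forall>h\<in>XP_factors. x \<notin> defect h"
      by (auto simp: prim_ind_eq nrm_ind_eq split: if_splits)
    moreover have "x \<noteq> 0" "poly f1 x / poly f2 x \<noteq> 0" "poly f2 x \<noteq> 0"
      using that by (auto simp: Gd_def good_def)
    ultimately show False using none primitive_if_coprime normal_if_avoids by blast
  qed
  define I where "I = {..<N} \<times> {..<N} \<times> (UNIV :: 'a set)"
  have finI: "finite I" by (simp add: I_def)
  define C where "C = (\<lambda>(u, v, c). \<alpha> u * \<alpha> v * b c)"
  define M where "M = (\<lambda>(u, v, c). mixed_sum f1 f2 u v c)"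
  have expand: "0 = (\<Sum>i\<in>I. C i * M i)"
  proof -
    have "0 = (\<Sum>x\<in>Gd. prim_ind x * prim_ind (poly f1 x / poly f2 x) * nrm_ind x)"
      by (rule sum.neutral [symmetric]) (use zero in blast)
    also have "\<dots> = (\<Sum>x\<in>Gd. \<Sum>(u, v, c)\<in>I. C (u, v, c) * (mchar u x * mchar v (poly f1 x / poly f2 x) * achar c x))"
    proof (intro sum.cong refl)
      fix x assume "x \<in> Gd"
      hence nz: "x \<noteq> 0" "poly f1 x / poly f2 x \<noteq> 0" by (auto simp: Gd_def good_def)
      have "prim_ind x * prim_ind (poly f1 x / poly f2 x) * nrm_ind x =
        (\<Sum>u<N. \<Sum>v<N. \<Sum>c\<in>UNIV. (\<alpha> u * mchar u x) * (\<alpha> v * mchar v (poly f1 x / poly f2 x)) * (b c * achar c x))"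
        unfolding \<alpha>(1)[OF nz(1)] \<alpha>(1)[OF nz(2)] b(1)
        by (rule sum_product3)
      also have "\<dots> = (\<Sum>(u, v, c)\<in>I. C (u, v, c) * (mchar u x * mchar v (poly f1 x / poly f2 x) * achar c x))"
        by (simp add: I_def C_def sum.cartesian_product split_def mult_ac)
      finally show "prim_ind x * prim_ind (poly f1 x / poly f2 x) * nrm_ind x =
        (\<Sum>(u, v, c)\<in>I. C (u, v, c) * (mchar u x * mchar v (poly f1 x / poly f2 x) * achar c x))" .
    qed
    also have "\<dots> = (\<Sum>i\<in>I. C i * M i)"
      by (subst sum.swap) (simp add: M_def mixed_sum_def sum_distrib_left Gd_def split_def)
    finally show ?thesis .
  qed
  define D where "D = real (degree f1 + degree f2 + 1)"
  define i0 :: "nat \<times> nat \<times> 'a" where "i0 = (0, 0, 0)"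
  have i0: "i0 \<in> I" using N_pos by (simp add: i0_def I_def)
  \<comment> \<open>The coefficient of the trivial triple. It is a common factor of all estimates
    and cancels at the end.\<close>
  define m where "m = \<theta> ^ 2 * \<Theta>"
  have m: "m > 0" using theta_pos Theta_pos by (simp add: m_def)
  have C0: "C i0 = complex_of_real m"
    by (simp add: C_def i0_def \<alpha>(3) b(3) m_def power2_eq_square)
  have M0: "M i0 = of_nat (card Gd)"
    by (simp add: M_def i0_def mixed_sum_def Gd_def good_def mchar_zero achar_0_left)
  define L where "L = (2 ^ card (prime_factors N)) ^ 2 * (2 ^ card XP_factors :: real)"
  have sumC: "(\<Sum>i\<in>I. norm (C i)) \<le> m * L"
  proof -
    have "(\<Sum>i\<in>I. norm (C i)) = (\<Sum>u<N. \<Sum>v<N. \<Sum>c\<in>UNIV. norm (\<alpha> u) * norm (\<alpha> v) * norm (b c))"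
      by (simp add: I_def C_def norm_mult sum.cartesian_product split_def)
    also have "\<dots> = (\<Sum>u<N. norm (\<alpha> u)) * (\<Sum>u<N. norm (\<alpha> u)) * (\<Sum>c\<in>UNIV. norm (b c))"
      by (rule sum_product3 [symmetric])
    also have "\<dots> = (\<Sum>u<N. norm (\<alpha> u)) * ((\<Sum>u<N. norm (\<alpha> u)) * (\<Sum>c\<in>UNIV. norm (b c)))"
      by (rule mult.assoc)
    also have "\<dots> \<le> (\<theta> * 2 ^ card (prime_factors N)) * ((\<theta> * 2 ^ card (prime_factors N)) * (\<Theta> * 2 ^ card XP_factors))"
      using theta_pos Theta_pos by (intro mult_mono \<alpha> b mult_nonneg_nonneg sum_nonneg) auto
    finally show ?thesis by (simp add: m_def L_def power2_eq_square mult_ac)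
  qed
  have Mle: "norm (M i) \<le> D * sqrt (real Q)" if "i \<in> I - {i0}" for i
  proof -
    obtain u v c where i: "i = (u, v, c)" by (cases i)
    have "norm (mixed_sum f1 f2 u v c) \<le> real (degree f1 + degree f2 + 1) * sqrt (real Q)"
      by (rule mixed_sum_bound[OF f g a]) (use that in \<open>auto simp: i i0_def I_def\<close>)
    thus ?thesis by (simp add: i M_def D_def)
  qed
  have "m * real (card Gd) = norm (C i0 * M i0)" using m by (simp add: C0 M0 norm_mult)
  also have "C i0 * M i0 = - (\<Sum>i\<in>I - {i0}. C i * M i)"
    using expand sum.remove[OF finI i0, of "\<lambda>i. C i * M i"] by (simp add: eq_neg_iff_add_eq_0)
  also have "norm (- (\<Sum>i\<in>I - {i0}. C i * M i)) \<le> (\<Sum>i\<in>I - {i0}. norm (C i) * (D * sqrt (real Q)))"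
    unfolding norm_minus_cancel
    by (rule order.trans[OF norm_sum], rule sum_mono) (auto simp: norm_mult intro!: mult_left_mono Mle)
  also have "\<dots> = ((\<Sum>i\<in>I. norm (C i)) - m) * (D * sqrt (real Q))"
    using sum.remove[OF finI i0, of "\<lambda>i. norm (C i)"] m by (simp add: sum_distrib_right C0)
  also have "\<dots> \<le> (m * L - m) * (D * sqrt (real Q))"
    using sumC by (intro mult_right_mono) (auto simp: D_def)
  finally have "m * real (card Gd) \<le> m * ((L - 1) * (D * sqrt (real Q)))" by (simp add: algebra_simps)
  hence up: "real (card Gd) \<le> (L - 1) * (D * sqrt (real Q))" using m by simp
  have "card (UNIV - Gd) = Q - card Gd" by (simp add: card_Diff_subset Q_card)
  hence lo: "real Q - D \<le> real (card Gd)"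
    using card_bad[OF f(1,2)] unfolding D_def Gd_def by linarith
  have "D * L * sqrt (real Q) \<le> sqrt (real Q) * sqrt (real Q)"
    using large by (intro mult_right_mono) (auto simp: D_def L_def mult.assoc)
  hence "D * L * sqrt (real Q) \<le> real Q" by simp
  \<comment> \<open>Leaving out the trivial triple reduced \<open>L\<close> to \<open>L - 1\<close>;
    the spare \<open>D * sqrt (real Q)\<close> exceeds the at most \<open>D\<close> excluded
    points.\<close>
  hence "D * sqrt (real Q) \<le> D * 1" using up lo by (simp add: algebra_simps)
  moreover have "D > 0" by (simp add: D_def)
  ultimately have "sqrt (real Q) \<le> 1" by simp
  thus False using Q_gt_1 by simp
qed

end

theorem corollary3p3:
  fixes q n m1 m2 :: nat
    and \<iota> :: "'k :: {field, finite} \<Rightarrow> 'a :: {field, finite}"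
  assumes "primepow q" and "n \<ge> 3" and "m1 > 0" and "m2 > 0"
    and "CARD('k) = q" and "CARD('a) = q ^ n" and "field_embedding \<iota>"
    and "real q powr (real n / 2) \<ge>
           real (m1 + m2 + 1) * real (W (q ^ n - 1)) ^ 2 * real (W_poly (monom 1 n - 1 :: 'k poly))"
  shows "\<forall>f \<in> (Upsilon m1 m2 :: 'a poly fract set).
           \<exists>\<alpha> :: 'a. primitive_elem \<alpha> \<and> normal_elem \<iota> n \<alpha> \<and>
             (\<exists>v. ratfun_value f \<alpha> v \<and> primitive_elem v)"
proof
  fix f :: "'a poly fract"
  assume "f \<in> Upsilon m1 m2"
  then obtain f1 f2 a g where f: "f = Fract f1 f2" "f2 \<noteq> 0" "degree f1 \<le> m1" "degree f2 \<le> m2" "coprime f1 f2"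
    and g: "irreducible g" "lead_coeff g = 1" "g \<noteq> [:0, 1:]"
    and a: "a > 0" "g ^ a dvd f1 * f2" "\<not> g ^ (a + 1) dvd f1 * f2" "coprime a (CARD('a) - 1)"
    by (auto simp: Upsilon_def)
  \<comment> \<open>Otherwise \<open>g ^ (a + 1)\<close> would divide
    \<open>f1 * f2 = 0\<close>.\<close>
  have f1: "f1 \<noteq> 0" using a(3) by auto
  obtain p s where ps: "prime p" "s > 0" "q = p ^ s" using assms(1) by (auto simp: primepow_def)
  obtain \<gamma> :: 'a where gen: "\<gamma> \<noteq> 0" "\<And>x. x \<noteq> 0 \<Longrightarrow> \<exists>i. x = \<gamma> ^ i"
    using finite_field_generator by blast
  interpret finite_extension \<gamma> "q ^ n" p "s * n" \<iota> q n
    by unfold_locales (use assms gen ps in \<open>auto simp: power_mult\<close>)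
  have D: "real (degree f1 + degree f2 + 1) \<le> real (m1 + m2 + 1)" using f by simp
  have W1: "(2 ^ card (prime_factors N) :: real) \<le> real (W (q ^ n - 1))"
    using W_ge[OF N_pos] unfolding N_def by (metis of_nat_le_iff of_nat_numeral of_nat_power)
  have W2: "(2 ^ card XP_factors :: real) \<le> real (W_poly (monom 1 n - 1 :: 'k poly))"
    using W_poly_ge[OF XP_nz] unfolding XP_factors_def XP_def by (metis of_nat_le_iff of_nat_numeral of_nat_power)
  have "real (degree f1 + degree f2 + 1) * (2 ^ card (prime_factors N)) ^ 2 * 2 ^ card XP_factors
      \<le> real (m1 + m2 + 1) * real (W (q ^ n - 1)) ^ 2 * real (W_poly (monom 1 n - 1 :: 'k poly))"
    by (intro mult_mono power_mono D W1 W2) auto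
  also have "\<dots> \<le> real q powr (real n / 2)" by fact
  also have "\<dots> = sqrt (real (q ^ n))"
    using q_gt_1 by (simp add: powr_half_sqrt [symmetric] powr_powr flip: powr_realpow)
  finally have large: "real (degree f1 + degree f2 + 1) * (2 ^ card (prime_factors N)) ^ 2 * 2 ^ card XP_factors
      \<le> sqrt (real (q ^ n))" .
  have "coprime a N" using a(4) assms(6) by (simp add: N_def)
  from exists_good_element[OF f1 f(2,5) g a(1-3) this large] obtain x where
    x: "primitive_elem x" "normal_elem \<iota> n x" "poly f2 x \<noteq> 0" "primitive_elem (poly f1 x / poly f2 x)"
    by blast
  moreover have "ratfun_value f x (poly f1 x / poly f2 x)"
    using f x(3) by (auto simp: ratfun_value_def)
  ultimately show "\<exists>\<alpha>. primitive_elem \<alpha> \<and> normal_elem \<iota> n \<alpha> \<and> (\<exists>v. ratfun_value f \<alpha> v \<and> primitive_elem v)"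
    by blast
qed

end
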